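(* Let $(\mathcal{A}, \mathbb{E}, \mathbb{F}, \varepsilon)$ be a $\mathcal{B}$-$\mathcal{B}$-non-commutative probability space with a pair of $(\mathcal{B}, \mathcal{D})$-valued expectations. The operator-valued conditionally bi-free moment pair $(\mathcal{E}, \mathcal{F})$ on $\mathcal{A}$ is operator-valued conditionally bi-multiplicative.
   Context: All algebras are over $\mathbb{C}$. Spaces. A $\mathcal{B}$-$\mathcal{B}$-non-commutative probability space with a pair of $(\mathcal{B},\mathcal{D})$-valued expectations is a quadruple $(\mathcal{A},\mathbb{E},\mathbb{F},\varepsilon)$ where $\mathcal{A},\mathcal{B},\mathcal{D}$ are unital algebras with $1:=1_{\mathcal{D}}\in\mathcal{B}\subset\mathcal{D}$, $\varepsilon:\mathcal{B}\otimes\mathcal{B}^{\mathrm{op}}\to\mathcal{A}$ is a unital homomorphism whose restrictions to $\mathcal{B}\otimes 1$ and $1\otimes\mathcal{B}^{\mathrm{op}}$ are injective, and $\mathbb{E}:\mathcal{A}\to\mathcal{B}$, $\mathbb{F}:\mathcal{A}\to\mathcal{D}$ are unital linear maps such that, writing $L_b=\varepsilon(b\otimes 1)$ and $R_b=\varepsilon(1\otimes b)$, for all $b_1,b_2,b\in\mathcal{B}$ and $Z\in\mathcal{A}$: $\mathbb{E}(L_{b_1}R_{b_2}Z)=b_1\mathbb{E}(Z)b_2$, $\mathbb{E}(ZL_b)=\mathbb{E}(ZR_b)$, $\mathbb{F}(L_{b_1}R_{b_2}Z)=b_1\mathbb{F}(Z)b_2$, $\mathbb{F}(ZL_b)=\mathbb{F}(ZR_b)$.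 Set $\mathcal{A}_\ell=\{Z\in\mathcal{A}: ZR_b=R_bZ\ \forall b\in\mathcal{B}\}$ and $\mathcal{A}_r=\{Z\in\mathcal{A}: ZL_b=L_bZ\ \forall b\in\mathcal{B}\}$. Bi-non-crossing partitions. For $\chi:\{1,\dots,n\}\to\{\ell,r\}$ with $\chi^{-1}(\ell)=\{i_1<\dots<i_p\}$ and $\chi^{-1}(r)=\{j_1<\dots<j_{n-p}\}$, $\prec_\chi$ is the total order $i_1\prec_\chi\dots\prec_\chi i_p\prec_\chi j_{n-p}\prec_\chi\dots\prec_\chi j_1$. A $\chi$-interval is an interval for $\prec_\chi$. $\mathcal{BNC}(\chi)$ is the lattice (under refinement) of partitions of $\{1,\dots,n\}$ that are non-crossing with respect to $\prec_\chi$; $1_\chi$ is the one-block partition. For a subset $V$, $\pi|_V$, $\chi|_V$ and $(Z_1,\dots,Z_n)|_V$ denote restriction to the indices in $V$ (relabelled in increasing order). $\min(V)$ is for the usual order; $\min_{\prec_\chi},\max_{\prec_\chi}$ for $\prec_\chi$. A block $V$ of $\pi$ is interior if there is another block $W$ of $\pi$ with $\min_{\prec_\chi}(W)\prec_\chi\min_{\prec_\chi}(V)$ and $\max_{\prec_\chi}(V)\prec_\chi\max_{\prec_\chi}(W)$; otherwise it is exterior. The function $\mathcal{E}$. For $\pi\in\mathcal{BNC}(\chi)$ and $Z_1,\dots,Z_n\in\mathcal{A}$ define $\mathcal{E}_\pi(Z_1,\dots,Z_n)\in\mathcal{B}$ recursively. If $\pi=1_\chi$, it is $\mathbb{E}(Z_1\cdots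 Z_n)$. Otherwise let $V=\{v_1<\dots<v_s\}$ be the block with the largest $\min(V)$, $m=\min(V)$, $b=\mathbb{E}(Z_{v_1}\cdots Z_{v_s})$, and $T_b=L_b$ if $\chi(m)=\ell$, $T_b=R_b$ if $\chi(m)=r$. If $V=\{m,\dots,n\}$, then $\mathcal{E}_\pi(Z_1,\dots,Z_n)=\mathcal{E}_{\pi|_{V^\complement}}(Z_1,\dots,Z_{m-2},Z_{m-1}T_b)$. Otherwise let $W$ be the block whose spine is adjacent to $\min(V)$ in the bi-non-crossing diagram of $\pi$, i.e. the block containing the $\prec_\chi$-smallest (if $\chi(m)=\ell$) or $\prec_\chi$-largest (if $\chi(m)=r$) element of those $j\in\{m+1,\dots,n\}\setminus V$ whose block contains an element smaller than $m$, let $k=\min\{j\in W: j>m\}$, and set $\mathcal{E}_\pi(Z_1,\dots,Z_n)=\mathcal{E}_{\pi|_{V^\complement}}((Z_1,\dots,Z_{k-1},T_bZ_k,Z_{k+1},\dots,Z_n)|_{V^\complement})$. The function $\mathcal{F}$. For $\pi\in\mathcal{BNC}(\chi)$ and $Z_1,\dots,Z_n\in\mathcal{A}$ define $\mathcal{F}_\pi(Z_1,\dots,Z_n)\in\mathcal{D}$ as follows. If $\pi=1_\chi$, it is $\mathbb{F}(Z_1\cdots Z_n)$. If $\pi$ has no interior block, its blocks are $\chi$-intervals $V_1,\dots,V_t$, ordered by $\prec_\chi$, and $\mathcal{F}_\pi(Z_1,\dots,Z_n)=\mathcal{F}_{\pi|_{V_1}}((Z_1,\dots,Z_n)|_{V_1})\cdots\mathcal{F}_{\pi|_{V_t}}((Z_1,\dots,Z_n)|_{V_t})$.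 Otherwise let $V$ be the interior block with the largest $\min(V)$, and with $m,b,T_b,W,k$ defined exactly as in the definition of $\mathcal{E}_\pi$ (so $b=\mathbb{E}$ of the ordered product over $V$), set $\mathcal{F}_\pi(Z_1,\dots,Z_n)=\mathcal{F}_{\pi|_{V^\complement}}(Z_1,\dots,Z_{m-2},Z_{m-1}T_b)$ if $V=\{m,\dots,n\}$, and $\mathcal{F}_\pi(Z_1,\dots,Z_n)=\mathcal{F}_{\pi|_{V^\complement}}((Z_1,\dots,Z_{k-1},T_bZ_k,Z_{k+1},\dots,Z_n)|_{V^\complement})$ otherwise. The operator-valued conditionally bi-free moment pair $(\mathcal{E},\mathcal{F})$ consists of these functions restricted to $Z_k\in\mathcal{A}_{\chi(k)}$. Conditional bi-multiplicativity. Let $\Psi$ ($\mathcal{B}$-valued) and $\Phi$ ($\mathcal{D}$-valued) be functions on $\bigcup_{n\ge1}\bigcup_{\chi:\{1,\dots,n\}\to\{\ell,r\}}\mathcal{BNC}(\chi)\times\mathcal{A}_{\chi(1)}\times\cdots\times\mathcal{A}_{\chi(n)}$, linear in each $\mathcal{A}_{\chi(k)}$. The pair $(\Psi,\Phi)$ is operator-valued conditionally bi-multiplicative if for all $\chi:\{1,\dots,n\}\to\{\ell,r\}$, $Z_k\in\mathcal{A}_{\chi(k)}$, $b\in\mathcal{B}$, $\pi\in\mathcal{BNC}(\chi)$ the following hold (with $\max\emptyset=-\infty$), where (1)-(3) are required for both $\Theta=\Psi$ and $\Theta=\Phi$: (1) Let $q=\max\{k:\chi(k)\ne\chi(n)\}$.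 If $\chi(n)=\ell$, then $\Theta_{1_\chi}(Z_1,\dots,Z_{n-1},Z_nL_b)$ equals $\Theta_{1_\chi}(Z_1,\dots,Z_{q-1},Z_qR_b,Z_{q+1},\dots,Z_n)$ if $q\ne-\infty$ and $\Theta_{1_\chi}(Z_1,\dots,Z_n)b$ if $q=-\infty$. If $\chi(n)=r$, then $\Theta_{1_\chi}(Z_1,\dots,Z_{n-1},Z_nR_b)$ equals $\Theta_{1_\chi}(Z_1,\dots,Z_{q-1},Z_qL_b,Z_{q+1},\dots,Z_n)$ if $q\neq-\infty$ and $b\,\Theta_{1_\chi}(Z_1,\dots,Z_n)$ if $q=-\infty$. (2) Let $p\in\{1,\dots,n\}$ and $q=\max\{k<p:\chi(k)=\chi(p)\}$. If $\chi(p)=\ell$, then $\Theta_{1_\chi}(Z_1,\dots,L_bZ_p,\dots,Z_n)$ equals $\Theta_{1_\chi}(Z_1,\dots,Z_qL_b,\dots,Z_n)$ if $q\ne-\infty$ and $b\,\Theta_{1_\chi}(Z_1,\dots,Z_n)$ if $q=-\infty$. If $\chi(p)=r$, then $\Theta_{1_\chi}(Z_1,\dots,R_bZ_p,\dots,Z_n)$ equals $\Theta_{1_\chi}(Z_1,\dots,Z_qR_b,\dots,Z_n)$ if $q\ne-\infty$ and $\Theta_{1_\chi}(Z_1,\dots,Z_n)b$ if $q=-\infty$. (3) If $V_1,\dots,V_m$ are $\chi$-intervals ordered by $\prec_\chi$ which partition $\{1,\dots,n\}$, each a union of blocks of $\pi$, then $\Theta_\pi(Z_1,\dots,Z_n)=\Theta_{\pi|_{V_1}}((Z_1,\dots,Z_n)|_{V_1})\cdots\Theta_{\pi|_{V_m}}((Z_1,\dots,Z_n)|_{V_m})$.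 (4) Suppose $V$ and $W$ partition $\{1,\dots,n\}$, each a union of blocks of $\pi$, $V$ is a $\chi$-interval, and $\min_{\prec_\chi}(\{1,\dots,n\}),\max_{\prec_\chi}(\{1,\dots,n\})\in W$. Let $p=\max_{\prec_\chi}\{k\in W:k\prec_\chi\min_{\prec_\chi}(V)\}$, $q=\min_{\prec_\chi}\{k\in W:\max_{\prec_\chi}(V)\prec_\chi k\}$ and $c=\Psi_{\pi|_V}((Z_1,\dots,Z_n)|_V)$. Then, for $\Theta=\Psi$ always, and for $\Theta=\Phi$ under the additional assumption that $\min_{\prec_\chi}(\{1,\dots,n\})$ and $\max_{\prec_\chi}(\{1,\dots,n\})$ lie in the same block of $\pi$: $\Theta_\pi(Z_1,\dots,Z_n)$ equals $\Theta_{\pi|_W}$ evaluated at $(Z_1,\dots,Z_n)|_W$ with $Z_p$ replaced by $Z_pL_c$ if $\chi(p)=\ell$ and by $R_cZ_p$ if $\chi(p)=r$; and it also equals $\Theta_{\pi|_W}$ evaluated at $(Z_1,\dots,Z_n)|_W$ with $Z_q$ replaced by $L_cZ_q$ if $\chi(q)=\ell$ and by $Z_qR_c$ if $\chi(q)=r$. *)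

theory Defs
  imports Complex_Main "HOL-Library.Poly_Mapping" "HOL-Library.Disjoint_Sets"
begin

section \<open>Complex algebras and the tensor product of an algebra with its opposite\<close>

text \<open>
  A unital complex algebra is a type of sort \<open>{ring, monoid_mult}\<close> (so the zero algebra is not
  excluded) together with a scalar multiplication satisfying the following predicate.
\<close>

definition complex_algebra ::
    "(complex \<Rightarrow> 'a \<Rightarrow> 'a::{ring, monoid_mult}) \<Rightarrow> bool" where
  "complex_algebra scl \<longleftrightarrow> vector_space scl \<and>
     (\<forall>c x y. scl c (x * y) = scl c x * y \<and> scl c (x * y) = x * scl c y)"

definition unital_subalgebra ::
    "(complex \<Rightarrow> 'd \<Rightarrow> 'd) \<Rightarrow> ('d::{ring, monoid_mult}) set \<Rightarrow> bool" where
  "unital_subalgebra scl B \<longleftrightarrow>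
     module.subspace scl B \<and> 1 \<in> B \<and> (\<forall>x\<in>B. \<forall>y\<in>B. x * y \<in> B)"

text \<open>
  For a subalgebra \<open>B\<close>, the algebra \<open>B \<otimes> B\<^sup>o\<^sup>p\<close> is the free vector space on \<open>B \<times> B\<close> modulo the span
  of the bilinearity relations. Its product is induced by
  \<open>(a \<otimes> b) (c \<otimes> d) = ac \<otimes> db\<close>: the second factor is multiplied in the opposite algebra.
\<close>

type_synonym 'd free2 = "('d \<times> 'd) \<Rightarrow>\<^sub>0 complex"

abbreviation gen :: "'d \<Rightarrow> 'd \<Rightarrow> 'd free2" where
  "gen a b \<equiv> Poly_Mapping.single (a, b) 1"

definition free_scale :: "complex \<Rightarrow> 'd free2 \<Rightarrow> 'd free2" where
  "free_scale c f = Poly_Mapping.map ((*) c) f"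

definition free_mult :: "('d::{ring, monoid_mult}) free2 \<Rightarrow> 'd free2 \<Rightarrow> 'd free2" where
  "free_mult f g =
     (\<Sum>(a, b)\<in>Poly_Mapping.keys f. \<Sum>(c, d)\<in>Poly_Mapping.keys g.
        Poly_Mapping.single (a * c, d * b)
          (Poly_Mapping.lookup f (a, b) * Poly_Mapping.lookup g (c, d)))"

definition free_carrier :: "'d set \<Rightarrow> 'd free2 set" where
  "free_carrier B = {f. Poly_Mapping.keys f \<subseteq> B \<times> B}"

definition bilinearity_relations ::
    "(complex \<Rightarrow> 'd \<Rightarrow> 'd) \<Rightarrow> ('d::{ring, monoid_mult}) set \<Rightarrow> 'd free2 set" where
  "bilinearity_relations scl B =
     {gen (a + a') b - gen a b - gen a' b | a a' b. a \<in> B \<and> a' \<in> B \<and> b \<in> B} \<union>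
     {gen a (b + b') - gen a b - gen a b' | a b b'. a \<in> B \<and> b \<in> B \<and> b' \<in> B} \<union>
     {gen (scl c a) b - free_scale c (gen a b) | c a b. a \<in> B \<and> b \<in> B} \<union>
     {gen a (scl c b) - free_scale c (gen a b) | c a b. a \<in> B \<and> b \<in> B}"

definition tensor_class ::
    "(complex \<Rightarrow> 'd \<Rightarrow> 'd) \<Rightarrow> ('d::{ring, monoid_mult}) set \<Rightarrow> 'd free2 \<Rightarrow> 'd free2 set" where
  "tensor_class scl B f =
     {g \<in> free_carrier B. g - f \<in> module.span free_scale (bilinearity_relations scl B)}"

definition pure_tensor ::
    "(complex \<Rightarrow> 'd \<Rightarrow> 'd) \<Rightarrow> ('d::{ring, monoid_mult}) set \<Rightarrow> 'd \<Rightarrow> 'd \<Rightarrow> 'd free2 set" where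
  "pure_tensor scl B a b = tensor_class scl B (gen a b)"

text \<open>
  Unital algebra homomorphisms from \<open>B \<otimes> B\<^sup>o\<^sup>p\<close>, whose elements are the classes of elements of
  \<open>free_carrier B\<close> and whose operations are computed on representatives.
\<close>

definition tensor_op_hom ::
    "(complex \<Rightarrow> 'd \<Rightarrow> 'd) \<Rightarrow> ('d::{ring, monoid_mult}) set \<Rightarrow>
     (complex \<Rightarrow> 'a \<Rightarrow> 'a) \<Rightarrow> ('d free2 set \<Rightarrow> 'a::{ring, monoid_mult}) \<Rightarrow> bool" where
  "tensor_op_hom sclD B sclA h \<longleftrightarrow>
     (let cl = tensor_class sclD B in
       (\<forall>f\<in>free_carrier B. \<forall>g\<in>free_carrier B. h (cl (f + g)) = h (cl f) + h (cl g)) \<and>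
       (\<forall>c. \<forall>f\<in>free_carrier B. h (cl (free_scale c f)) = sclA c (h (cl f))) \<and>
       (\<forall>f\<in>free_carrier B. \<forall>g\<in>free_carrier B. h (cl (free_mult f g)) = h (cl f) * h (cl g)) \<and>
       h (cl (gen 1 1)) = 1)"


section \<open>Non-commutative probability spaces with a pair of expectations\<close>

text \<open>
  The algebras \<open>\<A>\<close> and \<open>\<D>\<close> are the types \<open>'a\<close> and \<open>'d\<close>; \<open>\<B>\<close> is the subset \<open>alg_B\<close> of \<open>'d\<close>.
\<close>

record ('a, 'd) pair_space =
  scale_A :: "complex \<Rightarrow> 'a \<Rightarrow> 'a"
  scale_D :: "complex \<Rightarrow> 'd \<Rightarrow> 'd"
  alg_B :: "'d set"
  exp_E :: "'a \<Rightarrow> 'd"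
  exp_F :: "'a \<Rightarrow> 'd"
  eps :: "'d free2 set \<Rightarrow> 'a"

definition tens ::
    "('a, 'd::{ring, monoid_mult}) pair_space \<Rightarrow> 'd \<Rightarrow> 'd \<Rightarrow> 'd free2 set" where
  "tens S = pure_tensor (scale_D S) (alg_B S)"

definition Lop :: "('a, 'd::{ring, monoid_mult}) pair_space \<Rightarrow> 'd \<Rightarrow> 'a" where
  "Lop S b = eps S (tens S b 1)"

definition Rop :: "('a, 'd::{ring, monoid_mult}) pair_space \<Rightarrow> 'd \<Rightarrow> 'a" where
  "Rop S b = eps S (tens S 1 b)"

definition is_pair_space ::
    "('a::{ring, monoid_mult}, 'd::{ring, monoid_mult}) pair_space \<Rightarrow> bool" where
  "is_pair_space S \<longleftrightarrow>
     complex_algebra (scale_A S) \<and>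
     complex_algebra (scale_D S) \<and>
     unital_subalgebra (scale_D S) (alg_B S) \<and>
     tensor_op_hom (scale_D S) (alg_B S) (scale_A S) (eps S) \<and>
     inj_on (eps S) {tens S b 1 | b. b \<in> alg_B S} \<and>
     inj_on (eps S) {tens S 1 b | b. b \<in> alg_B S} \<and>
     Vector_Spaces.linear (scale_A S) (scale_D S) (exp_E S) \<and>
     Vector_Spaces.linear (scale_A S) (scale_D S) (exp_F S) \<and>
     range (exp_E S) \<subseteq> alg_B S \<and>
     exp_E S 1 = 1 \<and> exp_F S 1 = 1 \<and>
     (\<forall>b1\<in>alg_B S. \<forall>b2\<in>alg_B S. \<forall>Z.
        exp_E S (Lop S b1 * Rop S b2 * Z) = b1 * exp_E S Z * b2 \<and>
        exp_F S (Lop S b1 * Rop S b2 * Z) = b1 * exp_F S Z * b2) \<and>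
     (\<forall>b\<in>alg_B S. \<forall>Z.
        exp_E S (Z * Lop S b) = exp_E S (Z * Rop S b) \<and>
        exp_F S (Z * Lop S b) = exp_F S (Z * Rop S b))"


section \<open>Bi-non-crossing partitions\<close>

text \<open>
  A map \<open>\<chi> : {1,\<dots>,n} \<rightarrow> {\<ell>, r}\<close> is a list of sides of length \<open>n\<close> and a tuple \<open>(Z\<^sub>1,\<dots>,Z\<^sub>n)\<close> is a list.
  Indices are shifted by one: they range over \<open>{..<n}\<close>. The restrictions \<open>\<chi>|\<^sub>V\<close> and
  \<open>(Z\<^sub>1,\<dots>,Z\<^sub>n)|\<^sub>V\<close>, relabelled increasingly, are \<open>nths \<chi> V\<close> and \<open>nths Z V\<close>.
\<close>

datatype side = Lft | Rgt

definition side_alg ::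
    "('a::{ring, monoid_mult}, 'd::{ring, monoid_mult}) pair_space \<Rightarrow> side \<Rightarrow> 'a set" where
  "side_alg S s = (case s of
      Lft \<Rightarrow> {Z. \<forall>b\<in>alg_B S. Z * Rop S b = Rop S b * Z}
    | Rgt \<Rightarrow> {Z. \<forall>b\<in>alg_B S. Z * Lop S b = Lop S b * Z})"

definition side_op :: "('a, 'd::{ring, monoid_mult}) pair_space \<Rightarrow> side \<Rightarrow> 'd \<Rightarrow> 'a" where
  "side_op S s = (case s of Lft \<Rightarrow> Lop S | Rgt \<Rightarrow> Rop S)"

definition chi_less :: "side list \<Rightarrow> nat \<Rightarrow> nat \<Rightarrow> bool" where
  "chi_less \<chi> i j \<longleftrightarrow> i < length \<chi> \<and> j < length \<chi> \<and>
     (\<chi> ! i = Lft \<and> \<chi> ! j = Lft \<and> i < j \<or>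
      \<chi> ! i = Lft \<and> \<chi> ! j = Rgt \<or>
      \<chi> ! i = Rgt \<and> \<chi> ! j = Rgt \<and> j < i)"

definition chi_min :: "side list \<Rightarrow> nat set \<Rightarrow> nat" where
  "chi_min \<chi> V = (THE i. i \<in> V \<and> (\<forall>j\<in>V. j \<noteq> i \<longrightarrow> chi_less \<chi> i j))"

definition chi_max :: "side list \<Rightarrow> nat set \<Rightarrow> nat" where
  "chi_max \<chi> V = (THE i. i \<in> V \<and> (\<forall>j\<in>V. j \<noteq> i \<longrightarrow> chi_less \<chi> j i))"

definition chi_interval :: "side list \<Rightarrow> nat set \<Rightarrow> bool" where
  "chi_interval \<chi> V \<longleftrightarrow> V \<subseteq> {..<length \<chi>} \<and>
     (\<forall>i\<in>V. \<forall>k\<in>V. \<forall>j. chi_less \<chi> i j \<and> chi_less \<chi> j k \<longrightarrow> j \<in> V)"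

definition chi_ordered :: "side list \<Rightarrow> nat set list \<Rightarrow> bool" where
  "chi_ordered \<chi> Vs \<longleftrightarrow> sorted_wrt (\<lambda>V W. \<forall>i\<in>V. \<forall>j\<in>W. chi_less \<chi> i j) Vs"

definition BNC :: "side list \<Rightarrow> nat set set set" where
  "BNC \<chi> = {\<pi>. partition_on {..<length \<chi>} \<pi> \<and>
     (\<forall>V\<in>\<pi>. \<forall>W\<in>\<pi>. \<forall>i\<in>V. \<forall>j\<in>W. \<forall>k\<in>V. \<forall>l\<in>W.
        chi_less \<chi> i j \<and> chi_less \<chi> j k \<and> chi_less \<chi> k l \<longrightarrow> V = W)}"

definition one_part :: "side list \<Rightarrow> nat set set" where
  "one_part \<chi> = {{..<length \<chi>}}"

text \<open>The partition \<open>\<pi>|\<^sub>V\<close>, where the elements of \<open>V\<close> are relabelled in increasing order.\<close>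

definition restr :: "nat set set \<Rightarrow> nat set \<Rightarrow> nat set set" where
  "restr \<pi> V = {(\<lambda>j. card {i \<in> V. i < j}) ` (U \<inter> V) | U. U \<in> \<pi> \<and> U \<inter> V \<noteq> {}}"

definition interior :: "side list \<Rightarrow> nat set set \<Rightarrow> nat set \<Rightarrow> bool" where
  "interior \<chi> \<pi> V \<longleftrightarrow> V \<in> \<pi> \<and> (\<exists>W\<in>\<pi>. W \<noteq> V \<and>
     chi_less \<chi> (chi_min \<chi> W) (chi_min \<chi> V) \<and> chi_less \<chi> (chi_max \<chi> V) (chi_max \<chi> W))"

definition union_of_blocks :: "nat set set \<Rightarrow> nat set \<Rightarrow> bool" where
  "union_of_blocks \<pi> V \<longleftrightarrow> (\<exists>P\<subseteq>\<pi>. V = \<Union>P)"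

definition ordered_blocks :: "side list \<Rightarrow> nat set set \<Rightarrow> nat set list" where
  "ordered_blocks \<chi> \<pi> = (THE Vs. distinct Vs \<and> set Vs = \<pi> \<and> chi_ordered \<chi> Vs)"


section \<open>The moment functions\<close>

text \<open>The block with the largest minimum in a set of pairwise disjoint blocks.\<close>

definition last_block :: "nat set set \<Rightarrow> nat set" where
  "last_block P = arg_max_on Min P"

text \<open>
  The index \<open>k\<close> used when a block \<open>V\<close> is removed: the first element after \<open>min V\<close> of the block \<open>W\<close>
  whose spine is adjacent to \<open>min V\<close>.
\<close>

definition adjacent_index :: "side list \<Rightarrow> nat set set \<Rightarrow> nat set \<Rightarrow> nat" where
  "adjacent_index \<chi> \<pi> V =
     (let m = Min V;
          J = {j \<in> {m<..<length \<chi>} - V. \<exists>U\<in>\<pi>. j \<in> U \<and> (\<exists>i\<in>U. i < m)};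
          j = (case \<chi> ! m of Lft \<Rightarrow> chi_min \<chi> J | Rgt \<Rightarrow> chi_max \<chi> J);
          W = (THE U. U \<in> \<pi> \<and> j \<in> U)
      in Min {i \<in> W. m < i})"

text \<open>The tuple that remains, indexed by the complement of \<open>V\<close>, when the block \<open>V\<close> is removed.\<close>

definition remove_block ::
    "('a::{ring, monoid_mult}, 'd::{ring, monoid_mult}) pair_space \<Rightarrow>
     side list \<Rightarrow> nat set set \<Rightarrow> 'a list \<Rightarrow> nat set \<Rightarrow> 'a list" where
  "remove_block S \<chi> \<pi> Z V =
     (let m = Min V;
          T = side_op S (\<chi> ! m) (exp_E S (prod_list (nths Z V)));
          k = adjacent_index \<chi> \<pi> V;
          Z' = (if V = {m..<length \<chi>} then Z[m - 1 := Z ! (m - 1) * T] else Z[k := T * Z ! k])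
      in nths Z' ({..<length \<chi>} - V))"

lemma length_nths_compl_less:
  assumes "\<chi> \<noteq> []" "\<pi> \<in> BNC \<chi>" "V \<in> \<pi>"
  shows "length (nths \<chi> ({..<length \<chi>} - V)) < length \<chi>"
proof -
  have "V \<noteq> {}" "V \<subseteq> {..<length \<chi>}"
    using assms unfolding BNC_def partition_on_def by auto
  then obtain v where v: "v \<in> V" "v < length \<chi>" by auto
  have "{i. i < length \<chi> \<and> i \<in> {..<length \<chi>} - V} \<subset> {..<length \<chi>}" using v by auto
  then have "card {i. i < length \<chi> \<and> i \<in> {..<length \<chi>} - V} < card {..<length \<chi>}"
    by (intro psubset_card_mono) auto
  then show ?thesis by (simp add: length_nths)
qed

lemma last_block_in:
  assumes "finite P" "P \<noteq> {}"
  shows "last_block P \<in> P"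
proof -
  have "Max (Min ` P) \<in> Min ` P" using assms by (intro Max_in) auto
  then obtain V where V: "V \<in> P" "Min V = Max (Min ` P)" by auto
  have "is_arg_max Min (\<lambda>U. U \<in> P) V"
    using V assms(1) by (auto simp: is_arg_max_def not_less)
  then have "is_arg_max Min (\<lambda>U. U \<in> P) (last_block P)"
    unfolding last_block_def arg_max_on_def arg_max_def by (rule someI)
  then show ?thesis by (simp add: is_arg_max_def)
qed

lemma finite_BNC: "\<pi> \<in> BNC \<chi> \<Longrightarrow> finite \<pi>"
  unfolding BNC_def by (auto intro: finite_elements)

lemma BNC_nonempty: "\<lbrakk>\<pi> \<in> BNC \<chi>; \<chi> \<noteq> []\<rbrakk> \<Longrightarrow> \<pi> \<noteq> {}"
  unfolding BNC_def partition_on_def by auto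

text \<open>Outside their domain (\<open>n \<ge> 1\<close>, \<open>\<pi> \<in> BNC \<chi>\<close>, tuples of length \<open>n\<close>) both functions are set to zero.\<close>

function E_mom ::
    "('a::{ring, monoid_mult}, 'd::{ring, monoid_mult}) pair_space \<Rightarrow>
     side list \<Rightarrow> nat set set \<Rightarrow> 'a list \<Rightarrow> 'd" where
  "E_mom S \<chi> \<pi> Z =
     (if \<chi> = [] \<or> \<pi> \<notin> BNC \<chi> \<or> length Z \<noteq> length \<chi> then 0
      else if \<pi> = one_part \<chi> then exp_E S (prod_list Z)
      else let V = last_block \<pi>; C = {..<length \<chi>} - V
           in E_mom S (nths \<chi> C) (restr \<pi> C) (remove_block S \<chi> \<pi> Z V))"
  by pat_completeness auto
termination
  by (relation "measure (\<lambda>(S, \<chi>, \<pi>, Z). length \<chi>)")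
     (auto intro: length_nths_compl_less last_block_in finite_BNC dest: BNC_nonempty)

declare E_mom.simps [simp del]

text \<open>
  In the second case every block \<open>V\<close> is a \<open>\<chi>\<close>-interval and \<open>\<pi>|\<^sub>V\<close> has a single block, so the factor
  \<open>\<F>\<close> attached to \<open>V\<close> is the expectation of the ordered product over \<open>V\<close>.
\<close>

function F_mom ::
    "('a::{ring, monoid_mult}, 'd::{ring, monoid_mult}) pair_space \<Rightarrow>
     side list \<Rightarrow> nat set set \<Rightarrow> 'a list \<Rightarrow> 'd" where
  "F_mom S \<chi> \<pi> Z =
     (if \<chi> = [] \<or> \<pi> \<notin> BNC \<chi> \<or> length Z \<noteq> length \<chi> then 0
      else if \<pi> = one_part \<chi> then exp_F S (prod_list Z)
      else if \<not> (\<exists>V. interior \<chi> \<pi> V) then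
        prod_list (map (\<lambda>V. exp_F S (prod_list (nths Z V))) (ordered_blocks \<chi> \<pi>))
      else let V = last_block {V. interior \<chi> \<pi> V}; C = {..<length \<chi>} - V
           in F_mom S (nths \<chi> C) (restr \<pi> C) (remove_block S \<chi> \<pi> Z V))"
  by pat_completeness auto
termination
proof (relation "measure (\<lambda>(S, \<chi>, \<pi>, Z). length \<chi>)", goal_cases)
  case 1
  show ?case by simp
next
  case (2 S \<chi> \<pi> Z V C)
  have "finite {V. interior \<chi> \<pi> V}"
    by (rule finite_subset[of _ \<pi>]) (use 2 in \<open>auto simp: interior_def intro: finite_BNC\<close>)
  then have "last_block {V. interior \<chi> \<pi> V} \<in> {V. interior \<chi> \<pi> V}"
    by (rule last_block_in) (use 2 in auto)
  then have "last_block {V. interior \<chi> \<pi> V} \<in> \<pi>"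
    unfolding mem_Collect_eq by (rule interior_def[THEN iffD1, THEN conjunct1])
  then have "V \<in> \<pi>" using 2 by simp
  then show ?case using 2 length_nths_compl_less[of \<chi> \<pi> V] by simp
qed

declare F_mom.simps [simp del]


section \<open>Conditional bi-multiplicativity\<close>

definition admissible ::
    "('a::{ring, monoid_mult}, 'd::{ring, monoid_mult}) pair_space \<Rightarrow>
     side list \<Rightarrow> 'a list \<Rightarrow> bool" where
  "admissible S \<chi> Z \<longleftrightarrow> \<chi> \<noteq> [] \<and> length Z = length \<chi> \<and>
     (\<forall>k<length \<chi>. Z ! k \<in> side_alg S (\<chi> ! k))"

type_synonym ('a, 'd) moment_fun = "side list \<Rightarrow> nat set set \<Rightarrow> 'a list \<Rightarrow> 'd"

definition multilinear ::
    "('a::{ring, monoid_mult}, 'd::{ring, monoid_mult}) pair_space \<Rightarrow>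
     ('a, 'd) moment_fun \<Rightarrow> bool" where
  "multilinear S \<Theta> \<longleftrightarrow>
     (\<forall>\<chi> \<pi> Z k X Y c. admissible S \<chi> Z \<and> \<pi> \<in> BNC \<chi> \<and> k < length \<chi> \<and>
        X \<in> side_alg S (\<chi> ! k) \<and> Y \<in> side_alg S (\<chi> ! k) \<longrightarrow>
        \<Theta> \<chi> \<pi> (Z[k := X + Y]) = \<Theta> \<chi> \<pi> (Z[k := X]) + \<Theta> \<chi> \<pi> (Z[k := Y]) \<and>
        \<Theta> \<chi> \<pi> (Z[k := scale_A S c X]) = scale_D S c (\<Theta> \<chi> \<pi> (Z[k := X])))"

definition bimult_1 ::
    "('a::{ring, monoid_mult}, 'd::{ring, monoid_mult}) pair_space \<Rightarrow>
     ('a, 'd) moment_fun \<Rightarrow> bool" where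
  "bimult_1 S \<Theta> \<longleftrightarrow>
     (\<forall>\<chi> Z. \<forall>b\<in>alg_B S. admissible S \<chi> Z \<longrightarrow>
       (let n = length \<chi>;
            Q = {k. k < n \<and> \<chi> ! k \<noteq> \<chi> ! (n - 1)};
            q = Max Q;
            \<theta> = \<Theta> \<chi> (one_part \<chi>)
        in case \<chi> ! (n - 1) of
             Lft \<Rightarrow> \<theta> (Z[n - 1 := Z ! (n - 1) * Lop S b]) =
                    (if Q \<noteq> {} then \<theta> (Z[q := Z ! q * Rop S b]) else \<theta> Z * b)
           | Rgt \<Rightarrow> \<theta> (Z[n - 1 := Z ! (n - 1) * Rop S b]) =
                    (if Q \<noteq> {} then \<theta> (Z[q := Z ! q * Lop S b]) else b * \<theta> Z)))"

definition bimult_2 ::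
    "('a::{ring, monoid_mult}, 'd::{ring, monoid_mult}) pair_space \<Rightarrow>
     ('a, 'd) moment_fun \<Rightarrow> bool" where
  "bimult_2 S \<Theta> \<longleftrightarrow>
     (\<forall>\<chi> Z. \<forall>b\<in>alg_B S. \<forall>p<length \<chi>. admissible S \<chi> Z \<longrightarrow>
       (let Q = {k. k < p \<and> \<chi> ! k = \<chi> ! p};
            q = Max Q;
            \<theta> = \<Theta> \<chi> (one_part \<chi>)
        in case \<chi> ! p of
             Lft \<Rightarrow> \<theta> (Z[p := Lop S b * Z ! p]) =
                    (if Q \<noteq> {} then \<theta> (Z[q := Z ! q * Lop S b]) else b * \<theta> Z)
           | Rgt \<Rightarrow> \<theta> (Z[p := Rop S b * Z ! p]) =
                    (if Q \<noteq> {} then \<theta> (Z[q := Z ! q * Rop S b]) else \<theta> Z * b)))"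

definition bimult_3 ::
    "('a::{ring, monoid_mult}, 'd::{ring, monoid_mult}) pair_space \<Rightarrow>
     ('a, 'd) moment_fun \<Rightarrow> bool" where
  "bimult_3 S \<Theta> \<longleftrightarrow>
     (\<forall>\<chi> Z \<pi> Vs. admissible S \<chi> Z \<and> \<pi> \<in> BNC \<chi> \<and>
        partition_on {..<length \<chi>} (set Vs) \<and> chi_ordered \<chi> Vs \<and>
        (\<forall>V\<in>set Vs. chi_interval \<chi> V \<and> union_of_blocks \<pi> V) \<longrightarrow>
        \<Theta> \<chi> \<pi> Z = prod_list (map (\<lambda>V. \<Theta> (nths \<chi> V) (restr \<pi> V) (nths Z V)) Vs))"

text \<open>
  The common part of condition (4) for \<open>\<Psi>\<close> and \<open>\<Phi>\<close>; the extra hypothesis on \<open>\<chi>\<close> and \<open>\<pi>\<close> needed for \<open>\<Phi>\<close>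
  is the argument \<open>H\<close>. The element \<open>c\<close> is always computed with \<open>\<Psi>\<close>.
\<close>

definition bimult_4 ::
    "('a::{ring, monoid_mult}, 'd::{ring, monoid_mult}) pair_space \<Rightarrow>
     (side list \<Rightarrow> nat set set \<Rightarrow> bool) \<Rightarrow>
     ('a, 'd) moment_fun \<Rightarrow> ('a, 'd) moment_fun \<Rightarrow> bool" where
  "bimult_4 S H \<Psi> \<Theta> \<longleftrightarrow>
     (\<forall>\<chi> Z \<pi> V W. admissible S \<chi> Z \<and> \<pi> \<in> BNC \<chi> \<and> H \<chi> \<pi> \<and>
        V \<noteq> {} \<and> V \<inter> W = {} \<and> V \<union> W = {..<length \<chi>} \<and>
        union_of_blocks \<pi> V \<and> union_of_blocks \<pi> W \<and> chi_interval \<chi> V \<and>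
        chi_min \<chi> {..<length \<chi>} \<in> W \<and> chi_max \<chi> {..<length \<chi>} \<in> W \<longrightarrow>
        (let p = chi_max \<chi> {k \<in> W. chi_less \<chi> k (chi_min \<chi> V)};
             q = chi_min \<chi> {k \<in> W. chi_less \<chi> (chi_max \<chi> V) k};
             c = \<Psi> (nths \<chi> V) (restr \<pi> V) (nths Z V);
             \<theta> = (\<lambda>Z'. \<Theta> (nths \<chi> W) (restr \<pi> W) (nths Z' W))
         in \<Theta> \<chi> \<pi> Z = \<theta> (Z[p := (case \<chi> ! p of Lft \<Rightarrow> Z ! p * Lop S c | Rgt \<Rightarrow> Rop S c * Z ! p)]) \<and>
            \<Theta> \<chi> \<pi> Z = \<theta> (Z[q := (case \<chi> ! q of Lft \<Rightarrow> Lop S c * Z ! q | Rgt \<Rightarrow> Z ! q * Rop S c)])))"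

definition ends_in_same_block :: "side list \<Rightarrow> nat set set \<Rightarrow> bool" where
  "ends_in_same_block \<chi> \<pi> \<longleftrightarrow>
     (\<exists>U\<in>\<pi>. chi_min \<chi> {..<length \<chi>} \<in> U \<and> chi_max \<chi> {..<length \<chi>} \<in> U)"

definition cond_bimultiplicative ::
    "('a::{ring, monoid_mult}, 'd::{ring, monoid_mult}) pair_space \<Rightarrow>
     ('a, 'd) moment_fun \<Rightarrow> ('a, 'd) moment_fun \<Rightarrow> bool" where
  "cond_bimultiplicative S \<Psi> \<Phi> \<longleftrightarrow>
     (\<forall>\<chi> \<pi> Z. admissible S \<chi> Z \<and> \<pi> \<in> BNC \<chi> \<longrightarrow> \<Psi> \<chi> \<pi> Z \<in> alg_B S) \<and>
     (\<forall>\<Theta>\<in>{\<Psi>, \<Phi>}. multilinear S \<Theta> \<and> bimult_1 S \<Theta> \<and> bimult_2 S \<Theta> \<and> bimult_3 S \<Theta>) \<and>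
     bimult_4 S (\<lambda>_ _. True) \<Psi> \<Psi> \<and>
     bimult_4 S ends_in_same_block \<Psi> \<Phi>"

end

theory Submission
  imports Defs
begin

text \<open>
  Both moment functions have a closed form that does not refer to an order in which blocks are
  removed. Each block contributes the expectation of the ordered product of its variables, after the
  variable at every point has absorbed, as a left or right multiplication, the value of the
  blocks nested in the gap following that point for \<open>\<prec>\<^sub>\<chi>\<close>; the contributions of the
  exterior blocks are multiplied in the order \<open>\<prec>\<^sub>\<chi>\<close>. Condition (3) is immediate for
  this closed form. Conditions (1) and (2) say that, inside one block, an element of \<open>\<B>\<close> can be moved
  between \<open>\<prec>\<^sub>\<chi>\<close>-neighbours, and condition (4) follows from them by induction on the nesting.

  That the recursions compute the closed form is a repeated application of condition (4): the removed
  block is a \<open>\<chi>\<close>-interval. The recursions insert \<open>T\<^sub>b\<close> at a place that is not always adjacent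
  to this interval, and they produce non-admissible tuples, but they only replace the relevant products
  by others that the expectations do not distinguish from them.
\<close>

section \<open>Ordered products and restriction of tuples\<close>

text \<open>The obstacle is where the recursions insert \<open>T\<close>. When a block with minimum
  \<open>m\<close> is removed, the closed form inserts its value at a neighbour of that block for
  \<open>\<prec>\<^sub>\<chi>\<close>; the recursions insert at the first index after
  \<open>m\<close> of an adjacent block, or at \<open>m - 1\<close>, with an operator chosen by the
  side of \<open>m\<close>, which can take a variable out of its side algebra. What survives is a
  statement about tails: for each block, the product of its variables from a threshold on is the
  same in both tuples up to a relation that is stable under left multiplication. That is enough,
  because later removals have smaller minima: they multiply a tail from the left or alter a variable
  still below it. The relation also admits exchanging \<open>L b\<close> and \<open>R b\<close> at
  the right end of a product.

  The extra hypothesis of condition (4) for \<Phi> has its origin here: the inserted value is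
  computed with \<open>exp_E S\<close>, while an exterior block contributes through
  \<open>exp_F S\<close>. The insertion lemmas therefore ask for a block that encloses the inserted
  family, unless exterior blocks are evaluated with \<open>exp_E S\<close> too.\<close>

definition ordered_prod :: "nat set \<Rightarrow> (nat \<Rightarrow> 'a::monoid_mult) \<Rightarrow> 'a" where
  "ordered_prod U Z = prod_list (map Z (sorted_list_of_set U))"

lemma ordered_prod_empty [simp]: "ordered_prod {} Z = 1"
  by (simp add: ordered_prod_def)

lemma ordered_prod_singleton [simp]: "ordered_prod {p} Z = Z p"
  by (simp add: ordered_prod_def)

lemma ordered_prod_cong:
  assumes "finite U" "\<And>i. i \<in> U \<Longrightarrow> Z i = Z' i"
  shows "ordered_prod U Z = ordered_prod U Z'"
  unfolding ordered_prod_def using assms by (intro arg_cong[of _ _ prod_list] map_cong) auto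

lemma ordered_prod_Un:
  assumes "finite A" "finite B" "\<And>a b. a \<in> A \<Longrightarrow> b \<in> B \<Longrightarrow> a < b"
  shows "ordered_prod (A \<union> B) Z = ordered_prod A Z * ordered_prod B Z"
proof -
  have "sorted_list_of_set (A \<union> B) = sorted_list_of_set A @ sorted_list_of_set B"
    using assms
    by (intro sorted_distinct_set_unique) (force simp: sorted_append less_imp_le)+
  then show ?thesis by (simp add: ordered_prod_def)
qed

lemma ordered_prod_split:
  assumes "finite U" "p \<in> U"
  shows "ordered_prod U Z = ordered_prod (U \<inter> {..<p}) Z * Z p * ordered_prod (U \<inter> {p<..}) Z"
proof -
  have U: "U = (U \<inter> {..<p} \<union> {p}) \<union> (U \<inter> {p<..})" using assms(2) by auto
  have "ordered_prod U Z = ordered_prod ((U \<inter> {..<p} \<union> {p}) \<union> (U \<inter> {p<..})) Z"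
    using U by simp
  also have "\<dots> = ordered_prod (U \<inter> {..<p} \<union> {p}) Z * ordered_prod (U \<inter> {p<..}) Z"
    using assms(1) by (intro ordered_prod_Un) auto
  also have "ordered_prod (U \<inter> {..<p} \<union> {p}) Z = ordered_prod (U \<inter> {..<p}) Z * Z p"
    using assms(1) by (subst ordered_prod_Un) auto
  finally show ?thesis .
qed

lemma ordered_prod_update:
  assumes "finite U" "p \<in> U"
  shows "ordered_prod U (Z(p := x)) = ordered_prod (U \<inter> {..<p}) Z * x * ordered_prod (U \<inter> {p<..}) Z"
proof -
  have "ordered_prod (U \<inter> {..<p}) (Z(p := x)) = ordered_prod (U \<inter> {..<p}) Z"
    "ordered_prod (U \<inter> {p<..}) (Z(p := x)) = ordered_prod (U \<inter> {p<..}) Z"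
    using assms(1) by (auto intro!: ordered_prod_cong)
  then show ?thesis using ordered_prod_split[OF assms, of "Z(p := x)"] by simp
qed

lemma ordered_prod_image:
  assumes "finite U" "strict_mono_on U f"
  shows "ordered_prod (f ` U) Z = ordered_prod U (\<lambda>i. Z (f i))"
proof -
  have "sorted_list_of_set (f ` U) = map f (sorted_list_of_set U)"
  proof (rule sorted_distinct_set_unique)
    have "sorted_wrt (<) (sorted_list_of_set U)" by simp
    then have "sorted_wrt (\<lambda>x y. f x \<le> f y) (sorted_list_of_set U)"
      by (rule sorted_wrt_mono_rel[rotated])
        (use assms in \<open>auto simp: strict_mono_on_def less_imp_le\<close>)
    then show "sorted (map f (sorted_list_of_set U))" by (simp add: sorted_map)
    show "distinct (map f (sorted_list_of_set U))"
      using assms by (simp add: distinct_map strict_mono_on_imp_inj_on)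
  qed (use assms in auto)
  then show ?thesis by (simp add: ordered_prod_def comp_def)
qed

lemma prod_list_eq_ordered_prod: "prod_list Z = ordered_prod {..<length Z} ((!) Z)"
proof -
  have "sorted_list_of_set {..<length Z} = [0..<length Z]"
    by (simp add: atLeast0LessThan[symmetric])
  then show ?thesis by (simp add: ordered_prod_def map_nth)
qed

lemma prod_list_nths:
  assumes "V \<subseteq> {..<length Z}"
  shows "prod_list (nths Z V) = ordered_prod V ((!) Z)"
proof -
  have "nths Z V = map ((!) Z) (filter (\<lambda>i. i \<in> V) [0..<length Z])"
  proof -
    have "nths Z V = nths (map ((!) Z) [0..<length Z]) V" by (simp add: map_nth)
    also have "\<dots> = map ((!) Z) (nths [0..<length Z] V)" by (rule nths_map)
    also have "nths [0..<length Z] V = filter (\<lambda>i. i \<in> V) [0..<length Z]"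
    proof -
      have "{i. i < length [0..<length Z] \<and> [0..<length Z] ! i \<in> V} = V"
        using assms by auto
      then show ?thesis
        using filter_eq_nths[of "\<lambda>i. i \<in> V" "[0..<length Z]"] by simp
    qed
    finally show ?thesis .
  qed
  moreover have "filter (\<lambda>i. i \<in> V) [0..<length Z] = sorted_list_of_set V"
    using assms finite_subset[OF assms]
    by (intro sorted_distinct_set_unique) (auto simp: sorted_wrt_filter)
  ultimately show ?thesis by (simp add: ordered_prod_def)
qed

lemma ordered_prod_commute:
  assumes "finite U" "\<And>i. i \<in> U \<Longrightarrow> T * Z i = Z i * T"
  shows "T * ordered_prod U Z = ordered_prod U Z * T"
proof -
  have "T * prod_list (map Z xs) = prod_list (map Z xs) * T" if "set xs \<subseteq> U" for xs
    using that
  proof (induction xs)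
    case (Cons x xs)
    have "T * prod_list (map Z (x # xs)) = (T * Z x) * prod_list (map Z xs)"
      by (simp add: mult.assoc)
    also have "\<dots> = Z x * (T * prod_list (map Z xs))"
      using Cons.prems assms(2)[of x] by (simp add: mult.assoc)
    also have "\<dots> = prod_list (map Z (x # xs)) * T"
      using Cons by (simp add: mult.assoc)
    finally show ?case .
  qed simp
  then show ?thesis using assms(1) by (simp add: ordered_prod_def)
qed

lemma ordered_prod_slide_front:
  assumes "finite U" "q \<in> U" "\<And>i. i \<in> U \<Longrightarrow> i < q \<Longrightarrow> T * Z i = Z i * T"
  shows "ordered_prod U (Z(q := T * Z q)) = T * ordered_prod U Z"
proof -
  have "ordered_prod (U \<inter> {..<q}) Z * T = T * ordered_prod (U \<inter> {..<q}) Z"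
    using assms by (intro ordered_prod_commute[symmetric]) auto
  then show ?thesis
    using assms(1,2) by (simp add: ordered_prod_update ordered_prod_split[of U q Z] mult.assoc[symmetric])
qed

lemma ordered_prod_slide_back:
  assumes "finite U" "p \<in> U" "\<And>i. i \<in> U \<Longrightarrow> p < i \<Longrightarrow> T * Z i = Z i * T"
  shows "ordered_prod U (Z(p := Z p * T)) = ordered_prod U Z * T"
proof -
  have "T * ordered_prod (U \<inter> {p<..}) Z = ordered_prod (U \<inter> {p<..}) Z * T"
    using assms by (intro ordered_prod_commute) auto
  then show ?thesis
    using assms(1,2) by (simp add: ordered_prod_update ordered_prod_split[of U p Z] mult.assoc)
qed

lemma ordered_prod_slide:
  assumes "finite U" "p \<in> U" "q \<in> U" "p < q"
    and comm: "\<And>i. i \<in> U \<Longrightarrow> p < i \<Longrightarrow> i < q \<Longrightarrow> T * Z i = Z i * T"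
  shows "ordered_prod U (Z(p := Z p * T)) = ordered_prod U (Z(q := T * Z q))"
proof -
  let ?A = "U \<inter> {..p}" and ?B = "U \<inter> {p<..}"
  have U: "U = ?A \<union> ?B" by auto
  have split: "ordered_prod U Y = ordered_prod ?A Y * ordered_prod ?B Y" for Y :: "nat \<Rightarrow> 'a"
    by (subst U, rule ordered_prod_Un) (use assms(1) in auto)
  have "ordered_prod ?A (Z(p := Z p * T)) = ordered_prod ?A Z * T"
    using assms by (intro ordered_prod_slide_back) auto
  moreover have "ordered_prod ?B (Z(p := Z p * T)) = ordered_prod ?B Z"
    "ordered_prod ?A (Z(q := T * Z q)) = ordered_prod ?A Z"
    using assms by (auto intro!: ordered_prod_cong)
  moreover have "ordered_prod ?B (Z(q := T * Z q)) = T * ordered_prod ?B Z"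
    using assms by (intro ordered_prod_slide_front) auto
  ultimately show ?thesis by (simp add: split mult.assoc)
qed

section \<open>Relabelling by rank and restriction to unions of blocks\<close>

definition rank :: "nat set \<Rightarrow> nat \<Rightarrow> nat" where
  "rank V j = card {i \<in> V. i < j}"

lemma rank_mono: "finite V \<Longrightarrow> i \<le> j \<Longrightarrow> rank V i \<le> rank V j"
  unfolding rank_def by (rule card_mono) auto

lemma rank_less: "finite V \<Longrightarrow> i \<in> V \<Longrightarrow> i < j \<Longrightarrow> rank V i < rank V j"
  unfolding rank_def by (rule psubset_card_mono) auto

lemma rank_less_iff: "finite V \<Longrightarrow> i \<in> V \<Longrightarrow> rank V i < rank V j \<longleftrightarrow> i < j"
  using rank_mono[of V j i] rank_less[of V i j] by (meson leD not_less)

lemma strict_mono_rank: "finite V \<Longrightarrow> U \<subseteq> V \<Longrightarrow> strict_mono_on U (rank V)"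
  by (auto simp: strict_mono_on_def rank_less)

lemma inj_on_rank: "finite V \<Longrightarrow> U \<subseteq> V \<Longrightarrow> inj_on (rank V) U"
  using strict_mono_on_imp_inj_on strict_mono_rank by blast

lemma length_nths_subset: "V \<subseteq> {..<length xs} \<Longrightarrow> length (nths xs V) = card V"
  unfolding length_nths by (rule arg_cong[of _ _ card]) auto

lemma nth_nths_rank:
  assumes "V \<subseteq> {..<length xs}" "j \<in> V"
  shows "nths xs V ! rank V j = xs ! j"
proof -
  have j: "j < length xs" using assms by auto
  let ?l = "nths (take j xs) V"
  have "length ?l = rank V j"
    unfolding length_nths rank_def using assms j by (intro arg_cong[of _ _ card]) auto
  moreover have "nths xs V = ?l @ nths (xs ! j # drop (Suc j) xs) {i. i + j \<in> V}"
    using j nths_append[of "take j xs" "xs ! j # drop (Suc j) xs" V]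
    by (simp add: id_take_nth_drop[symmetric])
  ultimately show ?thesis using assms by (simp add: nths_Cons nth_append)
qed

lemma rank_image: 
  assumes "finite V" shows "rank V ` V = {..<card V}"
proof (rule card_subset_eq)
  have "rank V j < card V" if "j \<in> V" for j
    unfolding rank_def using assms that by (intro psubset_card_mono) auto
  then show "rank V ` V \<subseteq> {..<card V}" by auto
  show "card (rank V ` V) = card {..<card V}"
    using assms by (simp add: card_image inj_on_rank)
qed simp

text \<open>A union of blocks cuts no block, so the intersections taken in \<open>restr\<close> are
  whole blocks and restriction is the relabelling of a subfamily.\<close>

lemma restr_union_of_blocks:
  assumes "partition_on A \<pi>" "union_of_blocks \<pi> V"
  shows "restr \<pi> V = (\<lambda>U. rank V ` U) ` {U \<in> \<pi>. U \<subseteq> V}"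
proof -
  obtain P where P: "P \<subseteq> \<pi>" "V = \<Union>P" using assms(2) by (auto simp: union_of_blocks_def)
  have sub: "U \<subseteq> V" if "U \<in> \<pi>" "U \<inter> V \<noteq> {}" for U
  proof -
    have "\<exists>W\<in>P. U \<inter> W \<noteq> {}" using that P by auto
    then obtain W where W: "W \<in> P" "U \<inter> W \<noteq> {}" by blast
    then have "U = W" using assms(1) P that partition_onD2[OF assms(1)]
      unfolding disjoint_def by blast
    then show ?thesis using W P by auto
  qed
  have ne: "U \<noteq> {}" if "U \<in> \<pi>" for U using partition_onD3[OF assms(1)] that by auto
  show ?thesis unfolding restr_def rank_def
  proof (intro equalityI subsetI)
    fix X assume "X \<in> {(\<lambda>j. card {i \<in> V. i < j}) ` (U \<inter> V) |U. U \<in> \<pi> \<and> U \<inter> V \<noteq> {}}"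
    then obtain U where U: "X = (\<lambda>j. card {i \<in> V. i < j}) ` (U \<inter> V)" "U \<in> \<pi>" "U \<inter> V \<noteq> {}" by auto
    then have "U \<inter> V = U" using sub by auto
    then show "X \<in> (\<lambda>U. (\<lambda>j. card {i \<in> V. i < j}) ` U) ` {U \<in> \<pi>. U \<subseteq> V}"
      using U by (auto intro!: image_eqI[of _ _ U])
  next
    fix X assume "X \<in> (\<lambda>U. (\<lambda>j. card {i \<in> V. i < j}) ` U) ` {U \<in> \<pi>. U \<subseteq> V}"
    then obtain U where "X = (\<lambda>j. card {i \<in> V. i < j}) ` U" "U \<in> \<pi>" "U \<subseteq> V" by auto
    moreover from this have "U \<inter> V = U" by auto
    ultimately show "X \<in> {(\<lambda>j. card {i \<in> V. i < j}) ` (U \<inter> V) |U. U \<in> \<pi> \<and> U \<inter> V \<noteq> {}}"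
      using ne by (intro CollectI exI[of _ U]) auto
  qed
qed


section \<open>Noncrossing families of blocks\<close>

text \<open>The order of \<open>\<prec>\<^sub>\<chi>\<close> is the order of the real numbers \<open>side_key\<close>.\<close>

definition side_key :: "(nat \<Rightarrow> side) \<Rightarrow> nat \<Rightarrow> real" where
  "side_key s i = (case s i of Lft \<Rightarrow> - (1 / (real i + 1)) | Rgt \<Rightarrow> 1 / (real i + 1))"

lemma side_key_less_iff:
  "side_key s i < side_key s j \<longleftrightarrow>
     s i = Lft \<and> s j = Lft \<and> i < j \<or> s i = Lft \<and> s j = Rgt \<or> s i = Rgt \<and> s j = Rgt \<and> j < i"
proof -
  have pos: "1 / (real k + 1) > 0" for k by simp
  have lt: "1 / (real k + 1) < 1 / (real l + 1) \<longleftrightarrow> l < k" for k l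
    by (simp add: divide_simps)
  have "- (1 / (real i + 1)) < 1 / (real j + 1)" "\<not> 1 / (real i + 1) < - (1 / (real j + 1))"
    using pos[of i] pos[of j] by linarith+
  then show ?thesis using lt[of i j] lt[of j i]
    by (cases "s i"; cases "s j") (auto simp: side_key_def)
qed

lemma inj_side_key: "inj (side_key s)"
proof (rule injI)
  fix x y assume "side_key s x = side_key s y"
  then have "\<not> side_key s x < side_key s y" "\<not> side_key s y < side_key s x" by auto
  then show "x = y" unfolding side_key_less_iff
    by (cases "s x"; cases "s y") auto
qed

lemma chi_less_iff:
  "chi_less \<chi> i j \<longleftrightarrow> i < length \<chi> \<and> j < length \<chi> \<and> side_key ((!) \<chi>) i < side_key ((!) \<chi>) j"
  by (auto simp: chi_less_def side_key_less_iff)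

text \<open>Nothing is required of the union, so every subfamily is again noncrossing;
  \<open>nested\<close> can recurse on subfamilies without relabelling. The key is arbitrary so that
  it may be negated, which exchanges the two sides.\<close>

definition noncrossing_family :: "(nat \<Rightarrow> real) \<Rightarrow> nat set set \<Rightarrow> bool" where
  "noncrossing_family k P \<longleftrightarrow> finite P \<and> (\<forall>U\<in>P. finite U \<and> U \<noteq> {}) \<and> disjoint P \<and>
     (\<forall>V\<in>P. \<forall>W\<in>P. \<forall>i\<in>V. \<forall>j\<in>W. \<forall>a\<in>V. \<forall>l\<in>W. k i < k j \<and> k j < k a \<and> k a < k l \<longrightarrow> V = W)"

lemma noncrossing_familyD:
  assumes "noncrossing_family k P"
  shows "finite P" "U \<in> P \<Longrightarrow> finite U" "U \<in> P \<Longrightarrow> U \<noteq> {}" "disjoint P"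
    "U \<in> P \<Longrightarrow> W \<in> P \<Longrightarrow> x \<in> U \<Longrightarrow> x \<in> W \<Longrightarrow> U = W"
    "V \<in> P \<Longrightarrow> W \<in> P \<Longrightarrow> i \<in> V \<Longrightarrow> j \<in> W \<Longrightarrow> a \<in> V \<Longrightarrow> l \<in> W \<Longrightarrow> k i < k j \<Longrightarrow> k j < k a \<Longrightarrow> k a < k l
      \<Longrightarrow> V = W"
proof -
  show "finite P" "U \<in> P \<Longrightarrow> finite U" "U \<in> P \<Longrightarrow> U \<noteq> {}" and dj: "disjoint P"
    using assms by (auto simp: noncrossing_family_def)
  show "U = W" if "U \<in> P" "W \<in> P" "x \<in> U" "x \<in> W"
    using that dj unfolding disjoint_def by blast
  show "V = W" if "V \<in> P" "W \<in> P" "i \<in> V" "j \<in> W" "a \<in> V" "l \<in> W" "k i < k j" "k j < k a" "k a < k l"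
  proof -
    have "\<forall>V\<in>P. \<forall>W\<in>P. \<forall>i\<in>V. \<forall>j\<in>W. \<forall>a\<in>V. \<forall>l\<in>W. k i < k j \<and> k j < k a \<and> k a < k l \<longrightarrow> V = W"
      using assms unfolding noncrossing_family_def by (elim conjE)
    from this[rule_format, OF that(1-6)] that(7-9) show ?thesis by auto
  qed
qed

lemma noncrossing_family_subset:
  assumes "noncrossing_family k P" "Q \<subseteq> P" shows "noncrossing_family k Q"
  unfolding noncrossing_family_def
proof (intro conjI)
  show "finite Q" using assms finite_subset noncrossing_familyD(1) by blast
  show "disjoint Q" using assms noncrossing_familyD(4) disjoint_def by (metis subsetD)
  show "\<forall>U\<in>Q. finite U \<and> U \<noteq> {}" using assms noncrossing_familyD(2,3)[OF assms(1)] by auto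
  show "\<forall>V\<in>Q. \<forall>W\<in>Q. \<forall>i\<in>V. \<forall>j\<in>W. \<forall>a\<in>V. \<forall>l\<in>W. k i < k j \<and> k j < k a \<and> k a < k l \<longrightarrow> V = W"
    using noncrossing_familyD(6)[OF assms(1)] assms(2) by (meson subsetD)
qed

section \<open>Decomposition of a noncrossing family along its first block\<close>

definition first_block :: "(nat \<Rightarrow> real) \<Rightarrow> nat set set \<Rightarrow> nat set" where
  "first_block k P = (SOME U. U \<in> P \<and> (\<exists>m\<in>U. \<forall>x\<in>\<Union>P. k m \<le> k x))"

text \<open>These are the blocks in the gap of \<open>U\<close> that follows \<open>i\<close>. The
  existence of a later point of \<open>U\<close> excludes the last point: what follows it is not
  nested in \<open>U\<close> but belongs to \<open>after\<close>.\<close>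

definition under :: "(nat \<Rightarrow> real) \<Rightarrow> nat set set \<Rightarrow> nat set \<Rightarrow> nat \<Rightarrow> nat set set" where
  "under k P U i = {W \<in> P. (\<exists>v\<in>U. k i < k v) \<and> (\<forall>x\<in>W. k i < k x \<and> (\<forall>u\<in>U. k i < k u \<longrightarrow> k x < k u))}"

definition after :: "(nat \<Rightarrow> real) \<Rightarrow> nat set set \<Rightarrow> nat set \<Rightarrow> nat set set" where
  "after k P U = {W \<in> P. \<forall>x\<in>W. \<forall>u\<in>U. k u < k x}"

lemma finite_key_min: 
  fixes k :: "nat \<Rightarrow> real"
  assumes "finite A" "A \<noteq> {}" obtains m where "m \<in> A" "\<forall>x\<in>A. k m \<le> k x"
  using arg_min_if_finite[OF assms, of k] by (metis not_le)

lemma finite_key_max: 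
  fixes k :: "nat \<Rightarrow> real"
  assumes "finite A" "A \<noteq> {}" obtains m where "m \<in> A" "\<forall>x\<in>A. k x \<le> k m"
  using finite_key_min[OF assms, of "\<lambda>x. - k x"] by auto

lemma first_block:
  assumes "noncrossing_family k P" "P \<noteq> {}"
  shows "first_block k P \<in> P" "\<exists>m\<in>first_block k P. \<forall>x\<in>\<Union>P. k m \<le> k x"
proof -
  have "finite (\<Union>P)" "\<Union>P \<noteq> {}"
    using noncrossing_familyD[OF assms(1)] assms(2) by auto
  then obtain m where m: "m \<in> \<Union>P" "\<forall>x\<in>\<Union>P. k m \<le> k x" by (rule finite_key_min)
  then have "\<exists>U. U \<in> P \<and> (\<exists>m\<in>U. \<forall>x\<in>\<Union>P. k m \<le> k x)" by blast
  then have "first_block k P \<in> P \<and> (\<exists>m\<in>first_block k P. \<forall>x\<in>\<Union>P. k m \<le> k x)"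
    unfolding first_block_def by (rule someI_ex)
  then show "first_block k P \<in> P" "\<exists>m\<in>first_block k P. \<forall>x\<in>\<Union>P. k m \<le> k x" by auto
qed

lemma first_block_eqI:
  assumes "noncrossing_family k P" "inj k" "U \<in> P" "m \<in> U" "\<And>x. x \<in> \<Union>P \<Longrightarrow> k m \<le> k x"
  shows "first_block k P = U"
proof -
  obtain m' where m': "m' \<in> first_block k P" "\<forall>x\<in>\<Union>P. k m' \<le> k x" and F: "first_block k P \<in> P"
    using first_block[OF assms(1)] assms(3) by blast
  then have "k m = k m'" using assms by (meson UnionI antisym)
  then have "m = m'" using assms(2) by (simp add: inj_eq)
  then show ?thesis using noncrossing_familyD(5)[OF assms(1) F assms(3)] m' assms by blast
qed

lemma under_subset: "under k P U i \<subseteq> P" and after_subset: "after k P U \<subseteq> P"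
  by (auto simp: under_def after_def)

lemma in_under_imp: "W \<in> under k P U i \<Longrightarrow> W \<noteq> {} \<Longrightarrow> W \<noteq> U"
  by (fastforce simp: under_def)

lemma in_after_imp: "W \<in> after k P U \<Longrightarrow> W \<noteq> {} \<Longrightarrow> W \<noteq> U"
  by (fastforce simp: after_def)

lemma card_under_after_less:
  assumes "noncrossing_family k P" "U \<in> P"
  shows "card (under k P U i) < card P" "card (after k P U) < card P"
proof -
  have "U \<noteq> {}" using noncrossing_familyD(3) assms by blast
  then have "under k P U i \<subset> P" "after k P U \<subset> P"
    using assms(2) under_subset[of k P U i] after_subset[of k P U] in_under_imp[of U k P U i]
      in_after_imp[of U k P U] by blast+
  then show "card (under k P U i) < card P" "card (after k P U) < card P"
    using noncrossing_familyD(1)[OF assms(1)] by (auto intro: psubset_card_mono)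
qed

text \<open>Take \<open>x\<close> in \<open>W\<close>. If \<open>U\<close> has a point beyond
  \<open>x\<close>, let \<open>i\<close> be the last point of \<open>U\<close> before
  \<open>x\<close>; a point of \<open>W\<close> outside the gap after \<open>i\<close> would create
  a crossing. If \<open>U\<close> has no point beyond \<open>x\<close>, a point of \<open>W\<close>
  before some point of \<open>U\<close> would cross \<open>U\<close>, whose least point precedes all
  of \<open>W\<close>.\<close>

lemma first_block_cases:
  assumes nc: "noncrossing_family k P" and k: "inj k" and "P \<noteq> {}"
    and U: "U = first_block k P" and W: "W \<in> P"
  obtains "W = U" | i where "i \<in> U" "W \<in> under k P U i" | "W \<in> after k P U"
proof (cases "W = U")
  case False
  note D = noncrossing_familyD[OF nc]
  obtain m where UP: "U \<in> P" and m: "m \<in> U" "\<forall>x\<in>\<Union>P. k m \<le> k x"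
    using first_block[OF nc \<open>P \<noteq> {}\<close>] U by blast
  have ne: "k x \<noteq> k u" if "x \<in> W" "u \<in> U" for x u
    using that D(5)[OF UP W] False k by (metis inj_eq)
  have mlt: "k m < k x" if "x \<in> W" for x using ne[OF that m(1)] m(2) that W by fastforce
  obtain x where x: "x \<in> W" using D(3) W by blast
  show thesis
  proof (cases "\<exists>v\<in>U. k x < k v")
    case True
    then obtain v where v: "v \<in> U" "k x < k v" by blast
    have "finite {u \<in> U. k u < k x}" "{u \<in> U. k u < k x} \<noteq> {}"
      using D(2)[OF UP] m(1) mlt[OF x] by auto
    then obtain i where i: "i \<in> {u \<in> U. k u < k x}" "\<forall>u\<in>{u \<in> U. k u < k x}. k u \<le> k i"
      by (rule finite_key_max)
    have "k i < k y \<and> (\<forall>u\<in>U. k i < k u \<longrightarrow> k y < k u)" if y: "y \<in> W" for y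
    proof (intro conjI ballI impI)
      show "k i < k y"
      proof (rule ccontr)
        assume "\<not> k i < k y"
        then have "k y < k i" using ne[OF y, of i] i by auto
        then have "W = U" using D(6)[OF W UP y _ x v(1), of i] i v by auto
        then show False using False by simp
      qed
      fix u assume u: "u \<in> U" "k i < k u"
      have xu: "k x < k u"
      proof (rule ccontr)
        assume "\<not> k x < k u"
        then have "k u < k x" using ne[OF x u(1)] by auto
        then show False using i(2) u by fastforce
      qed
      show "k y < k u"
      proof (rule ccontr)
        assume "\<not> k y < k u"
        then have "k u < k y" using ne[OF y u(1)] by auto
        then have "U = W" using D(6)[OF UP W _ x u(1) y, of i] i xu by auto
        then show False using False by simp
      qed
    qed
    then have "W \<in> under k P U i" unfolding under_def using W i v by fastforce
    then show thesis using that(2) i by blast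
  next
    case nv: False
    have "k u < k y" if y: "y \<in> W" and u: "u \<in> U" for y u
    proof (rule ccontr)
      assume "\<not> k u < k y"
      then have yu: "k y < k u" using ne[OF y u] by auto
      have ux: "k u < k x" using nv ne[OF x u] u by force
      have "U = W" using D(6)[OF UP W m(1) y u x mlt[OF y] yu ux] .
      then show False using False by simp
    qed
    then have "W \<in> after k P U" using W by (auto simp: after_def)
    then show thesis by (rule that(3))
  qed
qed (rule that(1))


section \<open>The algebra of left and right multiplications\<close>

lemma lookup_free_scale: "Poly_Mapping.lookup (free_scale c f) x = c * Poly_Mapping.lookup f x"
  by (simp add: free_scale_def Poly_Mapping.map.rep_eq when_def)

lemma module_free_scale: "module free_scale"
  by unfold_locales (auto intro!: poly_mapping_eqI simp: lookup_free_scale lookup_add algebra_simps)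

lemma tensor_class_eqI:
  assumes "f - g \<in> module.span free_scale (bilinearity_relations scl B)"
  shows "tensor_class scl B f = tensor_class scl B g"
proof -
  interpret module free_scale by (rule module_free_scale)
  have "h - f \<in> span (bilinearity_relations scl B) \<longleftrightarrow> h - g \<in> span (bilinearity_relations scl B)" for h
    using span_add[OF _ assms, of "h - f"] span_diff[OF _ assms, of "h - g"] by auto
  then show ?thesis by (simp add: tensor_class_def)
qed

text \<open>Before and after refer to the order of \<open>side_key\<close>. On the right side this
  order runs against the index order, so what comes after a right variable is multiplied from the
  left. The operator is of the same side as the variable, which keeps the result in the algebra of
  that side.\<close>

definition put_after ::
    "('a::{ring, monoid_mult}, 'd::{ring, monoid_mult}) pair_space \<Rightarrow> side \<Rightarrow> 'd \<Rightarrow> 'a \<Rightarrow> 'a" where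
  "put_after S t b z = (case t of Lft \<Rightarrow> z * Lop S b | Rgt \<Rightarrow> Rop S b * z)"

definition put_before ::
    "('a::{ring, monoid_mult}, 'd::{ring, monoid_mult}) pair_space \<Rightarrow> side \<Rightarrow> 'd \<Rightarrow> 'a \<Rightarrow> 'a" where
  "put_before S t b z = (case t of Lft \<Rightarrow> Lop S b * z | Rgt \<Rightarrow> z * Rop S b)"

locale expectation_pair =
  fixes S :: "('a::{ring, monoid_mult}, 'd::{ring, monoid_mult}) pair_space"
  assumes is_pair_space: "is_pair_space S"
begin

abbreviation "L \<equiv> Lop S"
abbreviation "R \<equiv> Rop S"
abbreviation "B \<equiv> alg_B S"
abbreviation "sA \<equiv> scale_A S"
abbreviation "sD \<equiv> scale_D S"
abbreviation "cl \<equiv> tensor_class sD B"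

lemma vector_space_A: "vector_space sA" and vector_space_D: "vector_space sD"
  and sA_mult: "sA c x * y = sA c (x * y)" "x * sA c y = sA c (x * y)"
  and sD_mult: "sD c u * v = sD c (u * v)" "u * sD c v = sD c (u * v)"
proof -
  have "complex_algebra sA" "complex_algebra sD" using is_pair_space by (auto simp: is_pair_space_def)
  then show "vector_space sA" "vector_space sD"
    "sA c x * y = sA c (x * y)" "x * sA c y = sA c (x * y)"
    "sD c u * v = sD c (u * v)" "u * sD c v = sD c (u * v)"
    unfolding complex_algebra_def by metis+
qed

lemma one_B [simp]: "1 \<in> B" and mult_B [intro]: "x \<in> B \<Longrightarrow> y \<in> B \<Longrightarrow> x * y \<in> B"
  and subspace_B: "module.subspace sD B"
  using is_pair_space by (auto simp: is_pair_space_def unital_subalgebra_def)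

lemma scale_B [intro]: "x \<in> B \<Longrightarrow> sD c x \<in> B"
proof -
  interpret vector_space sD by (rule vector_space_D)
  show "x \<in> B \<Longrightarrow> sD c x \<in> B" using subspace_B by (rule subspace_scale)
qed

lemma eps_hom:
  assumes "f \<in> free_carrier B" "g \<in> free_carrier B"
  shows "eps S (cl (f + g)) = eps S (cl f) + eps S (cl g)"
    "eps S (cl (free_scale c f)) = sA c (eps S (cl f))"
    "eps S (cl (free_mult f g)) = eps S (cl f) * eps S (cl g)"
  using is_pair_space assms unfolding is_pair_space_def tensor_op_hom_def Let_def by auto

lemma eps_one: "eps S (cl (gen 1 1)) = 1"
  using is_pair_space unfolding is_pair_space_def tensor_op_hom_def Let_def by auto

lemma gen_carrier: "a \<in> B \<Longrightarrow> b \<in> B \<Longrightarrow> gen a b \<in> free_carrier B"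
  by (simp add: free_carrier_def)

lemma L_def: "L b = eps S (cl (gen b 1))" and R_def: "R b = eps S (cl (gen 1 b))"
  by (simp_all add: Lop_def Rop_def tens_def pure_tensor_def)

lemma free_mult_gen: "free_mult (gen a b) (gen c d) = gen (a * c) (d * b)"
  by (simp add: free_mult_def)

lemma L_one [simp]: "L 1 = 1" and R_one [simp]: "R 1 = 1"
  by (simp_all add: L_def R_def eps_one)

lemma L_mult: "x \<in> B \<Longrightarrow> y \<in> B \<Longrightarrow> L (x * y) = L x * L y"
  unfolding L_def by (subst eps_hom(3)[symmetric]) (auto simp: gen_carrier free_mult_gen)

lemma R_mult: "x \<in> B \<Longrightarrow> y \<in> B \<Longrightarrow> R (x * y) = R y * R x"
  unfolding R_def by (subst eps_hom(3)[symmetric]) (auto simp: gen_carrier free_mult_gen)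

lemma L_R_commute: "x \<in> B \<Longrightarrow> y \<in> B \<Longrightarrow> L x * R y = R y * L x"
  unfolding L_def R_def by (subst (1 2) eps_hom(3)[symmetric]) (auto simp: gen_carrier free_mult_gen)

text \<open>\<open>eps S\<close> is additive and homogeneous on classes of sums and multiples of
  representatives. That such a sum or multiple represents a single generator is one of the
  bilinearity relations.\<close>

lemma L_R_linear:
  assumes "x \<in> B" "y \<in> B"
  shows "L (x + y) = L x + L y" "L (sD c x) = sA c (L x)"
    "R (x + y) = R x + R y" "R (sD c x) = sA c (R x)"
proof -
  interpret module free_scale by (rule module_free_scale)
  let ?rel = "bilinearity_relations sD B"
  have "gen (x + y) 1 - (gen x 1 + gen y 1) \<in> span ?rel"
    unfolding diff_diff_eq[symmetric]
    by (rule span_base) (use assms one_B in \<open>unfold bilinearity_relations_def, blast\<close>)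
  then show "L (x + y) = L x + L y"
    using eps_hom(1)[of "gen x 1" "gen y 1"] assms by (simp add: L_def tensor_class_eqI gen_carrier)
  have "gen 1 (x + y) - (gen 1 x + gen 1 y) \<in> span ?rel"
    unfolding diff_diff_eq[symmetric]
    by (rule span_base) (use assms one_B in \<open>unfold bilinearity_relations_def, blast\<close>)
  then show "R (x + y) = R x + R y"
    using eps_hom(1)[of "gen 1 x" "gen 1 y"] assms by (simp add: R_def tensor_class_eqI gen_carrier)
  have "gen (sD c x) 1 - free_scale c (gen x 1) \<in> span ?rel"
    by (rule span_base) (use assms one_B in \<open>unfold bilinearity_relations_def, blast\<close>)
  then show "L (sD c x) = sA c (L x)"
    using eps_hom(2)[of "gen x 1" "gen x 1"] assms by (simp add: L_def tensor_class_eqI gen_carrier)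
  have "gen 1 (sD c x) - free_scale c (gen 1 x) \<in> span ?rel"
    by (rule span_base) (use assms one_B in \<open>unfold bilinearity_relations_def, blast\<close>)
  then show "R (sD c x) = sA c (R x)"
    using eps_hom(2)[of "gen 1 x" "gen 1 x"] assms by (simp add: R_def tensor_class_eqI gen_carrier)
qed

section \<open>Expectations and elements that they do not distinguish\<close>

definition expectation :: "('a \<Rightarrow> 'd) \<Rightarrow> bool" where
  "expectation h \<longleftrightarrow> h = exp_E S \<or> h = exp_F S"

lemma expectation_E [simp]: "expectation (exp_E S)" and expectation_F [simp]: "expectation (exp_F S)"
  by (simp_all add: expectation_def)

lemma E_in_B [simp]: "exp_E S Z \<in> B"
  using is_pair_space by (auto simp: is_pair_space_def)

lemma expectation_bimodule:
  assumes "expectation h" "b \<in> B"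
  shows "h (L b * Z) = b * h Z" "h (R b * Z) = h Z * b" "h (Z * L b) = h (Z * R b)"
proof -
  have h: "h (L b1 * R b2 * Z) = b1 * h Z * b2" if "b1 \<in> B" "b2 \<in> B" for b1 b2 Z
    using is_pair_space assms(1) that by (auto simp: is_pair_space_def expectation_def)
  show "h (L b * Z) = b * h Z" "h (R b * Z) = h Z * b"
    using h[of b 1 Z] h[of 1 b Z] assms(2) by simp_all
  show "h (Z * L b) = h (Z * R b)"
    using is_pair_space assms by (auto simp: is_pair_space_def expectation_def)
qed

lemma expectation_linear:
  assumes "expectation h"
  shows "h (x + y) = h x + h y" "h (sA c x) = sD c (h x)"
proof -
  have "Vector_Spaces.linear sA sD h"
    using is_pair_space assms by (auto simp: is_pair_space_def expectation_def)
  then interpret Vector_Spaces.linear sA sD h .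
  show "h (x + y) = h x + h y" "h (sA c x) = sD c (h x)" by (simp_all add: add scale)
qed

lemma side_alg_commute:
  assumes "Z \<in> side_alg S t" "b \<in> B"
  shows "t = Lft \<Longrightarrow> R b * Z = Z * R b" "t = Rgt \<Longrightarrow> L b * Z = Z * L b"
  using assms by (auto simp: side_alg_def split: side.splits)

lemma put_after_side_alg:
  assumes "b \<in> B" "Z \<in> side_alg S t" shows "put_after S t b Z \<in> side_alg S t"
proof (cases t)
  case Lft
  have "Z * L b * R c = R c * (Z * L b)" if "c \<in> B" for c
    using L_R_commute[OF assms(1) that] side_alg_commute(1)[OF assms(2) that Lft]
    by (metis mult.assoc)
  then show ?thesis using Lft by (simp add: side_alg_def put_after_def)
next
  case Rgt
  have "R b * Z * L c = L c * (R b * Z)" if "c \<in> B" for c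
    using L_R_commute[OF that assms(1)] side_alg_commute(2)[OF assms(2) that Rgt]
    by (metis mult.assoc)
  then show ?thesis using Rgt by (simp add: side_alg_def put_after_def)
qed

lemma put_before_side_alg:
  assumes "b \<in> B" "Z \<in> side_alg S t" shows "put_before S t b Z \<in> side_alg S t"
proof (cases t)
  case Lft
  have "L b * Z * R c = R c * (L b * Z)" if "c \<in> B" for c
    using L_R_commute[OF assms(1) that] side_alg_commute(1)[OF assms(2) that Lft]
    by (metis mult.assoc)
  then show ?thesis using Lft by (simp add: side_alg_def put_before_def)
next
  case Rgt
  have "Z * R b * L c = L c * (Z * R b)" if "c \<in> B" for c
    using L_R_commute[OF that assms(1)] side_alg_commute(2)[OF assms(2) that Rgt]
    by (metis mult.assoc)
  then show ?thesis using Rgt by (simp add: side_alg_def put_before_def)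
qed

lemma put_after_one [simp]: "put_after S t 1 z = z"
  by (cases t) (simp_all add: put_after_def)

lemma put_after_mult: "b \<in> B \<Longrightarrow> c \<in> B \<Longrightarrow> put_after S t (b * c) z = put_after S t c (put_after S t b z)"
  by (cases t) (simp_all add: put_after_def L_mult R_mult mult.assoc)

lemma put_after_before: "put_after S t b (put_before S t c z) = put_before S t c (put_after S t b z)"
  by (cases t) (simp_all add: put_after_def put_before_def mult.assoc)

lemma put_after_linear_left:
  assumes "b \<in> B" "c \<in> B"
  shows "put_after S t (sD u b + sD v c) z = sA u (put_after S t b z) + sA v (put_after S t c z)"
proof -
  have "L (sD u b + sD v c) = sA u (L b) + sA v (L c)" "R (sD u b + sD v c) = sA u (R b) + sA v (R c)"
    using assms by (simp_all add: L_R_linear scale_B)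
  then show ?thesis
    by (cases t) (simp_all add: put_after_def distrib_left distrib_right sA_mult)
qed

lemma put_after_linear_right:
  "put_after S t b (sA u x + sA v y) = sA u (put_after S t b x) + sA v (put_after S t b y)"
  by (cases t) (simp_all add: put_after_def distrib_left distrib_right sA_mult)

lemma side_alg_linear:
  assumes "X \<in> side_alg S t" "Y \<in> side_alg S t"
  shows "sA u X + sA v Y \<in> side_alg S t"
  using assms by (cases t) (auto simp: side_alg_def algebra_simps sA_mult)

text \<open>The test uses left multiples because \<open>L b\<close> and \<open>R b\<close> can be
  exchanged at the right end of a product, whatever stands to the left.\<close>

definition equivalent :: "'a \<Rightarrow> 'a \<Rightarrow> bool" (infix "\<approx>" 50) where
  "x \<approx> y \<longleftrightarrow> (\<forall>h a. expectation h \<longrightarrow> h (a * x) = h (a * y))"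

lemma equivalent_refl [simp, intro]: "x \<approx> x"
  by (simp add: equivalent_def)

lemma equivalent_sym: "x \<approx> y \<Longrightarrow> y \<approx> x"
  unfolding equivalent_def by metis

lemma equivalent_trans [trans]: "x \<approx> y \<Longrightarrow> y \<approx> z \<Longrightarrow> x \<approx> z"
  unfolding equivalent_def by metis

lemma equivalent_mult: "x \<approx> y \<Longrightarrow> a * x \<approx> a * y"
  by (simp add: equivalent_def mult.assoc[symmetric])

lemma equivalentD: "x \<approx> y \<Longrightarrow> expectation h \<Longrightarrow> h x = h y"
  unfolding equivalent_def by (metis mult_1)

lemma equivalent_L_R: "b \<in> B \<Longrightarrow> x * L b \<approx> x * R b"
  unfolding equivalent_def by (metis expectation_bimodule(3) mult.assoc)

section \<open>Moving an element of the base algebra inside one block\<close>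

definition adm :: "(nat \<Rightarrow> side) \<Rightarrow> nat set \<Rightarrow> (nat \<Rightarrow> 'a) \<Rightarrow> bool" where
  "adm s U Z \<longleftrightarrow> (\<forall>i\<in>U. Z i \<in> side_alg S (s i))"

lemma adm_subset: "adm s U Z \<Longrightarrow> V \<subseteq> U \<Longrightarrow> adm s V Z"
  by (auto simp: adm_def)

lemma adm_commute:
  assumes "adm s U Z" "i \<in> U" "b \<in> B"
  shows "s i = Lft \<Longrightarrow> R b * Z i = Z i * R b" "s i = Rgt \<Longrightarrow> L b * Z i = Z i * L b"
  using assms side_alg_commute by (auto simp: adm_def)

text \<open>If \<open>p\<close> is on the right side, all earlier indices of \<open>U\<close> are
  left ones and commute with \<open>R c\<close>, which slides to the front. If \<open>p\<close> is
  on the left side, then \<open>U\<close> has only left indices and \<open>p\<close> is its last: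
  \<open>L c\<close> reaches the right end, is exchanged for \<open>R c\<close> there, and
  \<open>R c\<close> passes through the whole product.\<close>

lemma ordered_prod_put_after_max:
  assumes U: "finite U" "p \<in> U" "adm s U Z" "c \<in> B"
    and max: "\<And>i. i \<in> U \<Longrightarrow> \<not> side_key s p < side_key s i"
  shows "ordered_prod U (Z(p := put_after S (s p) c (Z p))) \<approx> R c * ordered_prod U Z"
proof (cases "s p")
  case Rgt
  have "ordered_prod U (Z(p := R c * Z p)) = R c * ordered_prod U Z"
  proof (rule ordered_prod_slide_front[OF U(1,2)])
    fix i assume i: "i \<in> U" "i < p"
    then have "s i = Lft" using max[OF i(1)] Rgt by (cases "s i") (auto simp: side_key_less_iff)
    then show "R c * Z i = Z i * R c" using adm_commute(1)[OF U(3) i(1) U(4)] by simp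
  qed
  then show ?thesis using Rgt by (simp add: put_after_def)
next
  case Lft
  have l: "s i = Lft" "i \<le> p" if "i \<in> U" for i
    using max[OF that] Lft by (cases "s i"; auto simp: side_key_less_iff)+
  have "ordered_prod U (Z(p := Z p * L c)) = ordered_prod U Z * L c"
    using l(2) by (intro ordered_prod_slide_back[OF U(1,2)]) (auto simp: leD)
  also have "\<dots> \<approx> ordered_prod U Z * R c" using U(4) by (rule equivalent_L_R)
  also have "ordered_prod U Z * R c = R c * ordered_prod U Z"
    using l(1) adm_commute(1)[OF U(3) _ U(4)] U(1) by (intro ordered_prod_commute[symmetric]) auto
  finally show ?thesis unfolding put_after_def Lft side.case .
qed

text \<open>The mirror image: exchanging the sides reverses the order, and it is \<open>L c\<close>
  that reaches the front.\<close>

lemma ordered_prod_put_before_min: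
  assumes U: "finite U" "q \<in> U" "adm s U Z" "c \<in> B"
    and min: "\<And>i. i \<in> U \<Longrightarrow> \<not> side_key s i < side_key s q"
  shows "ordered_prod U (Z(q := put_before S (s q) c (Z q))) \<approx> L c * ordered_prod U Z"
proof (cases "s q")
  case Lft
  have "ordered_prod U (Z(q := L c * Z q)) = L c * ordered_prod U Z"
  proof (rule ordered_prod_slide_front[OF U(1,2)])
    fix i assume i: "i \<in> U" "i < q"
    then have "s i = Rgt" using min[OF i(1)] Lft by (cases "s i") (auto simp: side_key_less_iff)
    then show "L c * Z i = Z i * L c" using adm_commute(2)[OF U(3) i(1) U(4)] by simp
  qed
  then show ?thesis using Lft by (simp add: put_before_def)
next
  case Rgt
  have l: "s i = Rgt" "i \<le> q" if "i \<in> U" for i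
    using min[OF that] Rgt by (cases "s i"; auto simp: side_key_less_iff)+
  have "ordered_prod U (Z(q := Z q * R c)) = ordered_prod U Z * R c"
    using l(2) by (intro ordered_prod_slide_back[OF U(1,2)]) (auto simp: leD)
  also have "\<dots> \<approx> ordered_prod U Z * L c" using U(4) by (intro equivalent_sym[OF equivalent_L_R])
  also have "ordered_prod U Z * L c = L c * ordered_prod U Z"
    using l(1) adm_commute(2)[OF U(3) _ U(4)] U(1) by (intro ordered_prod_commute[symmetric]) auto
  finally show ?thesis unfolding put_before_def Rgt side.case .
qed

text \<open>On a common side, the indices of \<open>U\<close> strictly between \<open>p\<close> and
  \<open>q\<close> all belong to the other side and commute with the operator, so equality holds.
  The equivalence is needed where the order turns from left to right.\<close>

lemma ordered_prod_put_adjacent: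
  assumes U: "finite U" "p \<in> U" "q \<in> U" "adm s U Z" "c \<in> B"
    and pq: "side_key s p < side_key s q"
    and adj: "\<And>i. i \<in> U \<Longrightarrow> side_key s p < side_key s i \<Longrightarrow> \<not> side_key s i < side_key s q"
  shows "ordered_prod U (Z(p := put_after S (s p) c (Z p))) \<approx>
    ordered_prod U (Z(q := put_before S (s q) c (Z q)))"
proof (cases "s p"; cases "s q")
  assume s: "s p = Lft" "s q = Lft"
  have "ordered_prod U (Z(p := Z p * L c)) = ordered_prod U (Z(q := L c * Z q))"
  proof (rule ordered_prod_slide[OF U(1-3)])
    show "p < q" using pq s by (auto simp: side_key_less_iff)
    fix i assume i: "i \<in> U" "p < i" "i < q"
    then have "s i = Rgt" using adj[OF i(1)] s by (cases "s i") (auto simp: side_key_less_iff)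
    then show "L c * Z i = Z i * L c" using adm_commute(2)[OF U(4) i(1) U(5)] by simp
  qed
  then show ?thesis using s by (simp add: put_after_def put_before_def)
next
  assume s: "s p = Rgt" "s q = Rgt"
  have "ordered_prod U (Z(q := Z q * R c)) = ordered_prod U (Z(p := R c * Z p))"
  proof (rule ordered_prod_slide[OF U(1,3,2)])
    show "q < p" using pq s by (auto simp: side_key_less_iff)
    fix i assume i: "i \<in> U" "q < i" "i < p"
    then have "s i = Lft" using adj[OF i(1)] s by (cases "s i") (auto simp: side_key_less_iff)
    then show "R c * Z i = Z i * R c" using adm_commute(1)[OF U(4) i(1) U(5)] by simp
  qed
  then show ?thesis using s by (simp add: put_after_def put_before_def)
next
  \<comment> \<open>Here \<open>p\<close> is the last left index of \<open>U\<close> and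
    \<open>q\<close> the last right one. Both operators can be carried to the right end of the
    product, where they are exchanged.\<close>
  assume s: "s p = Lft" "s q = Rgt"
  have sp: "s i = Rgt" if "i \<in> U" "p < i" for i
    using adj[OF that(1)] that s by (cases "s i") (auto simp: side_key_less_iff)
  have sq: "s i = Lft" if "i \<in> U" "q < i" for i
    using adj[OF that(1)] that s by (cases "s i") (auto simp: side_key_less_iff)
  have "ordered_prod U (Z(p := Z p * L c)) = ordered_prod U Z * L c"
    using sp adm_commute(2)[OF U(4) _ U(5)] by (intro ordered_prod_slide_back[OF U(1,2)]) auto
  also have "\<dots> \<approx> ordered_prod U Z * R c" using U(5) by (rule equivalent_L_R)
  also have "\<dots> = ordered_prod U (Z(q := Z q * R c))"
    using sq adm_commute(1)[OF U(4) _ U(5)] by (intro ordered_prod_slide_back[OF U(1,3), symmetric]) auto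
  finally show ?thesis unfolding put_after_def put_before_def s side.case .
next
  assume "s p = Rgt" "s q = Lft"
  then show ?thesis using pq by (simp add: side_key_less_iff)
qed

lemma ordered_prod_linear:
  assumes "finite U" "k \<in> U"
  shows "ordered_prod U (Z(k := sA u X + sA v Y)) =
    sA u (ordered_prod U (Z(k := X))) + sA v (ordered_prod U (Z(k := Y)))"
  using assms by (simp add: ordered_prod_update algebra_simps sA_mult)

end


section \<open>Nested expectations\<close>

text \<open>
  Nested blocks are always evaluated with the \<open>\<B>\<close>-valued expectation; exterior blocks are evaluated with
  \<open>h\<close>, which is one of the two expectations.
\<close>

function nested ::
    "('a::{ring, monoid_mult}, 'd::{ring, monoid_mult}) pair_space \<Rightarrow> (nat \<Rightarrow> side) \<Rightarrow>
     ('a \<Rightarrow> 'd) \<Rightarrow> nat set set \<Rightarrow> (nat \<Rightarrow> 'a) \<Rightarrow> 'd" where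
  "nested S s h P Z =
     (if P = {} \<or> \<not> noncrossing_family (side_key s) P then 1
      else let U = first_block (side_key s) P in
        h (ordered_prod U
            (\<lambda>i. put_after S (s i) (nested S s (exp_E S) (under (side_key s) P U i) Z) (Z i))) *
        nested S s h (after (side_key s) P U) Z)"
  by pat_completeness auto
termination
  by (relation "measure (\<lambda>(S, s, h, P, Z). card P)")
    (auto intro: card_under_after_less first_block(1))

declare nested.simps [simp del]

text \<open>Naming the tuple inside the recursion of \<open>nested\<close> turns an insertion into
  one gap into a function update at one point.\<close>

definition filled ::
    "('a::{ring, monoid_mult}, 'd::{ring, monoid_mult}) pair_space \<Rightarrow> (nat \<Rightarrow> side) \<Rightarrow>
     nat set set \<Rightarrow> nat set \<Rightarrow> (nat \<Rightarrow> 'a) \<Rightarrow> nat \<Rightarrow> 'a" where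
  "filled S s P U Z =
     (\<lambda>i. put_after S (s i) (nested S s (exp_E S) (under (side_key s) P U i) Z) (Z i))"

lemma nested_empty [simp]: "nested S s h {} Z = 1"
  by (simp add: nested.simps)

lemma nested_rec:
  assumes "noncrossing_family (side_key s) P" "P \<noteq> {}" "U = first_block (side_key s) P"
  shows "nested S s h P Z =
    h (ordered_prod U (filled S s P U Z)) * nested S s h (after (side_key s) P U) Z"
  using assms by (subst nested.simps) (simp add: filled_def Let_def)

lemma nested_cong:
  assumes "noncrossing_family (side_key s) P" "\<And>i. i \<in> \<Union>P \<Longrightarrow> Z i = Z' i"
  shows "nested S s h P Z = nested S s h P Z'"
  using assms
proof (induction "card P" arbitrary: P h rule: less_induct)
  case less
  show ?case
  proof (cases "P = {}")
    case False
    define U where "U = first_block (side_key s) P"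
    have U: "U \<in> P" using first_block(1)[OF less.prems(1) False] U_def by simp
    note c = card_under_after_less[OF less.prems(1) U]
    have IH: "nested S s h' Q Z = nested S s h' Q Z'" if "card Q < card P" "Q \<subseteq> P" for h' Q
      using that less.prems by (intro less.hyps) (auto intro: noncrossing_family_subset)
    have "Z i = Z' i" if "i \<in> U" for i using less.prems(2) U that by blast
    then have "ordered_prod U (filled S s P U Z) = ordered_prod U (filled S s P U Z')"
      using noncrossing_familyD(2)[OF less.prems(1) U] IH[OF c(1) under_subset]
      by (intro ordered_prod_cong) (auto simp: filled_def)
    then show ?thesis
      using IH[OF c(2) after_subset] by (simp add: nested_rec[OF less.prems(1) False U_def])
  qed simp
qed

section \<open>Effect of an added family on gaps and remainder\<close>

lemma under_Un: "under k (Q \<union> T) U i = under k Q U i \<union> under k T U i"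
  and after_Un: "after k (Q \<union> T) U = after k Q U \<union> after k T U"
  by (auto simp: under_def after_def)

text \<open>To be read with \<open>under_Un\<close> and \<open>after_Un\<close>: adding a family
  that lies in one gap enlarges this gap and leaves every other part of the recursion as it
  was.\<close>

lemma under_all:
  assumes "i \<in> U" "v \<in> U" "k i < k v" "inj k" "{} \<notin> T"
    and gap: "\<And>x. x \<in> \<Union>T \<Longrightarrow> k i < k x" "\<And>x u. x \<in> \<Union>T \<Longrightarrow> u \<in> U \<Longrightarrow> k i < k u \<Longrightarrow> k x < k u"
  shows "under k T U i = T" "j \<in> U \<Longrightarrow> j \<noteq> i \<Longrightarrow> under k T U j = {}" "after k T U = {}"
proof -
  show "under k T U i = T" using assms(1-3) gap unfolding under_def by blast
  have "W \<notin> under k T U j" if j: "j \<in> U" "j \<noteq> i" and W: "W \<in> T" for W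
  proof
    assume a: "W \<in> under k T U j"
    obtain x where x: "x \<in> W" using assms(5) W by fastforce
    then have "k j < k x" "\<forall>u\<in>U. k j < k u \<longrightarrow> k x < k u" using a by (auto simp: under_def)
    moreover have "k j \<noteq> k i" using j(2) assms(4) by (simp add: inj_eq)
    moreover have "k i < k x" "k i < k j \<Longrightarrow> k x < k j" using gap x W j by blast+
    ultimately show False using assms(1) by (metis not_less_iff_gr_or_eq)
  qed
  then show "j \<in> U \<Longrightarrow> j \<noteq> i \<Longrightarrow> under k T U j = {}" using under_subset[of k T U j] by blast
  have "W \<notin> after k T U" if W: "W \<in> T" for W
  proof
    assume a: "W \<in> after k T U"
    obtain x where x: "x \<in> W" using assms(5) W by fastforce
    then have "k v < k x" using a assms(2) by (auto simp: after_def)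
    moreover have "k x < k v" using gap(2)[of x v] x W assms(1-3) by blast
    ultimately show False by simp
  qed
  then show "after k T U = {}" using after_subset[of k T U] by blast
qed

lemma after_all:
  assumes "{} \<notin> T" "\<And>x u. x \<in> \<Union>T \<Longrightarrow> u \<in> U \<Longrightarrow> k u < k x"
  shows "after k T U = T" "under k T U j = {}"
proof -
  show "after k T U = T" using assms(2) unfolding after_def by blast
  have "W \<notin> under k T U j" if W: "W \<in> T" for W
  proof
    assume a: "W \<in> under k T U j"
    obtain x where x: "x \<in> W" using assms(1) W by fastforce
    obtain v where v: "v \<in> U" "k j < k v" using a by (auto simp: under_def)
    then have "k x < k v" using a x by (auto simp: under_def)
    moreover have "k v < k x" using assms(2) x W v(1) by blast
    ultimately show False by simp
  qed
  then show "under k T U j = {}" using under_subset[of k T U j] by blast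
qed

lemma under_unique:
  assumes "inj k" "i \<in> U" "j \<in> U" "x \<in> \<Union>(under k P U i)" "x \<in> \<Union>(under k P U j)"
  shows "i = j"
proof (rule ccontr)
  assume "i \<noteq> j"
  then have "k i \<noteq> k j" using assms(1) by (simp add: inj_eq)
  then show False using assms(2-) unfolding under_def by (force simp: not_less_iff_gr_or_eq)
qed

lemma first_block_notin:
  assumes "noncrossing_family k P" "U \<in> P" "x \<in> U"
  shows "x \<notin> \<Union>(under k P U i)" "x \<notin> \<Union>(after k P U)"
proof -
  show "x \<notin> \<Union>(under k P U i)"
  proof
    assume "x \<in> \<Union>(under k P U i)"
    then have "k i < k x" "\<forall>u\<in>U. k i < k u \<longrightarrow> k x < k u" by (auto simp: under_def)
    then show False using assms(3) by blast
  qed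
  show "x \<notin> \<Union>(after k P U)" using assms(3) by (force simp: after_def)
qed

lemma under_after_disjoint:
  assumes "x \<in> \<Union>(under k P U i)" shows "x \<notin> \<Union>(after k P U)"
proof
  assume "x \<in> \<Union>(after k P U)"
  then have "\<forall>u\<in>U. k u < k x" by (auto simp: after_def)
  moreover obtain v where "v \<in> U" "k x < k v" using assms by (auto simp: under_def)
  ultimately show False by force
qed

context expectation_pair
begin

lemma nested_E_in_B [simp]: "nested S s (exp_E S) P Z \<in> B"
proof (induction "card P" arbitrary: P rule: less_induct)
  case less
  show ?case
  proof (cases "P = {} \<or> \<not> noncrossing_family (side_key s) P")
    case False
    then have nc: "noncrossing_family (side_key s) P" "P \<noteq> {}" by auto
    have "nested S s (exp_E S) (after (side_key s) P (first_block (side_key s) P)) Z \<in> B"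
      using card_under_after_less(2)[OF nc(1) first_block(1)[OF nc]] by (rule less)
    then show ?thesis using nested_rec[OF nc refl, of S "exp_E S" Z] by (simp add: mult_B)
  qed (auto simp: nested.simps)
qed

lemma adm_filled: "U \<in> P \<Longrightarrow> adm s (\<Union>P) Z \<Longrightarrow> adm s U (filled S s P U Z)"
  by (auto simp: adm_def filled_def intro!: put_after_side_alg)

text \<open>As \<open>Q\<close> comes after all of \<open>P\<close>, it changes neither the first
  block nor any gap of it; it travels along inside \<open>after\<close> until \<open>P\<close> is
  used up.\<close>

lemma nested_Un:
  assumes "noncrossing_family (side_key s) (P \<union> Q)"
    "\<And>x y. x \<in> \<Union>P \<Longrightarrow> y \<in> \<Union>Q \<Longrightarrow> side_key s x < side_key s y"
  shows "nested S s h (P \<union> Q) Z = nested S s h P Z * nested S s h Q Z"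
  using assms
proof (induction "card P" arbitrary: P rule: less_induct)
  case less
  note nc = less.prems(1)
  let ?k = "side_key s"
  have ncP: "noncrossing_family ?k P" using nc by (rule noncrossing_family_subset) simp
  show ?case
  proof (cases "P = {}")
    case False
    define U where "U = first_block ?k P"
    have U: "U \<in> P" and "\<exists>m\<in>U. \<forall>x\<in>\<Union>P. ?k m \<le> ?k x"
      using first_block[OF ncP False] U_def by simp_all
    then obtain m where m: "m \<in> U" "\<forall>x\<in>\<Union>P. ?k m \<le> ?k x" by blast
    have "first_block ?k (P \<union> Q) = U"
    proof (rule first_block_eqI[OF nc inj_side_key _ m(1)])
      fix x assume x: "x \<in> \<Union>(P \<union> Q)"
      have "m \<in> \<Union>P" using m(1) U by blast
      then show "?k m \<le> ?k x" using x m(2) less.prems(2)[of m x] less_imp_le by blast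
    qed (use U in auto)
    have Q: "{} \<notin> Q" using noncrossing_familyD(3)[OF nc] by auto
    have gt: "?k u < ?k x" if "x \<in> \<Union>Q" "u \<in> U" for x u
      using less.prems(2)[of u x] that U by blast
    have A: "after ?k (P \<union> Q) U = after ?k P U \<union> Q" "under ?k (P \<union> Q) U i = under ?k P U i" for i
      using after_all[of Q U ?k] Q gt by (simp_all add: under_Un after_Un)
    have "nested S s h (after ?k P U \<union> Q) Z = nested S s h (after ?k P U) Z * nested S s h Q Z"
    proof (rule less.hyps)
      show "card (after ?k P U) < card P" using ncP U by (rule card_under_after_less)
      show "noncrossing_family ?k (after ?k P U \<union> Q)"
        using nc by (rule noncrossing_family_subset) (auto simp: after_def)
      show "\<And>x y. x \<in> \<Union>(after ?k P U) \<Longrightarrow> y \<in> \<Union>Q \<Longrightarrow> ?k x < ?k y"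
        using less.prems(2) after_subset[of ?k P U] by blast
    qed
    then show ?thesis
      using \<open>first_block ?k (P \<union> Q) = U\<close> False
      by (simp add: nested_rec[OF nc _ refl] nested_rec[OF ncP _ refl] U_def[symmetric] A
          filled_def mult.assoc)
  qed simp
qed

text \<open>The inductive step shared by both insertion lemmas when the point \<open>r\<close> of
  insertion lies in a gap of the first block. The family \<open>T\<close> falls into the same gap,
  and the other gaps, \<open>U\<close> itself and the remainder see neither \<open>T\<close> nor
  \<open>r\<close>.\<close>

lemma nested_step_under:
  assumes nc: "noncrossing_family (side_key s) (Q \<union> T)" and "Q \<noteq> {}"
    and U: "U = first_block (side_key s) Q" "U = first_block (side_key s) (Q \<union> T)"
    and i: "i \<in> U" "v \<in> U" "side_key s i < side_key s v"
    and gap: "\<And>x. x \<in> \<Union>T \<Longrightarrow> side_key s i < side_key s x"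
      "\<And>x u. x \<in> \<Union>T \<Longrightarrow> u \<in> U \<Longrightarrow> side_key s i < side_key s u \<Longrightarrow> side_key s x < side_key s u"
    and r: "r \<in> \<Union>(under (side_key s) Q U i)"
    and IH: "nested S s (exp_E S) (under (side_key s) Q U i \<union> T) Z =
      nested S s (exp_E S) (under (side_key s) Q U i) (Z(r := z))"
  shows "nested S s h (Q \<union> T) Z = nested S s h Q (Z(r := z))"
proof -
  let ?k = "side_key s"
  have ncQ: "noncrossing_family ?k Q" using nc by (rule noncrossing_family_subset) simp
  have UQ: "U \<in> Q" using first_block(1)[OF ncQ \<open>Q \<noteq> {}\<close>] U by simp
  have T: "{} \<notin> T" using noncrossing_familyD(3)[OF nc] by auto
  note all = under_all[of i U v ?k T, OF i inj_side_key T gap]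
  have ncsub: "noncrossing_family ?k (under ?k Q U j)" "noncrossing_family ?k (after ?k Q U)" for j
    by (rule noncrossing_family_subset[OF ncQ under_subset] noncrossing_family_subset[OF ncQ after_subset])+
  have rU: "r \<notin> U" using first_block_notin(1)[OF ncQ UQ] r by blast
  have "nested S s h (after ?k (Q \<union> T) U) Z = nested S s h (after ?k Q U) (Z(r := z))"
    using under_after_disjoint[OF r] all
    by (auto simp: after_Un intro!: nested_cong[OF ncsub(2)])
  moreover have "ordered_prod U (filled S s (Q \<union> T) U Z) = ordered_prod U (filled S s Q U (Z(r := z)))"
  proof (rule ordered_prod_cong)
    show "finite U" using noncrossing_familyD(2)[OF ncQ UQ] .
    fix j assume j: "j \<in> U"
    have "nested S s (exp_E S) (under ?k (Q \<union> T) U j) Z =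
      nested S s (exp_E S) (under ?k Q U j) (Z(r := z))"
    proof (cases "j = i")
      case True
      then show ?thesis using IH all by (simp add: under_Un)
    next
      case False
      then have "r \<notin> \<Union>(under ?k Q U j)" using under_unique[OF inj_side_key i(1) j r] by auto
      then show ?thesis using False all j
        by (auto simp: under_Un intro!: nested_cong[OF ncsub(1)])
    qed
    then show "filled S s (Q \<union> T) U Z j = filled S s Q U (Z(r := z)) j"
      using j rU by (auto simp: filled_def)
  qed
  ultimately show ?thesis
    using nested_rec[OF nc _ U(2), of S h Z] nested_rec[OF ncQ \<open>Q \<noteq> {}\<close> U(1), of S h "Z(r := z)"]
      \<open>Q \<noteq> {}\<close> by simp
qed

text \<open>The companion step for a point of insertion beyond the first block, where all changes
  are confined to the remainder.\<close>

lemma nested_step_after: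
  assumes nc: "noncrossing_family (side_key s) (Q \<union> T)" and "Q \<noteq> {}"
    and U: "U = first_block (side_key s) Q" "U = first_block (side_key s) (Q \<union> T)"
    and gt: "\<And>x u. x \<in> \<Union>T \<Longrightarrow> u \<in> U \<Longrightarrow> side_key s u < side_key s x"
    and r: "r \<in> \<Union>(after (side_key s) Q U)"
    and IH: "nested S s h (after (side_key s) Q U \<union> T) Z =
      nested S s h (after (side_key s) Q U) (Z(r := z))"
  shows "nested S s h (Q \<union> T) Z = nested S s h Q (Z(r := z))"
proof -
  let ?k = "side_key s"
  have ncQ: "noncrossing_family ?k Q" using nc by (rule noncrossing_family_subset) simp
  have UQ: "U \<in> Q" using first_block(1)[OF ncQ \<open>Q \<noteq> {}\<close>] U by simp
  have T: "{} \<notin> T" using noncrossing_familyD(3)[OF nc] by auto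
  note all = after_all[of T U ?k, OF T gt]
  have ncsub: "noncrossing_family ?k (under ?k Q U j)" for j
    using noncrossing_family_subset[OF ncQ under_subset] .
  have rU: "r \<notin> U" using first_block_notin(2)[OF ncQ UQ] r by blast
  have "nested S s (exp_E S) (under ?k (Q \<union> T) U j) Z =
      nested S s (exp_E S) (under ?k Q U j) (Z(r := z))" for j
    using under_after_disjoint[of _ ?k Q U j] r all
    by (simp add: under_Un) (rule nested_cong[OF ncsub], fastforce)
  then have "ordered_prod U (filled S s (Q \<union> T) U Z) = ordered_prod U (filled S s Q U (Z(r := z)))"
    using rU noncrossing_familyD(2)[OF ncQ UQ]
    by (intro ordered_prod_cong) (auto simp: filled_def)
  then show ?thesis
    using nested_rec[OF nc _ U(2), of S h Z] nested_rec[OF ncQ \<open>Q \<noteq> {}\<close> U(1), of S h "Z(r := z)"]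
      \<open>Q \<noteq> {}\<close> IH all by (simp add: after_Un)
qed

text \<open>One single block of \<open>Q\<close> has points on both sides of \<open>T\<close>. Then
  the blocks of \<open>T\<close> are interior and are evaluated with \<open>exp_E S\<close> even if
  \<open>h\<close> is \<open>exp_F S\<close>.\<close>

definition enclosed :: "(nat \<Rightarrow> side) \<Rightarrow> nat set set \<Rightarrow> nat set set \<Rightarrow> bool" where
  "enclosed s Q T \<longleftrightarrow> (\<exists>W\<in>Q. \<exists>u\<in>W. \<exists>v\<in>W. \<forall>x\<in>\<Union>T. side_key s u < side_key s x \<and> side_key s x < side_key s v)"

text \<open>The enclosing block has a point beyond \<open>T\<close>, hence beyond \<open>U\<close>.
  So it is neither \<open>U\<close> nor nested in a gap of \<open>U\<close>.\<close>

lemma enclosed_after: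
  assumes nc: "noncrossing_family (side_key s) Q" and "Q \<noteq> {}" and U: "U = first_block (side_key s) Q"
    and T: "{} \<notin> T" "T \<noteq> {}"
    and gt: "\<And>x u. x \<in> \<Union>T \<Longrightarrow> u \<in> U \<Longrightarrow> side_key s u < side_key s x"
    and enc: "enclosed s Q T"
  shows "enclosed s (after (side_key s) Q U) T"
proof -
  let ?k = "side_key s"
  obtain x where x: "x \<in> \<Union>T" using T by (metis UnionI ex_in_conv)
  obtain W u v where W: "W \<in> Q" "u \<in> W" "v \<in> W" "\<forall>x\<in>\<Union>T. ?k u < ?k x \<and> ?k x < ?k v"
    using enc unfolding enclosed_def by blast
  have "?k w < ?k v" if "w \<in> U" for w using gt[OF x that] W(4) x by force
  then have "W \<noteq> U" "W \<notin> under ?k Q U i" if "i \<in> U" for i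
    using W(3) that by (auto simp: under_def) (meson less_asym)
  moreover obtain m where "m \<in> U" using first_block(2)[OF nc \<open>Q \<noteq> {}\<close>] U by blast
  ultimately have "W \<in> after ?k Q U"
    using first_block_cases[OF nc inj_side_key \<open>Q \<noteq> {}\<close> U W(1)] by metis
  then show ?thesis unfolding enclosed_def using W by blast
qed

lemma nested_insert_after:
  assumes "noncrossing_family (side_key s) (Q \<union> T)" "T \<noteq> {}" "p \<in> \<Union>Q" "adm s (\<Union>(Q \<union> T)) Z"
    "\<And>x. x \<in> \<Union>T \<Longrightarrow> side_key s p < side_key s x"
    "\<And>x y. x \<in> \<Union>T \<Longrightarrow> y \<in> \<Union>Q \<Longrightarrow> side_key s p < side_key s y \<Longrightarrow> side_key s x < side_key s y"
    "expectation h" "h = exp_E S \<or> enclosed s Q T"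
  shows "nested S s h (Q \<union> T) Z =
    nested S s h Q (Z(p := put_after S (s p) (nested S s (exp_E S) T Z) (Z p)))"
  using assms
proof (induction "card Q" arbitrary: Q h rule: less_induct)
  case less
  note nc = less.prems(1) and px = less.prems(5) and pxy = less.prems(6)
  let ?k = "side_key s" and ?c = "nested S s (exp_E S) T Z"
  define z where "z = put_after S (s p) ?c (Z p)"
  have ncQ: "noncrossing_family ?k Q" using nc by (rule noncrossing_family_subset) simp
  have Q0: "Q \<noteq> {}" using less.prems(3) by auto
  have R0: "{} \<notin> T" using noncrossing_familyD(3)[OF nc] by auto
  obtain x0 where x0: "x0 \<in> \<Union>T" using less.prems(2) R0 by (metis UnionI ex_in_conv)
  define U where "U = first_block ?k Q"
  have U: "U \<in> Q" and "\<exists>m\<in>U. \<forall>x\<in>\<Union>Q. ?k m \<le> ?k x"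
    using first_block[OF ncQ Q0] U_def by simp_all
  then obtain m where m: "m \<in> U" "\<forall>x\<in>\<Union>Q. ?k m \<le> ?k x" by blast
  \<comment> \<open>Since \<open>T\<close> comes after the point \<open>p\<close> of
    \<open>Q\<close>, the least point is unchanged.\<close>
  have U': "U = first_block ?k (Q \<union> T)"
  proof (rule first_block_eqI[OF nc inj_side_key _ m(1), symmetric])
    fix x assume x: "x \<in> \<Union>(Q \<union> T)"
    show "?k m \<le> ?k x" using x m(2) px[of x] less.prems(3) by fastforce
  qed (use U in auto)
  obtain W0 where W0: "W0 \<in> Q" "p \<in> W0" using less.prems(3) by blast
  have finU: "finite U" using noncrossing_familyD(2)[OF ncQ U] .
  have UQ: "u \<in> \<Union>Q" if "u \<in> U" for u using that U by blast
  have IH: "nested S s h' (Q' \<union> T) Z = nested S s h' Q' (Z(p := z))"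
    if "card Q' < card Q" "Q' \<subseteq> Q" "p \<in> \<Union>Q'" "expectation h'" "h' = exp_E S \<or> enclosed s Q' T" for Q' h'
    unfolding z_def
  proof (rule less.hyps[OF that(1)])
    show "noncrossing_family ?k (Q' \<union> T)"
      using nc by (rule noncrossing_family_subset) (use that in auto)
    show "adm s (\<Union>(Q' \<union> T)) Z"
      using less.prems(4) by (rule adm_subset) (use that in auto)
    show "\<And>x y. x \<in> \<Union>T \<Longrightarrow> y \<in> \<Union>Q' \<Longrightarrow> ?k p < ?k y \<Longrightarrow> ?k x < ?k y" using pxy that(2) by blast
  qed (use less.prems(2) px that in auto)
  have ncsub: "noncrossing_family ?k (under ?k Q U j)" "noncrossing_family ?k (after ?k Q U)" for j
    by (rule noncrossing_family_subset[OF ncQ under_subset] noncrossing_family_subset[OF ncQ after_subset])+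
  note recs = nested_rec[OF nc _ U', of S h Z] nested_rec[OF ncQ Q0 U_def, of S h "Z(p := z)"]
  from first_block_cases[OF ncQ inj_side_key Q0 U_def W0(1)]
  consider "W0 = U" | i where "i \<in> U" "W0 \<in> under ?k Q U i" | "W0 \<in> after ?k Q U" by blast
  then have "nested S s h (Q \<union> T) Z = nested S s h Q (Z(p := z))"
  proof cases
    case 1
    then have pU: "p \<in> U" using W0 by simp
    have under_eq: "nested S s h' (under ?k Q U j) (Z(p := z)) = nested S s h' (under ?k Q U j) Z" for h' j
      using first_block_notin(1)[OF ncQ U pU] by (intro nested_cong[OF ncsub(1)]) auto
    have after_eq: "nested S s h (after ?k Q U) (Z(p := z)) = nested S s h (after ?k Q U) Z"
      using first_block_notin(2)[OF ncQ U pU] by (intro nested_cong[OF ncsub(2)]) auto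
    show ?thesis
    proof (cases "\<exists>v\<in>U. ?k p < ?k v")
      case True
      then obtain v where v: "v \<in> U" "?k p < ?k v" by blast
      have gap: "?k x < ?k u" if "x \<in> \<Union>T" "u \<in> U" "?k p < ?k u" for x u
        using pxy[OF that(1) UQ[OF that(2)] that(3)] .
      note all = under_all[of p U v ?k T, OF pU v inj_side_key R0 px gap]
      \<comment> \<open>\<open>T\<close> is adjacent to \<open>p\<close>, so within this gap it
        precedes the blocks already there. Its value is the left factor, and
        \<open>put_after_mult\<close> makes \<open>p\<close> absorb it first.\<close>
      have "nested S s (exp_E S) (T \<union> under ?k Q U p) Z = ?c * nested S s (exp_E S) (under ?k Q U p) Z"
      proof (rule nested_Un)
        show "noncrossing_family ?k (T \<union> under ?k Q U p)"
          using nc by (rule noncrossing_family_subset) (auto simp: under_def)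
        fix x y assume x: "x \<in> \<Union>T" and y: "y \<in> \<Union>(under ?k Q U p)"
        then have "y \<in> \<Union>Q" "?k p < ?k y" by (auto simp: under_def)
        then show "?k x < ?k y" using pxy x by blast
      qed
      then have "filled S s (Q \<union> T) U Z j = filled S s Q U (Z(p := z)) j" if "j \<in> U" for j
        using all that under_eq
        by (cases "j = p") (auto simp: filled_def under_Un Un_commute put_after_mult z_def)
      then have "ordered_prod U (filled S s (Q \<union> T) U Z) = ordered_prod U (filled S s Q U (Z(p := z)))"
        using finU by (intro ordered_prod_cong) auto
      then show ?thesis using recs Q0 all(3) after_eq by (simp add: after_Un)
    next
      case False
      then have max: "\<not> ?k p < ?k u" if "u \<in> U" for u using that by blast
      have gt: "?k u < ?k x" if "x \<in> \<Union>T" "u \<in> U" for x u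
        using max[OF that(2)] px[OF that(1)] by simp
      note all = after_all[of T U ?k, OF R0 gt]
      \<comment> \<open>An enclosing block would lie after \<open>U\<close>, so all its points are
        beyond \<open>p\<close>; yet one of them precedes \<open>T\<close>, although no point of
        \<open>Q\<close> lies between \<open>p\<close> and \<open>T\<close>.\<close>
      have hE: "h = exp_E S"
      proof (rule ccontr)
        assume "h \<noteq> exp_E S"
        then have "enclosed s (after ?k Q U) T"
          using less.prems(8) enclosed_after[OF ncQ Q0 U_def R0 less.prems(2) gt] by blast
        then obtain W u where W: "W \<in> after ?k Q U" "u \<in> W" "?k u < ?k x0"
          using x0 unfolding enclosed_def by blast
        then have "?k p < ?k u" "u \<in> \<Union>Q" using pU by (auto simp: after_def)
        then have "?k x0 < ?k u" using pxy[OF x0] by blast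
        then show False using W(3) by simp
      qed
      have "nested S s (exp_E S) (T \<union> after ?k Q U) Z = ?c * nested S s (exp_E S) (after ?k Q U) Z"
      proof (rule nested_Un)
        show "noncrossing_family ?k (T \<union> after ?k Q U)"
          using nc by (rule noncrossing_family_subset) (auto simp: after_def)
        fix x y assume x: "x \<in> \<Union>T" and y: "y \<in> \<Union>(after ?k Q U)"
        then have "y \<in> \<Union>Q" "?k p < ?k y" using pU by (auto simp: after_def)
        then show "?k x < ?k y" using pxy x by blast
      qed
      moreover have "h (ordered_prod U (filled S s Q U (Z(p := z)))) =
        h (ordered_prod U (filled S s (Q \<union> T) U Z)) * ?c"
      proof -
        let ?f = "filled S s Q U Z"
        \<comment> \<open>As the last point of \<open>U\<close>, \<open>p\<close> has absorbed
          nothing so far, so the value of \<open>T\<close> is the only insertion there.\<close>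
        have up: "under ?k Q U p = {}" using max by (auto simp: under_def)
        have "ordered_prod U (filled S s Q U (Z(p := z))) = ordered_prod U (?f(p := put_after S (s p) ?c (?f p)))"
          using finU under_eq up by (intro ordered_prod_cong) (auto simp: filled_def z_def)
        also have "h \<dots> = h (R ?c * ordered_prod U ?f)"
          using finU pU adm_filled[OF U adm_subset[OF less.prems(4)]] max less.prems(7)
          by (intro equivalentD[OF ordered_prod_put_after_max]) auto
        also have "\<dots> = h (ordered_prod U ?f) * ?c" using less.prems(7) by (simp add: expectation_bimodule)
        also have "?f = filled S s (Q \<union> T) U Z" using all by (simp add: filled_def under_Un)
        finally show ?thesis .
      qed
      ultimately show ?thesis using recs Q0 all after_eq hE
        by (simp add: after_Un Un_commute mult.assoc)
    qed
  next
    case (2 i)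
    then have pi: "p \<in> \<Union>(under ?k Q U i)" using W0 by blast
    then obtain v where v: "v \<in> U" "?k i < ?k v" by (auto simp: under_def)
    have ip: "?k i < ?k p" and pu: "?k p < ?k u" if "u \<in> U" "?k i < ?k u" for u
      using pi that by (auto simp: under_def)
    show ?thesis
    proof (rule nested_step_under[OF nc Q0 U_def U' 2(1) v _ _ pi IH])
      show "card (under ?k Q U i) < card Q" using ncQ U by (rule card_under_after_less)
      show "under ?k Q U i \<subseteq> Q" by (rule under_subset)
      show "?k i < ?k x" if "x \<in> \<Union>T" for x using ip[OF v] px[OF that] by simp
      show "?k x < ?k u" if "x \<in> \<Union>T" "u \<in> U" "?k i < ?k u" for x u
        using pxy[OF that(1) UQ[OF that(2)] pu[OF that(2,3)]] .
    qed (use pi in auto)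
  next
    case 3
    then have pa: "p \<in> \<Union>(after ?k Q U)" using W0 by blast
    have gt: "?k u < ?k x" if "x \<in> \<Union>T" "u \<in> U" for x u
    proof -
      have "?k u < ?k p" using pa that(2) by (auto simp: after_def)
      then show ?thesis using px[OF that(1)] by simp
    qed
    show ?thesis
    proof (rule nested_step_after[OF nc Q0 U_def U' gt pa IH])
      show "card (after ?k Q U) < card Q" using ncQ U by (rule card_under_after_less)
      show "after ?k Q U \<subseteq> Q" by (rule after_subset)
      show "h = exp_E S \<or> enclosed s (after ?k Q U) T"
        using less.prems(8) enclosed_after[OF ncQ Q0 U_def R0 less.prems(2) gt] by blast
    qed (use pa less.prems(7) in auto)
  qed
  then show ?case by (simp add: z_def)
qed

text \<open>This is not the literal mirror image, because \<open>nested\<close> starts from the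
  least point and attaches the value of a gap to the point before it. If \<open>U\<close> has a
  point before \<open>q\<close>, the value of \<open>T\<close> arrives at the predecessor
  \<open>i\<close> of \<open>q\<close> in \<open>U\<close> and is carried over by
  \<open>ordered_prod_put_adjacent\<close>. If \<open>q\<close> is the least point, \<open>T\<close>
  precedes everything.\<close>

lemma nested_insert_before:
  assumes "noncrossing_family (side_key s) (Q \<union> T)" "T \<noteq> {}" "q \<in> \<Union>Q" "adm s (\<Union>(Q \<union> T)) Z"
    "\<And>x. x \<in> \<Union>T \<Longrightarrow> side_key s x < side_key s q"
    "\<And>x y. x \<in> \<Union>T \<Longrightarrow> y \<in> \<Union>Q \<Longrightarrow> side_key s y < side_key s q \<Longrightarrow> side_key s y < side_key s x"
    "expectation h" "h = exp_E S \<or> enclosed s Q T"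
  shows "nested S s h (Q \<union> T) Z =
    nested S s h Q (Z(q := put_before S (s q) (nested S s (exp_E S) T Z) (Z q)))"
  using assms
proof (induction "card Q" arbitrary: Q h rule: less_induct)
  case less
  note nc = less.prems(1) and xq = less.prems(5) and yx = less.prems(6)
  let ?k = "side_key s" and ?c = "nested S s (exp_E S) T Z"
  define z where "z = put_before S (s q) ?c (Z q)"
  have ncQ: "noncrossing_family ?k Q" using nc by (rule noncrossing_family_subset) simp
  have Q0: "Q \<noteq> {}" using less.prems(3) by auto
  have R0: "{} \<notin> T" using noncrossing_familyD(3)[OF nc] by auto
  obtain x0 where x0: "x0 \<in> \<Union>T" using less.prems(2) R0 by (metis UnionI ex_in_conv)
  define U where "U = first_block ?k Q"
  have U: "U \<in> Q" and "\<exists>m\<in>U. \<forall>x\<in>\<Union>Q. ?k m \<le> ?k x"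
    using first_block[OF ncQ Q0] U_def by simp_all
  then obtain m where m: "m \<in> U" "\<forall>x\<in>\<Union>Q. ?k m \<le> ?k x" by blast
  obtain W0 where W0: "W0 \<in> Q" "q \<in> W0" using less.prems(3) by blast
  have finU: "finite U" using noncrossing_familyD(2)[OF ncQ U] .
  have UQ: "u \<in> \<Union>Q" if "u \<in> U" for u using that U by blast
  \<comment> \<open>When \<open>q\<close> is the least point of \<open>Q\<close>, the family
    \<open>T\<close> comes before it and the first block changes; hence the restriction.\<close>
  have U': "U = first_block ?k (Q \<union> T)" if mq: "m \<noteq> q"
  proof (rule first_block_eqI[OF nc inj_side_key _ m(1), symmetric])
    have "?k m \<noteq> ?k q" using mq inj_side_key[of s] by (simp add: inj_eq)
    then have "?k m < ?k q" using m(2) less.prems(3) by fastforce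
    then show "?k m \<le> ?k x" if "x \<in> \<Union>(Q \<union> T)" for x
      using that m(2) yx[of x m] UQ[OF m(1)] by fastforce
  qed (use U in auto)
  have IH: "nested S s h' (Q' \<union> T) Z = nested S s h' Q' (Z(q := z))"
    if "card Q' < card Q" "Q' \<subseteq> Q" "q \<in> \<Union>Q'" "expectation h'" "h' = exp_E S \<or> enclosed s Q' T" for Q' h'
    unfolding z_def
  proof (rule less.hyps[OF that(1)])
    show "noncrossing_family ?k (Q' \<union> T)"
      using nc by (rule noncrossing_family_subset) (use that in auto)
    show "adm s (\<Union>(Q' \<union> T)) Z"
      using less.prems(4) by (rule adm_subset) (use that in auto)
    show "\<And>x y. x \<in> \<Union>T \<Longrightarrow> y \<in> \<Union>Q' \<Longrightarrow> ?k y < ?k q \<Longrightarrow> ?k y < ?k x" using yx that(2) by blast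
  qed (use less.prems(2) xq that in auto)
  have ncsub: "noncrossing_family ?k (under ?k Q U j)" "noncrossing_family ?k (after ?k Q U)" for j
    by (rule noncrossing_family_subset[OF ncQ under_subset] noncrossing_family_subset[OF ncQ after_subset])+
  note recQ = nested_rec[OF ncQ Q0 U_def, of S h]
  from first_block_cases[OF ncQ inj_side_key Q0 U_def W0(1)]
  consider "W0 = U" | i where "i \<in> U" "W0 \<in> under ?k Q U i" | "W0 \<in> after ?k Q U" by blast
  then have "nested S s h (Q \<union> T) Z = nested S s h Q (Z(q := z))"
  proof cases
    case 1
    then have qU: "q \<in> U" using W0 by simp
    have under_eq: "nested S s h' (under ?k Q U j) (Z(q := z)) = nested S s h' (under ?k Q U j) Z" for h' j
      using first_block_notin(1)[OF ncQ U qU] by (intro nested_cong[OF ncsub(1)]) auto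
    have after_eq: "nested S s h (after ?k Q U) (Z(q := z)) = nested S s h (after ?k Q U) Z"
      using first_block_notin(2)[OF ncQ U qU] by (intro nested_cong[OF ncsub(2)]) auto
    let ?f = "filled S s Q U Z"
    have fz: "ordered_prod U (filled S s Q U (Z(q := z))) = ordered_prod U (?f(q := put_before S (s q) ?c (?f q)))"
      using finU under_eq by (intro ordered_prod_cong) (auto simp: filled_def z_def put_after_before)
    have admf: "adm s U ?f" using adm_filled[OF U adm_subset[OF less.prems(4)]] by auto
    show ?thesis
    proof (cases "\<exists>u\<in>U. ?k u < ?k q")
      case True
      then have mq: "m \<noteq> q" using m(2) UQ by fastforce
      have "finite {u \<in> U. ?k u < ?k q}" "{u \<in> U. ?k u < ?k q} \<noteq> {}" using True finU by auto
      then obtain i where i: "i \<in> {u \<in> U. ?k u < ?k q}" "\<forall>u\<in>{u \<in> U. ?k u < ?k q}. ?k u \<le> ?k i"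
        by (rule finite_key_max)
      then have iU: "i \<in> U" "?k i < ?k q" by auto
      have adj: "\<not> ?k u < ?k q" if "u \<in> U" "?k i < ?k u" for u using i(2) that by fastforce
      have gap: "?k i < ?k x" if "x \<in> \<Union>T" for x using yx[OF that UQ[OF iU(1)] iU(2)] .
      have gap': "?k x < ?k u" if "x \<in> \<Union>T" "u \<in> U" "?k i < ?k u" for x u
        using adj[OF that(2,3)] xq[OF that(1)] by simp
      note all = under_all[of i U q ?k T, OF iU(1) qU iU(2) inj_side_key R0 gap gap']
      \<comment> \<open>Here \<open>T\<close> is adjacent to the end \<open>q\<close> of the gap, so
        the blocks already in the gap precede it and its value is absorbed last.\<close>
      have "nested S s (exp_E S) (under ?k Q U i \<union> T) Z = nested S s (exp_E S) (under ?k Q U i) Z * ?c"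
      proof (rule nested_Un)
        show "noncrossing_family ?k (under ?k Q U i \<union> T)"
          using nc by (rule noncrossing_family_subset) (auto simp: under_def)
        fix y x assume x: "x \<in> \<Union>T" and y: "y \<in> \<Union>(under ?k Q U i)"
        then have "y \<in> \<Union>Q" "?k y < ?k q" using iU qU by (auto simp: under_def)
        then show "?k y < ?k x" using yx x by blast
      qed
      then have "filled S s (Q \<union> T) U Z j = (?f(i := put_after S (s i) ?c (?f i))) j" if "j \<in> U" for j
        using all that by (cases "j = i") (auto simp: filled_def under_Un put_after_mult)
      then have "ordered_prod U (filled S s (Q \<union> T) U Z) = ordered_prod U (?f(i := put_after S (s i) ?c (?f i)))"
        using finU by (intro ordered_prod_cong) auto
      \<comment> \<open>The points \<open>i\<close> and \<open>q\<close> are consecutive in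
        \<open>U\<close>, so the value may pass from the one to the other.\<close>
      moreover have "h (ordered_prod U (?f(i := put_after S (s i) ?c (?f i)))) =
          h (ordered_prod U (?f(q := put_before S (s q) ?c (?f q))))"
        using finU iU qU admf adj less.prems(7)
        by (intro equivalentD[OF ordered_prod_put_adjacent]) auto
      ultimately have "h (ordered_prod U (filled S s (Q \<union> T) U Z)) = h (ordered_prod U (filled S s Q U (Z(q := z))))"
        by (simp only: fz)
      then show ?thesis using nested_rec[OF nc _ U'[OF mq], of S h Z] recQ Q0 all(3) after_eq
        by (simp add: after_Un)
    next
      case False
      then have min: "\<not> ?k u < ?k q" if "u \<in> U" for u using that by blast
      have "?k q \<le> ?k y" if "y \<in> \<Union>Q" for y using m min[OF m(1)] that by fastforce
      then have lt: "?k x < ?k y" if "x \<in> \<Union>T" "y \<in> \<Union>Q" for x y using that xq by fastforce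
      \<comment> \<open>No point of \<open>Q\<close> precedes \<open>T\<close> now, so
        \<open>T\<close> cannot be enclosed.\<close>
      have hE: "h = exp_E S"
      proof (rule ccontr)
        assume "h \<noteq> exp_E S"
        then obtain W u where "W \<in> Q" "u \<in> W" "?k u < ?k x0"
          using less.prems(8) x0 unfolding enclosed_def by blast
        then show False using lt[OF x0, of u] by auto
      qed
      have "nested S s (exp_E S) (T \<union> Q) Z = ?c * nested S s (exp_E S) Q Z"
        using nc lt by (intro nested_Un) (auto simp: Un_commute)
      moreover have "h (ordered_prod U (filled S s Q U (Z(q := z)))) = ?c * h (ordered_prod U ?f)"
      proof -
        have "ordered_prod U (?f(q := put_before S (s q) ?c (?f q))) \<approx> L ?c * ordered_prod U ?f"
          using finU qU admf min by (intro ordered_prod_put_before_min) auto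
        then show ?thesis unfolding fz
          using less.prems(7) by (simp add: equivalentD expectation_bimodule)
      qed
      ultimately show ?thesis using recQ after_eq hE by (simp add: Un_commute mult.assoc)
    qed
  next
    case (2 i)
    then have qi: "q \<in> \<Union>(under ?k Q U i)" using W0 by blast
    then obtain v where v: "v \<in> U" "?k i < ?k v" by (auto simp: under_def)
    have iq: "?k i < ?k q" and qu: "?k q < ?k u" if "u \<in> U" "?k i < ?k u" for u
      using qi that by (auto simp: under_def)
    have mq: "m \<noteq> q" using first_block_notin(1)[OF ncQ U m(1)] qi by auto
    show ?thesis
    proof (rule nested_step_under[OF nc Q0 U_def U'[OF mq] 2(1) v _ _ qi IH])
      show "card (under ?k Q U i) < card Q" using ncQ U by (rule card_under_after_less)
      show "under ?k Q U i \<subseteq> Q" by (rule under_subset)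
      show "?k i < ?k x" if "x \<in> \<Union>T" for x using yx[OF that UQ[OF 2(1)] iq[OF v]] .
      show "?k x < ?k u" if "x \<in> \<Union>T" "u \<in> U" "?k i < ?k u" for x u
        using xq[OF that(1)] qu[OF that(2,3)] by simp
    qed (use qi in auto)
  next
    case 3
    then have qa: "q \<in> \<Union>(after ?k Q U)" using W0 by blast
    have mq: "m \<noteq> q" using first_block_notin(2)[OF ncQ U m(1)] qa by auto
    have gt: "?k u < ?k x" if "x \<in> \<Union>T" "u \<in> U" for x u
    proof -
      have "?k u < ?k q" using qa that(2) by (auto simp: after_def)
      then show ?thesis using yx[OF that(1) UQ[OF that(2)]] by simp
    qed
    show ?thesis
    proof (rule nested_step_after[OF nc Q0 U_def U'[OF mq] gt qa IH])
      show "card (after ?k Q U) < card Q" using ncQ U by (rule card_under_after_less)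
      show "after ?k Q U \<subseteq> Q" by (rule after_subset)
      show "h = exp_E S \<or> enclosed s (after ?k Q U) T"
        using less.prems(8) enclosed_after[OF ncQ Q0 U_def R0 less.prems(2) gt] by blast
    qed (use qa less.prems(7) in auto)
  qed
  then show ?case by (simp add: z_def)
qed


section \<open>Linearity and multiplicativity of nested expectations\<close>

lemma nested_linear:
  assumes "noncrossing_family (side_key s) P" "r \<in> \<Union>P" "expectation h"
  shows "nested S s h P (Z(r := sA a X + sA b Y)) =
    sD a (nested S s h P (Z(r := X))) + sD b (nested S s h P (Z(r := Y)))"
  using assms
proof (induction "card P" arbitrary: P h rule: less_induct)
  case less
  note nc = less.prems(1)
  let ?k = "side_key s"
  have P0: "P \<noteq> {}" using less.prems(2) by auto
  define U where "U = first_block ?k P"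
  have U: "U \<in> P" using first_block(1)[OF nc P0] U_def by simp
  have finU: "finite U" using noncrossing_familyD(2)[OF nc U] .
  note rec = nested_rec[OF nc P0 U_def, of S h]
  have ncsub: "noncrossing_family ?k (under ?k P U j)" "noncrossing_family ?k (after ?k P U)" for j
    by (rule noncrossing_family_subset[OF nc under_subset] noncrossing_family_subset[OF nc after_subset])+
  have under_eq: "nested S s h' (under ?k P U j) (Z(r := z)) = nested S s h' (under ?k P U j) Z"
    if "r \<notin> \<Union>(under ?k P U j)" for h' j z
    using that by (intro nested_cong[OF ncsub(1)]) auto
  have after_eq: "nested S s h' (after ?k P U) (Z(r := z)) = nested S s h' (after ?k P U) Z"
    if "r \<notin> \<Union>(after ?k P U)" for h' z
    using that by (intro nested_cong[OF ncsub(2)]) auto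
  \<comment> \<open>Covers both \<open>r\<close> in \<open>U\<close> and \<open>r\<close> in a gap
    of \<open>U\<close>: the variable at \<open>r\<close> then enters the product over
    \<open>U\<close> through the single factor at \<open>i\<close>, and linearly through
    \<open>g\<close>.\<close>
  have block: ?case
    if "i \<in> U" "r \<notin> \<Union>(after ?k P U)" and f: "\<And>z. z \<in> {sA a X + sA b Y, X, Y} \<Longrightarrow>
        ordered_prod U (filled S s P U (Z(r := z))) = ordered_prod U ((filled S s P U Z)(i := g z))"
      and g: "g (sA a X + sA b Y) = sA a (g X) + sA b (g Y)" for i g
  proof -
    let ?op = "\<lambda>z. ordered_prod U (filled S s P U (Z(r := z)))"
    have "?op (sA a X + sA b Y) = sA a (?op X) + sA b (?op Y)"
      by (simp only: f g ordered_prod_linear[OF finU that(1)] insert_iff simp_thms)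
    then show ?thesis
      using less.prems(3) that(2)
      by (simp add: rec after_eq expectation_linear distrib_right sD_mult)
  qed
  obtain W where W: "W \<in> P" "r \<in> W" using less.prems(2) by blast
  from first_block_cases[OF nc inj_side_key P0 U_def W(1)]
  consider "W = U" | i where "i \<in> U" "W \<in> under ?k P U i" | "W \<in> after ?k P U" by blast
  then show ?case
  proof cases
    case 1
    then have rU: "r \<in> U" using W by simp
    show ?thesis
    proof (rule block[OF rU, where g = "put_after S (s r) (nested S s (exp_E S) (under ?k P U r) Z)"])
      show "r \<notin> \<Union>(after ?k P U)" by (rule first_block_notin(2)[OF nc U rU])
      show "ordered_prod U (filled S s P U (Z(r := z))) = ordered_prod U ((filled S s P U Z)
        (r := put_after S (s r) (nested S s (exp_E S) (under ?k P U r) Z) z))" for z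
        using finU first_block_notin(1)[OF nc U rU] under_eq
        by (intro ordered_prod_cong) (auto simp: filled_def)
    qed (rule put_after_linear_right)
  next
    case (2 i)
    then have r: "r \<in> \<Union>(under ?k P U i)" using W by blast
    show ?thesis
    proof (rule block[OF 2(1), where
          g = "\<lambda>z. put_after S (s i) (nested S s (exp_E S) (under ?k P U i) (Z(r := z))) (Z i)"])
      show "r \<notin> \<Union>(after ?k P U)" by (rule under_after_disjoint[OF r])
      have "r \<notin> \<Union>(under ?k P U j)" if "j \<in> U" "j \<noteq> i" for j
        using under_unique[OF inj_side_key 2(1) that(1) r] that(2) by auto
      moreover have "r \<notin> U" using first_block_notin(1)[OF nc U] r by blast
      ultimately show "ordered_prod U (filled S s P U (Z(r := z))) = ordered_prod U ((filled S s P U Z)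
        (i := put_after S (s i) (nested S s (exp_E S) (under ?k P U i) (Z(r := z))) (Z i)))" for z
        using finU under_eq 2(1) by (intro ordered_prod_cong) (auto simp: filled_def)
      have "nested S s (exp_E S) (under ?k P U i) (Z(r := sA a X + sA b Y)) =
        sD a (nested S s (exp_E S) (under ?k P U i) (Z(r := X))) +
        sD b (nested S s (exp_E S) (under ?k P U i) (Z(r := Y)))"
        using card_under_after_less(1)[OF nc U] ncsub(1) r by (intro less.hyps) auto
      then show "put_after S (s i) (nested S s (exp_E S) (under ?k P U i) (Z(r := sA a X + sA b Y))) (Z i) =
        sA a (put_after S (s i) (nested S s (exp_E S) (under ?k P U i) (Z(r := X))) (Z i)) +
        sA b (put_after S (s i) (nested S s (exp_E S) (under ?k P U i) (Z(r := Y))) (Z i))"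
        by (simp add: put_after_linear_left)
    qed
  next
    case 3
    then have r: "r \<in> \<Union>(after ?k P U)" using W by blast
    then have "r \<notin> \<Union>(under ?k P U j)" for j using under_after_disjoint by blast
    moreover have "r \<notin> U" using first_block_notin(2)[OF nc U] r by blast
    ultimately have "ordered_prod U (filled S s P U (Z(r := z))) = ordered_prod U (filled S s P U Z)" for z
      using finU under_eq by (intro ordered_prod_cong) (auto simp: filled_def)
    moreover have "nested S s h (after ?k P U) (Z(r := sA a X + sA b Y)) =
        sD a (nested S s h (after ?k P U) (Z(r := X))) + sD b (nested S s h (after ?k P U) (Z(r := Y)))"
      using card_under_after_less(2)[OF nc U] ncsub(2) r less.prems(3) by (intro less.hyps) auto
    ultimately show ?thesis by (simp add: rec distrib_left sD_mult)
  qed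
qed

lemma nested_single_block:
  assumes "finite V" "V \<noteq> {}"
  shows "nested S s h {V} Z = h (ordered_prod V Z)"
proof -
  have nc: "noncrossing_family (side_key s) {V}"
    using assms by (simp add: noncrossing_family_def disjoint_def)
  have V: "V = first_block (side_key s) {V}" using first_block(1)[OF nc] by simp
  have e: "under (side_key s) {V} V i = {}" "after (side_key s) {V} V = {}" for i
    using in_under_imp[of V _ "{V}" V i] in_after_imp[of V _ "{V}" V] assms(2)
      under_subset[of _ "{V}" V i] after_subset[of _ "{V}" V] by blast+
  show ?thesis using nested_rec[OF nc _ V, of S h Z] by (simp add: e filled_def)
qed

lemma nested_concat:
  assumes "noncrossing_family (side_key s) P" "\<And>U. U \<in> P \<Longrightarrow> \<exists>V\<in>set Vs. U \<subseteq> V"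
    "sorted_wrt (\<lambda>V W. \<forall>i\<in>V. \<forall>j\<in>W. side_key s i < side_key s j) Vs"
  shows "nested S s h P Z = prod_list (map (\<lambda>V. nested S s h {U \<in> P. U \<subseteq> V} Z) Vs)"
  using assms
proof (induction Vs arbitrary: P)
  case Nil
  then have "P = {}" by auto
  then show ?case by simp
next
  case (Cons V Vs)
  let ?Q = "{U \<in> P. \<exists>W\<in>set Vs. U \<subseteq> W}"
  have P: "P = {U \<in> P. U \<subseteq> V} \<union> ?Q" using Cons.prems(2) by auto
  have "nested S s h P Z = nested S s h {U \<in> P. U \<subseteq> V} Z * nested S s h ?Q Z"
  proof (subst P, rule nested_Un)
    show "noncrossing_family (side_key s) ({U \<in> P. U \<subseteq> V} \<union> ?Q)"
      using Cons.prems(1) P by simp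
    fix x y assume "x \<in> \<Union>{U \<in> P. U \<subseteq> V}" "y \<in> \<Union>?Q"
    then obtain W where "x \<in> V" "y \<in> W" "W \<in> set Vs" by blast
    then show "side_key s x < side_key s y" using Cons.prems(3) by simp
  qed
  also have "nested S s h ?Q Z = prod_list (map (\<lambda>V. nested S s h {U \<in> ?Q. U \<subseteq> V} Z) Vs)"
    using Cons.prems by (intro Cons.IH noncrossing_family_subset[OF Cons.prems(1)]) auto
  also have "map (\<lambda>V. nested S s h {U \<in> ?Q. U \<subseteq> V} Z) Vs = map (\<lambda>V. nested S s h {U \<in> P. U \<subseteq> V} Z) Vs"
  proof (intro map_cong refl)
    fix W assume "W \<in> set Vs"
    then have "{U \<in> ?Q. U \<subseteq> W} = {U \<in> P. U \<subseteq> W}" by auto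
    then show "nested S s h {U \<in> ?Q. U \<subseteq> W} Z = nested S s h {U \<in> P. U \<subseteq> W} Z" by simp
  qed
  finally show ?case by simp
qed

end

section \<open>Invariance under increasing relabelling\<close>

lemma side_key_relabel:
  assumes "strict_mono_on A f" "\<And>i. i \<in> A \<Longrightarrow> s' (f i) = s i" "i \<in> A" "j \<in> A"
  shows "side_key s' (f i) < side_key s' (f j) \<longleftrightarrow> side_key s i < side_key s j"
  using assms strict_mono_on_less[OF assms(1)] by (auto simp: side_key_less_iff)

lemma noncrossing_family_image:
  assumes nc: "noncrossing_family k P" and f: "inj_on f (\<Union>P)"
    and k: "\<And>i j. i \<in> \<Union>P \<Longrightarrow> j \<in> \<Union>P \<Longrightarrow> k' (f i) < k' (f j) \<longleftrightarrow> k i < k j"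
  shows "noncrossing_family k' ((`) f ` P)"
  unfolding noncrossing_family_def
proof (intro conjI ballI impI)
  note D = noncrossing_familyD[OF nc]
  show "finite ((`) f ` P)" using D(1) by simp
  show "disjoint ((`) f ` P)"
  proof (rule disjointI)
    fix a b assume "a \<in> (`) f ` P" "b \<in> (`) f ` P" "a \<noteq> b"
    then obtain U W where UW: "U \<in> P" "W \<in> P" "a = f ` U" "b = f ` W" "U \<noteq> W" by blast
    then have "U \<inter> W = {}" using D(5) by blast
    then have "f ` (U \<inter> W) = {}" by simp
    moreover have "f ` (U \<inter> W) = a \<inter> b"
      using UW inj_on_image_Int[OF f, of U W] by (simp add: Union_upper)
    ultimately show "a \<inter> b = {}" by simp
  qed
  fix V W i j a l
  assume VW: "V \<in> (`) f ` P" "W \<in> (`) f ` P"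
    and ij: "i \<in> V" "j \<in> W" "a \<in> V" "l \<in> W" and lt: "k' i < k' j \<and> k' j < k' a \<and> k' a < k' l"
  obtain V0 W0 where V0: "V0 \<in> P" "V = f ` V0" "W0 \<in> P" "W = f ` W0" using VW by blast
  obtain i0 j0 a0 l0 where o: "i0 \<in> V0" "i = f i0" "j0 \<in> W0" "j = f j0" "a0 \<in> V0" "a = f a0" "l0 \<in> W0" "l = f l0"
    using ij V0 by blast
  have "i0 \<in> \<Union>P" "j0 \<in> \<Union>P" "a0 \<in> \<Union>P" "l0 \<in> \<Union>P" using o V0 by blast+
  then have "k i0 < k j0" "k j0 < k a0" "k a0 < k l0" using lt k o by simp_all
  then show "V = W" using D(6)[OF V0(1,3) o(1,3,5,7)] V0 by simp
qed (use noncrossing_familyD[OF nc] in auto)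

lemma filter_image_eq:
  assumes "\<And>W. W \<in> P \<Longrightarrow> C' (g W) \<longleftrightarrow> C W"
  shows "{X \<in> g ` P. C' X} = g ` {W \<in> P. C W}"
  using assms by auto

text \<open>The recursion depends on the sides, the variables and the order of the keys, and by
  \<open>side_key_relabel\<close> an increasing relabelling that keeps the sides respects this
  order. This links the definitions, which relabel at each restriction, to the closed form, which
  never does.\<close>

lemma nested_relabel:
  assumes "noncrossing_family (side_key s) P" "strict_mono_on (\<Union>P) f"
    "\<And>i. i \<in> \<Union>P \<Longrightarrow> s' (f i) = s i" "\<And>i. i \<in> \<Union>P \<Longrightarrow> Z' (f i) = Z i"
  shows "nested S s' h ((`) f ` P) Z' = nested S s h P Z"
  using assms
proof (induction "card P" arbitrary: P h rule: less_induct)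
  case less
  note nc = less.prems(1)
  let ?k = "side_key s" and ?k' = "side_key s'"
  show ?case
  proof (cases "P = {}")
    case P0: False
    have k: "?k' (f i) < ?k' (f j) \<longleftrightarrow> ?k i < ?k j" if "i \<in> \<Union>P" "j \<in> \<Union>P" for i j
      using less.prems(2,3) that by (rule side_key_relabel)
    have nc': "noncrossing_family ?k' ((`) f ` P)"
      using noncrossing_family_image[OF nc strict_mono_on_imp_inj_on[OF less.prems(2)] k] .
    define U where "U = first_block ?k P"
    have U: "U \<in> P" and "\<exists>m\<in>U. \<forall>x\<in>\<Union>P. ?k m \<le> ?k x"
      using first_block[OF nc P0] U_def by simp_all
    then obtain m where m: "m \<in> U" "\<forall>x\<in>\<Union>P. ?k m \<le> ?k x" by blast
    have U': "f ` U = first_block ?k' ((`) f ` P)"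
    proof (rule first_block_eqI[OF nc' inj_side_key, symmetric])
      show "f m \<in> f ` U" using m by simp
      fix x assume "x \<in> \<Union>((`) f ` P)"
      then obtain y where "y \<in> \<Union>P" "x = f y" by auto
      then show "?k' (f m) \<le> ?k' x" using m U k[of y m] by (auto simp: not_less[symmetric])
    qed (use U in auto)
    have UP: "\<And>u. u \<in> U \<Longrightarrow> u \<in> \<Union>P" using U by blast
    have und: "under ?k' ((`) f ` P) (f ` U) (f i) = (`) f ` under ?k P U i" if i: "i \<in> U" for i
    proof -
      have "(\<exists>v\<in>f ` U. ?k' (f i) < ?k' v) \<longleftrightarrow> (\<exists>v\<in>U. ?k i < ?k v)" using k UP i by auto
      moreover have "(\<forall>x\<in>f ` W. ?k' (f i) < ?k' x \<and> (\<forall>u\<in>f ` U. ?k' (f i) < ?k' u \<longrightarrow> ?k' x < ?k' u)) \<longleftrightarrow>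
        (\<forall>x\<in>W. ?k i < ?k x \<and> (\<forall>u\<in>U. ?k i < ?k u \<longrightarrow> ?k x < ?k u))" if W: "W \<in> P" for W
      proof -
        have "\<And>x. x \<in> W \<Longrightarrow> x \<in> \<Union>P" using W by blast
        then show ?thesis using k UP i by simp
      qed
      ultimately show ?thesis unfolding under_def by (intro filter_image_eq) (simp only:)
    qed
    have aft: "after ?k' ((`) f ` P) (f ` U) = (`) f ` after ?k P U"
    proof -
      have "(\<forall>x\<in>f ` W. \<forall>u\<in>f ` U. ?k' u < ?k' x) \<longleftrightarrow> (\<forall>x\<in>W. \<forall>u\<in>U. ?k u < ?k x)" if W: "W \<in> P" for W
      proof -
        have "\<And>x. x \<in> W \<Longrightarrow> x \<in> \<Union>P" using W by blast
        then show ?thesis using k UP by simp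
      qed
      then show ?thesis unfolding after_def by (intro filter_image_eq)
    qed
    have IH: "nested S s' h' ((`) f ` Q) Z' = nested S s h' Q Z" if "card Q < card P" "Q \<subseteq> P" for h' Q
    proof -
      have "\<Union>Q \<subseteq> \<Union>P" using that by blast
      then show ?thesis
        using that(1) less.prems(3,4) noncrossing_family_subset[OF nc that(2)]
          monotone_on_subset[OF less.prems(2)] by (intro less.hyps) auto
    qed
    note c = card_under_after_less[OF nc U]
    have finU: "finite U" using noncrossing_familyD(2)[OF nc U] .
    have "strict_mono_on U f" using less.prems(2) U by (auto intro: monotone_on_subset)
    then have "ordered_prod (f ` U) (filled S s' ((`) f ` P) (f ` U) Z') = ordered_prod U (filled S s P U Z)"
      using less.prems(3,4)[OF UP] und IH[OF c(1) under_subset] finU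
      by (subst ordered_prod_image) (auto simp: filled_def intro!: ordered_prod_cong)
    then show ?thesis
      using nested_rec[OF nc' _ U', of S h Z'] nested_rec[OF nc P0 U_def, of S h Z] P0 aft
        IH[OF c(2) after_subset] by simp
  qed simp
qed


section \<open>Bi-non-crossing partitions and their restrictions\<close>

text \<open>Separates the crossing condition, which passes to subfamilies, from the covering
  condition, which does not.\<close>

lemma BNC_iff:
  "\<pi> \<in> BNC \<chi> \<longleftrightarrow> noncrossing_family (side_key ((!) \<chi>)) \<pi> \<and> \<Union>\<pi> = {..<length \<chi>}"
proof -
  have p: "partition_on {..<length \<chi>} \<pi> \<longleftrightarrow>
      finite \<pi> \<and> (\<forall>U\<in>\<pi>. finite U \<and> U \<noteq> {}) \<and> disjoint \<pi> \<and> \<Union>\<pi> = {..<length \<chi>}"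
  proof
    assume p: "partition_on {..<length \<chi>} \<pi>"
    have "finite U" if "U \<in> \<pi>" for U
    proof (rule finite_subset)
      show "U \<subseteq> {..<length \<chi>}" using that partition_onD1[OF p] by blast
    qed simp
    moreover have "finite \<pi>" using p by (rule finite_elements[rotated]) simp
    ultimately show "finite \<pi> \<and> (\<forall>U\<in>\<pi>. finite U \<and> U \<noteq> {}) \<and> disjoint \<pi> \<and> \<Union>\<pi> = {..<length \<chi>}"
      using p unfolding partition_on_def by auto
  qed (auto simp: partition_on_def)
  have q: "(\<forall>V\<in>\<pi>. \<forall>W\<in>\<pi>. \<forall>i\<in>V. \<forall>j\<in>W. \<forall>k\<in>V. \<forall>l\<in>W.
        chi_less \<chi> i j \<and> chi_less \<chi> j k \<and> chi_less \<chi> k l \<longrightarrow> V = W) \<longleftrightarrow>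
      (\<forall>V\<in>\<pi>. \<forall>W\<in>\<pi>. \<forall>i\<in>V. \<forall>j\<in>W. \<forall>a\<in>V. \<forall>l\<in>W.
        side_key ((!) \<chi>) i < side_key ((!) \<chi>) j \<and> side_key ((!) \<chi>) j < side_key ((!) \<chi>) a \<and>
        side_key ((!) \<chi>) a < side_key ((!) \<chi>) l \<longrightarrow> V = W)" (is "?A \<longleftrightarrow> ?B") if "\<Union>\<pi> = {..<length \<chi>}"
  proof -
    have lt: "i < length \<chi>" if "V \<in> \<pi>" "i \<in> V" for V i
      using that \<open>\<Union>\<pi> = {..<length \<chi>}\<close> by blast
    show ?thesis by (intro ball_cong refl) (use lt in \<open>simp add: chi_less_iff\<close>)
  qed
  show ?thesis
    unfolding BNC_def noncrossing_family_def mem_Collect_eq using p q by argo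
qed

lemma BNC_noncrossing: "\<pi> \<in> BNC \<chi> \<Longrightarrow> noncrossing_family (side_key ((!) \<chi>)) \<pi>"
  and BNC_Union: "\<pi> \<in> BNC \<chi> \<Longrightarrow> \<Union>\<pi> = {..<length \<chi>}"
  by (simp_all add: BNC_iff)

lemma union_of_blocks_Union:
  assumes "union_of_blocks \<pi> V" shows "\<Union>{U \<in> \<pi>. U \<subseteq> V} = V"
proof -
  obtain P where "P \<subseteq> \<pi>" "V = \<Union>P" using assms by (auto simp: union_of_blocks_def)
  then show ?thesis by blast
qed

lemma restr_union_of_blocks_facts:
  assumes "\<pi> \<in> BNC \<chi>" "union_of_blocks \<pi> V"
  shows "V \<subseteq> {..<length \<chi>}" "finite V" "restr \<pi> V = (`) (rank V) ` {U \<in> \<pi>. U \<subseteq> V}"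
    "noncrossing_family (side_key ((!) \<chi>)) {U \<in> \<pi>. U \<subseteq> V}"
    "strict_mono_on (\<Union>{U \<in> \<pi>. U \<subseteq> V}) (rank V)"
    "\<And>i. i \<in> \<Union>{U \<in> \<pi>. U \<subseteq> V} \<Longrightarrow> nths \<chi> V ! rank V i = \<chi> ! i"
proof -
  note V = union_of_blocks_Union[OF assms(2)]
  show sub: "V \<subseteq> {..<length \<chi>}" using V BNC_Union[OF assms(1)] by blast
  then show fin: "finite V" by (rule finite_subset) simp
  show "restr \<pi> V = (`) (rank V) ` {U \<in> \<pi>. U \<subseteq> V}"
    using assms by (intro restr_union_of_blocks[of "{..<length \<chi>}"]) (auto simp: BNC_def)
  show "noncrossing_family (side_key ((!) \<chi>)) {U \<in> \<pi>. U \<subseteq> V}"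
    using BNC_noncrossing[OF assms(1)] by (rule noncrossing_family_subset) auto
  show "strict_mono_on (\<Union>{U \<in> \<pi>. U \<subseteq> V}) (rank V)" using fin by (intro strict_mono_rank) auto
  show "\<And>i. i \<in> \<Union>{U \<in> \<pi>. U \<subseteq> V} \<Longrightarrow> nths \<chi> V ! rank V i = \<chi> ! i"
    using sub by (auto intro: nth_nths_rank)
qed

lemma restr_BNC:
  assumes "\<pi> \<in> BNC \<chi>" "union_of_blocks \<pi> V"
  shows "restr \<pi> V \<in> BNC (nths \<chi> V)"
proof -
  note aux = restr_union_of_blocks_facts[OF assms]
  have "noncrossing_family (side_key ((!) (nths \<chi> V))) ((`) (rank V) ` {U \<in> \<pi>. U \<subseteq> V})"
    using aux(4) strict_mono_on_imp_inj_on[OF aux(5)]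
      side_key_relabel[OF aux(5), where s' = "(!) (nths \<chi> V)" and s = "(!) \<chi>", OF aux(6)]
    by (rule noncrossing_family_image)
  moreover have "\<Union>((`) (rank V) ` {U \<in> \<pi>. U \<subseteq> V}) = rank V ` V"
    using union_of_blocks_Union[OF assms(2)] by (metis image_Union)
  ultimately show ?thesis
    using aux(1-3) by (simp add: BNC_iff rank_image length_nths_subset)
qed

lemma nested_restr:
  assumes "\<pi> \<in> BNC \<chi>" "union_of_blocks \<pi> V" "length Z = length \<chi>"
  shows "nested S ((!) (nths \<chi> V)) h (restr \<pi> V) ((!) (nths Z V)) =
    nested S ((!) \<chi>) h {U \<in> \<pi>. U \<subseteq> V} ((!) Z)"
proof -
  note aux = restr_union_of_blocks_facts[OF assms(1,2)]
  show ?thesis unfolding aux(3)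
    using aux(1) assms(3) by (intro nested_relabel[OF aux(4,5,6)] nth_nths_rank) auto
qed

section \<open>Extremal points, interior blocks and the block removed\<close>

lemma chi_min_eqI:
  assumes "V \<subseteq> {..<length \<chi>}" "m \<in> V" "\<And>x. x \<in> V \<Longrightarrow> side_key ((!) \<chi>) m \<le> side_key ((!) \<chi>) x"
  shows "chi_min \<chi> V = m"
  unfolding chi_min_def
proof (rule the_equality)
  have "side_key ((!) \<chi>) x \<noteq> side_key ((!) \<chi>) m" if "x \<noteq> m" for x
    using that inj_side_key[of "(!) \<chi>"] by (simp add: inj_eq)
  then have "chi_less \<chi> m j" if "j \<in> V" "j \<noteq> m" for j
    using assms(1,2) assms(3)[OF that(1)] that unfolding chi_less_iff
    by (metis lessThan_iff order.not_eq_order_implies_strict subsetD)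
  then show "m \<in> V \<and> (\<forall>j\<in>V. j \<noteq> m \<longrightarrow> chi_less \<chi> m j)" using assms(2) by blast
  show "i = m" if "i \<in> V \<and> (\<forall>j\<in>V. j \<noteq> i \<longrightarrow> chi_less \<chi> i j)" for i
    using that assms(2) assms(3)[of i] unfolding chi_less_iff by (metis not_le)
qed

lemma chi_max_eqI:
  assumes "V \<subseteq> {..<length \<chi>}" "m \<in> V" "\<And>x. x \<in> V \<Longrightarrow> side_key ((!) \<chi>) x \<le> side_key ((!) \<chi>) m"
  shows "chi_max \<chi> V = m"
  unfolding chi_max_def
proof (rule the_equality)
  have "side_key ((!) \<chi>) x \<noteq> side_key ((!) \<chi>) m" if "x \<noteq> m" for x
    using that inj_side_key[of "(!) \<chi>"] by (simp add: inj_eq)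
  then have "chi_less \<chi> j m" if "j \<in> V" "j \<noteq> m" for j
    using assms(1,2) assms(3)[OF that(1)] that unfolding chi_less_iff
    by (metis lessThan_iff order.not_eq_order_implies_strict subsetD)
  then show "m \<in> V \<and> (\<forall>j\<in>V. j \<noteq> m \<longrightarrow> chi_less \<chi> j m)" using assms(2) by blast
  show "i = m" if "i \<in> V \<and> (\<forall>j\<in>V. j \<noteq> i \<longrightarrow> chi_less \<chi> j i)" for i
    using that assms(2) assms(3)[of i] unfolding chi_less_iff by (metis not_le)
qed

lemma chi_min:
  assumes "V \<subseteq> {..<length \<chi>}" "V \<noteq> {}"
  shows "chi_min \<chi> V \<in> V" "x \<in> V \<Longrightarrow> side_key ((!) \<chi>) (chi_min \<chi> V) \<le> side_key ((!) \<chi>) x"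
proof -
  have "finite V" using assms(1) by (rule finite_subset) simp
  then obtain m where m: "m \<in> V" "\<forall>x\<in>V. side_key ((!) \<chi>) m \<le> side_key ((!) \<chi>) x"
    using assms(2) by (rule finite_key_min)
  then have "chi_min \<chi> V = m" using assms(1) by (intro chi_min_eqI) auto
  then show "chi_min \<chi> V \<in> V" "x \<in> V \<Longrightarrow> side_key ((!) \<chi>) (chi_min \<chi> V) \<le> side_key ((!) \<chi>) x"
    using m by auto
qed

lemma chi_max:
  assumes "V \<subseteq> {..<length \<chi>}" "V \<noteq> {}"
  shows "chi_max \<chi> V \<in> V" "x \<in> V \<Longrightarrow> side_key ((!) \<chi>) x \<le> side_key ((!) \<chi>) (chi_max \<chi> V)"
proof -
  have "finite V" using assms(1) by (rule finite_subset) simp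
  then obtain m where m: "m \<in> V" "\<forall>x\<in>V. side_key ((!) \<chi>) x \<le> side_key ((!) \<chi>) m"
    using assms(2) by (rule finite_key_max)
  then have "chi_max \<chi> V = m" using assms(1) by (intro chi_max_eqI) auto
  then show "chi_max \<chi> V \<in> V" "x \<in> V \<Longrightarrow> side_key ((!) \<chi>) x \<le> side_key ((!) \<chi>) (chi_max \<chi> V)"
    using m by auto
qed

text \<open>Interior blocks without reference to extremal points: this form makes sense for any key
  and is unchanged when the key is negated.\<close>

definition interior_block :: "(nat \<Rightarrow> real) \<Rightarrow> nat set set \<Rightarrow> nat set \<Rightarrow> bool" where
  "interior_block k P U \<longleftrightarrow>
     U \<in> P \<and> (\<exists>W\<in>P. W \<noteq> U \<and> (\<exists>u\<in>W. \<exists>v\<in>W. \<forall>x\<in>U. k u < k x \<and> k x < k v))"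

lemma interior_iff:
  assumes "\<pi> \<in> BNC \<chi>"
  shows "interior \<chi> \<pi> V \<longleftrightarrow> interior_block (side_key ((!) \<chi>)) \<pi> V"
proof -
  let ?k = "side_key ((!) \<chi>)"
  have sub: "U \<subseteq> {..<length \<chi>}" "U \<noteq> {}" if "U \<in> \<pi>" for U
    using that BNC_Union[OF assms] noncrossing_familyD(3)[OF BNC_noncrossing[OF assms]] by blast+
  have "chi_less \<chi> (chi_min \<chi> W) (chi_min \<chi> V) \<and> chi_less \<chi> (chi_max \<chi> V) (chi_max \<chi> W) \<longleftrightarrow>
    (\<exists>u\<in>W. \<exists>v\<in>W. \<forall>x\<in>V. ?k u < ?k x \<and> ?k x < ?k v)" if "V \<in> \<pi>" "W \<in> \<pi>" for W
  proof
    note v = chi_min[OF sub[OF that(1)]] chi_max[OF sub[OF that(1)]]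
    note w = chi_min[OF sub[OF that(2)]] chi_max[OF sub[OF that(2)]]
    show "\<exists>u\<in>W. \<exists>v\<in>W. \<forall>x\<in>V. ?k u < ?k x \<and> ?k x < ?k v"
      if "chi_less \<chi> (chi_min \<chi> W) (chi_min \<chi> V) \<and> chi_less \<chi> (chi_max \<chi> V) (chi_max \<chi> W)"
    proof (intro bexI ballI)
      fix x assume "x \<in> V"
      then show "?k (chi_min \<chi> W) < ?k x \<and> ?k x < ?k (chi_max \<chi> W)"
        using that v(2,4)[of x] by (auto simp: chi_less_iff)
    qed (use w in auto)
    assume "\<exists>u\<in>W. \<exists>v\<in>W. \<forall>x\<in>V. ?k u < ?k x \<and> ?k x < ?k v"
    then obtain u v where "u \<in> W" "v \<in> W" "\<forall>x\<in>V. ?k u < ?k x \<and> ?k x < ?k v" by blast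
    then have "?k (chi_min \<chi> W) < ?k (chi_min \<chi> V)" "?k (chi_max \<chi> V) < ?k (chi_max \<chi> W)"
      using v(1,3) w(2)[of u] w(4)[of v] by force+
    then show "chi_less \<chi> (chi_min \<chi> W) (chi_min \<chi> V) \<and> chi_less \<chi> (chi_max \<chi> V) (chi_max \<chi> W)"
      using v(1,3) w(1,3) sub[OF \<open>V \<in> \<pi>\<close>] sub[OF \<open>W \<in> \<pi>\<close>] by (auto simp: chi_less_iff)
  qed
  then show ?thesis unfolding interior_def interior_block_def
    by (intro conj_cong bex_cong refl)
qed

lemma interior_block_uminus: "interior_block (\<lambda>x. - k x) P U \<longleftrightarrow> interior_block k P U"
  unfolding interior_block_def by (simp only: neg_less_iff_less) blast

lemma last_block:
  assumes "finite P" "P \<noteq> {}"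
  shows "last_block P \<in> P" "U \<in> P \<Longrightarrow> Min U \<le> Min (last_block P)"
proof -
  show "last_block P \<in> P" using assms by (rule last_block_in)
  have "Max (Min ` P) \<in> Min ` P" using assms by (intro Max_in) auto
  then obtain V where V: "V \<in> P" "Min V = Max (Min ` P)" by auto
  have "is_arg_max Min (\<lambda>U. U \<in> P) V"
    using V assms(1) by (auto simp: is_arg_max_def not_less)
  then have "is_arg_max Min (\<lambda>U. U \<in> P) (last_block P)"
    unfolding last_block_def arg_max_on_def arg_max_def by (rule someI)
  then show "U \<in> P \<Longrightarrow> Min U \<le> Min (last_block P)" by (auto simp: is_arg_max_def not_less)
qed

text \<open>
  Assumption \<open>sep\<close> says that \<open>{m..}\<close> is an interval for \<open>k\<close>. In the applications \<open>m\<close> is the minimum of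
  \<open>V\<close>, and \<open>k\<close> is \<open>side_key\<close> or, to exchange left and right, its negative.
\<close>

lemma last_block_interval:
  assumes nc: "noncrossing_family k P" and V: "V \<in> P" "\<And>x. x \<in> V \<Longrightarrow> m \<le> x"
    and sep: "\<And>y. y < m \<Longrightarrow> (\<forall>x\<ge>m. k y < k x) \<or> (\<forall>x\<ge>m. k x < k y)"
    and last: "\<And>U. interior_block k P U \<Longrightarrow> U \<noteq> V \<Longrightarrow> Min U < m"
    and inj: "inj k" and U: "U \<in> P" "U \<noteq> V" "j \<in> U" and v: "v \<in> V" "v' \<in> V" "k v < k j" "k j < k v'"
  shows False
proof -
  note D = noncrossing_familyD[OF nc]
  have ne: "k y \<noteq> k x" if "y \<in> U" "x \<in> V" for x y
    using that D(5)[OF U(1) V(1)] U(2) inj by (metis inj_eq)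
  \<comment> \<open>A point \<open>y\<close> of \<open>U\<close> outside the span of
    \<open>v\<close> and \<open>v'\<close> would make \<open>U\<close> and \<open>V\<close>
    alternate at \<open>y\<close>, \<open>v\<close>, \<open>j\<close>, \<open>v'\<close> or at
    \<open>v\<close>, \<open>j\<close>, \<open>v'\<close>, \<open>y\<close>.\<close>
  have btw: "k v < k y \<and> k y < k v'" if y: "y \<in> U" for y
  proof (rule ccontr)
    assume "\<not> (k v < k y \<and> k y < k v')"
    then consider "k y < k v" | "k v' < k y" using ne[OF y v(1)] ne[OF y v(2)] by linarith
    then show False
    proof cases
      case 1
      then show False using D(6)[OF U(1) V(1) y v(1) U(3) v(2) _ v(3,4)] U(2) by simp
    next
      case 2
      then show False using D(6)[OF V(1) U(1) v(1) U(3) v(2) y v(3,4)] U(2) by simp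
    qed
  qed
  then have "interior_block k P U" using U V v unfolding interior_block_def by blast
  then have m: "Min U < m" using U(2) by (rule last)
  have "Min U \<in> U" using D(2,3)[OF U(1)] by simp
  \<comment> \<open>The minimum of \<open>U\<close> is below \<open>m\<close>, so it lies on one
    side of everything from \<open>m\<close> on, in particular not between \<open>v\<close> and
    \<open>v'\<close>.\<close>
  then show False using sep[OF m] btw[of "Min U"] V(2)[OF v(1)] V(2)[OF v(2)] by force
qed

text \<open>Suppose the block \<open>U\<close> of the extreme point \<open>j\<close> started after
  \<open>m\<close>. Then it is not interior, so \<open>V\<close> must be, and a block
  \<open>W\<close> enclosing \<open>V\<close> has a point below \<open>m\<close>, which precedes all
  of \<open>U\<close>. By extremality of \<open>j\<close>, its other end \<open>w'\<close> lies
  beyond \<open>j\<close>, and noncrossing puts all of \<open>U\<close> before \<open>w'\<close>. So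
  \<open>U\<close> is interior after all.\<close>

lemma last_block_neighbour:
  assumes nc: "noncrossing_family k P" and V: "V \<in> P" "m \<in> V"
    and sep: "\<And>y. y < m \<Longrightarrow> (\<forall>x\<ge>m. k y < k x) \<or> (\<forall>x\<ge>m. k x < k y)"
    and last: "\<And>U. interior_block k P U \<Longrightarrow> U \<noteq> V \<Longrightarrow> Min U < m"
    and inj: "inj k" and first: "\<And>x. m \<le> x \<Longrightarrow> k m \<le> k x"
    and alt: "interior_block k P V \<or> (\<forall>U\<in>P. U \<noteq> V \<longrightarrow> Min U < m)"
    and j: "j \<in> U" "U \<in> P" "m < j" "j \<notin> V" "\<And>x. x \<in> \<Union>P \<Longrightarrow> m < x \<Longrightarrow> x \<notin> V \<Longrightarrow> k j \<le> k x"
  shows "\<exists>i\<in>U. i < m"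
proof (rule ccontr)
  assume "\<not> (\<exists>i\<in>U. i < m)"
  then have ge: "m \<le> y" if "y \<in> U" for y using that by force
  note D = noncrossing_familyD[OF nc]
  have UV: "U \<noteq> V" using j by blast
  have "Min U \<in> U" using D(2,3)[OF j(2)] by simp
  then have "\<not> Min U < m" using ge by fastforce
  then have nint: "\<not> interior_block k P U" and "\<not> (\<forall>U\<in>P. U \<noteq> V \<longrightarrow> Min U < m)"
    using last UV j(2) by blast+
  then have "interior_block k P V" using alt by blast
  then obtain W w w' where W: "W \<in> P" "W \<noteq> V" "w \<in> W" "w' \<in> W" "k w < k m" "k m < k w'"
    using V(2) unfolding interior_block_def by blast
  have wm: "w < m" using first[of w] W(5) by (metis not_le)
  then have UW: "U \<noteq> W" using W(3) ge by fastforce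
  have wlt: "k w < k y" if "m \<le> y" for y using sep[OF wm] W(5) that by force
  have jw: "k j < k w'"
  proof (cases "w' < m")
    case True
    then show ?thesis using sep[OF True] W(6) j(3) by force
  next
    case False
    have "w' \<notin> V" using D(5)[OF W(1) V(1) W(4)] W(2) by blast
    moreover have "w' \<noteq> j" using D(5)[OF j(2) W(1) j(1)] W(4) UW by blast
    then have "k j \<noteq> k w'" using inj by (simp add: inj_eq)
    ultimately show ?thesis using j(5)[of w'] W False V(2) by fastforce
  qed
  have "k y < k w'" if y: "y \<in> U" for y
  proof (rule ccontr)
    assume a: "\<not> k y < k w'"
    have "w' \<noteq> y" using D(5)[OF j(2) W(1) y] W(4) UW by blast
    then have "k w' \<noteq> k y" using inj by (simp add: inj_eq)
    then have "k w' < k y" using a by simp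
    then show False
      using D(6)[OF W(1) j(2) W(3) j(1) W(4) y] wlt[of j] j(3) jw UW by simp
  qed
  then have "\<forall>x\<in>U. k w < k x \<and> k x < k w'" using wlt ge by simp
  then have "interior_block k P U"
    unfolding interior_block_def using j(2) W(1,3,4) UW by metis
  then show False using nint by simp
qed

lemma nth_list_update_fun: "i < length Z \<Longrightarrow> (!) (Z[i := x]) = ((!) Z)(i := x)"
  by (auto simp: nth_list_update)

section \<open>Admissible tuples and the removal of one block\<close>

context expectation_pair
begin

lemma admissible_adm: "admissible S \<chi> Z \<Longrightarrow> adm ((!) \<chi>) {..<length \<chi>} ((!) Z)"
  by (auto simp: admissible_def adm_def)

lemma admissible_update:
  "admissible S \<chi> Z \<Longrightarrow> i < length \<chi> \<Longrightarrow> z \<in> side_alg S (\<chi> ! i) \<Longrightarrow> admissible S \<chi> (Z[i := z])"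
  by (auto simp: admissible_def nth_list_update)

lemma admissible_nths:
  assumes "admissible S \<chi> Z" "V \<subseteq> {..<length \<chi>}" "V \<noteq> {}"
  shows "admissible S (nths \<chi> V) (nths Z V)"
proof -
  have fin: "finite V" using assms(2) by (rule finite_subset) simp
  have len: "length (nths \<chi> V) = card V" "length (nths Z V) = card V"
    using assms by (simp_all add: length_nths_subset admissible_def)
  have "nths Z V ! i \<in> side_alg S (nths \<chi> V ! i)" if i: "i < card V" for i
  proof -
    have "i \<in> rank V ` V" using rank_image[OF fin] i by simp
    then obtain j where "j \<in> V" "i = rank V j" by blast
    then show ?thesis using assms by (auto simp: nth_nths_rank admissible_def)
  qed
  moreover have "nths \<chi> V \<noteq> []" using len(1) assms(3) fin by auto
  ultimately show ?thesis by (simp add: admissible_def len)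
qed

text \<open>
  The recursions defining \<open>\<E>\<close> and \<open>\<F>\<close> leave the class of admissible tuples: they produce tuples that
  agree with an admissible tuple only in the following sense, where \<open>\<mu>\<close> bounds the minima
  of the blocks that are still to be removed.
\<close>

definition agree :: "nat \<Rightarrow> nat set set \<Rightarrow> 'a list \<Rightarrow> 'a list \<Rightarrow> bool" where
  "agree \<mu> P Z' Z \<longleftrightarrow> length Z' = length Z \<and> (\<forall>i<length Z. i < \<mu> \<longrightarrow> Z' ! i = Z ! i) \<and>
     (\<forall>U\<in>P. ordered_prod (U \<inter> {\<mu>..}) ((!) Z') \<approx> ordered_prod (U \<inter> {\<mu>..}) ((!) Z))"

text \<open>Lowering the threshold prepends variables that coincide in both tuples, and the
  equivalence is stable under left multiplication.\<close>

lemma agree_mono: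
  assumes "agree \<mu> P Z' Z" "\<nu> \<le> \<mu>" "\<Union>P \<subseteq> {..<length Z}"
  shows "agree \<nu> P Z' Z"
  unfolding agree_def
proof (intro conjI ballI allI impI)
  fix U assume U: "U \<in> P"
  have fin: "finite U" using assms(3) U by (meson Union_upper finite_lessThan finite_subset)
  have split: "ordered_prod (U \<inter> {\<nu>..}) Y = ordered_prod (U \<inter> {\<nu>..<\<mu>}) Y * ordered_prod (U \<inter> {\<mu>..}) Y"
    for Y :: "nat \<Rightarrow> 'a"
  proof -
    have e: "U \<inter> {\<nu>..} = (U \<inter> {\<nu>..<\<mu>}) \<union> (U \<inter> {\<mu>..})" using assms(2) by auto
    show ?thesis by (subst e, rule ordered_prod_Un) (use fin in auto)
  qed
  have "ordered_prod (U \<inter> {\<nu>..<\<mu>}) ((!) Z') = ordered_prod (U \<inter> {\<nu>..<\<mu>}) ((!) Z)"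
    using fin U assms(1,3) by (intro ordered_prod_cong) (auto simp: agree_def)
  then show "ordered_prod (U \<inter> {\<nu>..}) ((!) Z') \<approx> ordered_prod (U \<inter> {\<nu>..}) ((!) Z)"
    using assms(1) U by (auto simp: split agree_def intro!: equivalent_mult)
qed (use assms in \<open>auto simp: agree_def\<close>)

lemma agree_refl [simp]: "agree \<mu> P Z Z"
  by (simp add: agree_def)

lemma agree_expectation:
  assumes "agree \<mu> P Z' Z" "\<Union>P \<subseteq> {..<length Z}" "U \<in> P" "expectation h"
  shows "h (ordered_prod U ((!) Z')) = h (ordered_prod U ((!) Z))"
  using agree_mono[OF assms(1) le0 assms(2)] assms(3,4) by (auto simp: agree_def atLeast_0 intro: equivalentD)

text \<open>The relabelling is increasing, so tails of blocks go to tails of blocks, with the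
  threshold relabelled by the same rank.\<close>

lemma agree_restr:
  assumes \<pi>: "\<pi> \<in> BNC \<chi>" "union_of_blocks \<pi> C" and "length Z = length \<chi>"
    and "agree \<mu> {U \<in> \<pi>. U \<subseteq> C} Z' Z"
  shows "agree (rank C \<mu>) (restr \<pi> C) (nths Z' C) (nths Z C)"
proof -
  note aux = restr_union_of_blocks_facts[OF \<pi>]
  have len: "length Z' = length \<chi>" using assms by (simp add: agree_def)
  have C: "C \<subseteq> {..<length Z}" "C \<subseteq> {..<length Z'}" using aux(1) assms(3) len by auto
  have nth: "nths Z C ! rank C j = Z ! j" "nths Z' C ! rank C j = Z' ! j" if "j \<in> C" for j
    using C that by (auto intro: nth_nths_rank)
  show ?thesis unfolding agree_def
  proof (intro conjI allI ballI impI)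
    show "length (nths Z' C) = length (nths Z C)" using C by (simp add: length_nths_subset)
    fix i assume i: "i < length (nths Z C)" "i < rank C \<mu>"
    then have "i \<in> rank C ` C" using rank_image[OF aux(2)] C by (simp add: length_nths_subset)
    then obtain j where j: "j \<in> C" "i = rank C j" by blast
    then have "j < \<mu>" using i rank_less_iff[OF aux(2)] by simp
    then show "nths Z' C ! i = nths Z C ! i"
      using j nth C assms(4) by (auto simp: agree_def)
  next
    fix X assume "X \<in> restr \<pi> C"
    then obtain U where U: "U \<in> \<pi>" "U \<subseteq> C" "X = rank C ` U" unfolding aux(3) by blast
    have "rank C \<mu> \<le> rank C j \<longleftrightarrow> \<mu> \<le> j" if "j \<in> U" for j
      using rank_less_iff[OF aux(2), of j \<mu>] that U by (meson leD not_less subsetD)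
    then have X: "X \<inter> {rank C \<mu>..} = rank C ` (U \<inter> {\<mu>..})" unfolding U(3) by auto
    have fin: "finite (U \<inter> {\<mu>..})" using finite_subset[OF U(2) aux(2)] by simp
    have "ordered_prod (X \<inter> {rank C \<mu>..}) ((!) (nths Y C)) = ordered_prod (U \<inter> {\<mu>..}) ((!) Y)"
      if "\<And>j. j \<in> C \<Longrightarrow> nths Y C ! rank C j = Y ! j" for Y :: "'a list"
    proof -
      have "ordered_prod (rank C ` (U \<inter> {\<mu>..})) ((!) (nths Y C)) =
          ordered_prod (U \<inter> {\<mu>..}) (\<lambda>i. nths Y C ! rank C i)"
        using fin U(2) by (intro ordered_prod_image strict_mono_rank aux(2)) auto
      also have "\<dots> = ordered_prod (U \<inter> {\<mu>..}) ((!) Y)"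
        using that U(2) by (intro ordered_prod_cong fin) auto
      finally show ?thesis by (simp add: X)
    qed
    then show "ordered_prod (X \<inter> {rank C \<mu>..}) ((!) (nths Z' C)) \<approx> ordered_prod (X \<inter> {rank C \<mu>..}) ((!) (nths Z C))"
      using nth assms(4) U by (auto simp: agree_def)
  qed
qed


text \<open>The tuple of \<open>remove_block\<close> before its restriction, so that one removal can
  be studied with the original indices.\<close>

definition modified_tuple :: "side list \<Rightarrow> nat set set \<Rightarrow> 'a list \<Rightarrow> nat set \<Rightarrow> 'a list" where
  "modified_tuple \<chi> \<pi> Z V =
     (let m = Min V;
          T = side_op S (\<chi> ! m) (exp_E S (prod_list (nths Z V)));
          k = adjacent_index \<chi> \<pi> V
      in if V = {m..<length \<chi>} then Z[m - 1 := Z ! (m - 1) * T] else Z[k := T * Z ! k])"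

lemma remove_block_eq:
  "remove_block S \<chi> \<pi> Z V = nths (modified_tuple \<chi> \<pi> Z V) ({..<length \<chi>} - V)"
  by (simp add: remove_block_def modified_tuple_def Let_def)

text \<open>Covers one removal in either recursion; \<open>h\<close> tells which. \<open>V\<close>
  is an interval relative to the other blocks, so the closed form can absorb its value at a
  neighbouring point, which yields the admissible tuple \<open>Y\<close>. The recursion inserts
  elsewhere, but the tails from \<open>Min V - 1\<close> on cannot tell. The shift by one accounts
  for the insertion at the index before \<open>V\<close>.\<close>

lemma removal_step:
  assumes adm: "admissible S \<chi> Z" and \<pi>: "\<pi> \<in> BNC \<chi>" and V: "V \<in> \<pi>" "\<pi> \<noteq> {V}"
    and ag: "agree (Min V) \<pi> Z' Z"
    and last: "\<And>U. interior_block (side_key ((!) \<chi>)) \<pi> U \<Longrightarrow> U \<noteq> V \<Longrightarrow> Min U < Min V"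
    and h: "h = exp_E S \<and> (\<forall>U\<in>\<pi>. U \<noteq> V \<longrightarrow> Min U < Min V) \<or>
      h = exp_F S \<and> interior_block (side_key ((!) \<chi>)) \<pi> V"
  obtains (step) Y where "admissible S \<chi> Y"
    "nested S ((!) \<chi>) h \<pi> ((!) Z) = nested S ((!) \<chi>) h (\<pi> - {V}) ((!) Y)"
    "agree (Min V - 1) (\<pi> - {V}) (modified_tuple \<chi> \<pi> Z' V) Y"
proof -
  define n where "n = length \<chi>"
  define m where "m = Min V"
  let ?s = "(!) \<chi>" and ?k = "side_key ((!) \<chi>)" and ?Q = "\<pi> - {V}"
  note nc = BNC_noncrossing[OF \<pi>] and Un = BNC_Union[OF \<pi>, folded n_def]
  note D = noncrossing_familyD[OF nc]
  have lenZ: "length Z = n" "length Z' = n" using adm ag by (auto simp: admissible_def agree_def n_def)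
  have finV: "finite V" "V \<noteq> {}" using D V by blast+
  have mV: "m \<in> V" and mle: "\<And>x. x \<in> V \<Longrightarrow> m \<le> x" using finV by (auto simp: m_def)
  have Vn: "V \<subseteq> {..<n}" using V Un by blast
  have mn: "m < n" using mV Vn by auto
  have disj: "y \<notin> V" "y < n" if "y \<in> \<Union>?Q" for y using that D(5)[OF _ V(1)] Un by blast+
  have inQ: "y \<in> \<Union>?Q" if "y < n" "y \<notin> V" for y using that Un by blast
  have expectation_h: "expectation h" using h by (auto simp: expectation_def)
  have piQ: "\<pi> = ?Q \<union> {V}" using V by blast
  have UnV: "\<Union>{V} = V" by simp
  have ncQV: "noncrossing_family ?k (?Q \<union> {V})" using nc piQ by simp
  have admU: "adm ?s (\<Union>(?Q \<union> {V})) ((!) Z)"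
    using admissible_adm[OF adm] piQ Un by (simp add: n_def)
  have enc: "h = exp_E S \<or> enclosed ?s ?Q {V}"
    using h unfolding interior_block_def enclosed_def by blast
  define b where "b = exp_E S (ordered_prod V ((!) Z))"
  have bB: "b \<in> B" by (simp add: b_def)
  have nV: "nested S ?s (exp_E S) {V} ((!) Z) = b" using finV by (simp add: nested_single_block b_def)
  have "exp_E S (ordered_prod V ((!) Z')) = b"
    using agree_expectation[OF ag _ V(1) expectation_E] Un lenZ by (simp add: b_def)
  then have b: "exp_E S (prod_list (nths Z' V)) = b" using Vn lenZ by (simp add: prod_list_nths)
  define T where "T = side_op S (\<chi> ! m) b"
  have mod: "modified_tuple \<chi> \<pi> Z' V = (if V = {m..<n} then Z'[m - 1 := Z' ! (m - 1) * T]
      else Z'[adjacent_index \<chi> \<pi> V := T * Z' ! adjacent_index \<chi> \<pi> V])"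
    by (simp add: modified_tuple_def Let_def b T_def m_def[symmetric] n_def[symmetric])
  have sep: "(\<forall>x\<ge>m. ?k y < ?k x) \<or> (\<forall>x\<ge>m. ?k x < ?k y)" if "y < m" for y
  proof (cases "\<chi> ! y")
    case Lft
    then have "?k y < ?k x" if "x \<ge> m" for x
      using that \<open>y < m\<close> by (cases "\<chi> ! x") (auto simp: side_key_less_iff)
    then show ?thesis by blast
  next
    case Rgt
    then have "?k x < ?k y" if "x \<ge> m" for x
      using that \<open>y < m\<close> by (cases "\<chi> ! x") (auto simp: side_key_less_iff)
    then show ?thesis by blast
  qed
  have lastm: "interior_block ?k \<pi> U \<Longrightarrow> U \<noteq> V \<Longrightarrow> Min U < m" for U using last by (simp add: m_def)
  have interval: False if "j \<in> U" "U \<in> \<pi>" "U \<noteq> V" "v \<in> V" "v' \<in> V" "?k v < ?k j" "?k j < ?k v'" for j U v v'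
    using last_block_interval[OF nc V(1) mle sep lastm inj_side_key that(2,3,1,4-7)] .
  have kne: "?k x \<noteq> ?k y" if "x \<noteq> y" for x y using that inj_side_key[of ?s] by (simp add: inj_eq)
  have lenmod: "length (modified_tuple \<chi> \<pi> Z' V) = n" using lenZ by (simp add: mod)
  have finish: thesis
    if r: "r < n" and side: "z \<in> side_alg S (\<chi> ! r)"
      and nest: "nested S ?s h (?Q \<union> {V}) ((!) Z) = nested S ?s h ?Q (((!) Z)(r := z))"
      and agr: "agree (m - 1) ?Q (modified_tuple \<chi> \<pi> Z' V) (Z[r := z])" for r z
  proof (rule step)
    show "admissible S \<chi> (Z[r := z])" using adm r side by (intro admissible_update) (auto simp: n_def)
    show "nested S ?s h \<pi> ((!) Z) = nested S ?s h ?Q ((!) (Z[r := z]))"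
      using nest piQ r lenZ by (simp add: nth_list_update_fun)
    show "agree (Min V - 1) ?Q (modified_tuple \<chi> \<pi> Z' V) (Z[r := z])" using agr by (simp add: m_def)
  qed
  have agm: "Z' ! i = Z ! i" if "i < n" "i < m" for i
    using ag that lenZ by (auto simp: agree_def m_def)
  have sideZ: "Z ! r \<in> side_alg S (\<chi> ! r)" if "r < n" for r
    using adm that by (simp add: admissible_def n_def)
  have after_V: "nested S ?s h (?Q \<union> {V}) ((!) Z) =
      nested S ?s h ?Q (((!) Z)(r := put_after S (\<chi> ! r) b (Z ! r)))"
    if "r \<in> \<Union>?Q" "\<And>x. x \<in> V \<Longrightarrow> ?k r < ?k x"
      "\<And>x y. x \<in> V \<Longrightarrow> y \<in> \<Union>?Q \<Longrightarrow> ?k r < ?k y \<Longrightarrow> ?k x < ?k y" for r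
    using nested_insert_after[OF ncQV _ that(1) admU _ _ expectation_h enc, unfolded UnV nV] that(2,3) by simp
  have before_V: "nested S ?s h (?Q \<union> {V}) ((!) Z) =
      nested S ?s h ?Q (((!) Z)(r := put_before S (\<chi> ! r) b (Z ! r)))"
    if "r \<in> \<Union>?Q" "\<And>x. x \<in> V \<Longrightarrow> ?k x < ?k r"
      "\<And>x y. x \<in> V \<Longrightarrow> y \<in> \<Union>?Q \<Longrightarrow> ?k y < ?k r \<Longrightarrow> ?k y < ?k x" for r
    using nested_insert_before[OF ncQV _ that(1) admU _ _ expectation_h enc, unfolded UnV nV] that(2,3) by simp
  show thesis
  proof (cases "V = {m..<n}")
    case True
    define r where "r = m - 1"
    have modT: "modified_tuple \<chi> \<pi> Z' V = Z'[r := Z' ! r * T]"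
      using mod by (simp only: r_def if_P[OF True])
    obtain U0 where U0: "U0 \<in> \<pi>" "U0 \<noteq> V" using V by blast
    obtain y0 where "y0 \<in> U0" using D(3)[OF U0(1)] by blast
    then have y0: "y0 < n" "y0 \<notin> V" using disj[of y0] U0 by blast+
    \<comment> \<open>As \<open>V\<close> fills everything from \<open>m\<close> on, a point of
      another block must be below \<open>m\<close>. So \<open>m - 1\<close> is a genuine
      predecessor, not a truncated difference.\<close>
    then have m0: "m > 0" using True by auto
    then have r: "r < m" "r < n" "r \<notin> V" using mn True by (auto simp: r_def)
    have ym: "y \<le> r" if "y \<in> \<Union>?Q" for y using disj[OF that] True by (auto simp: r_def)
    have agr: "agree (m - 1) ?Q (modified_tuple \<chi> \<pi> Z' V) (Z[r := z])" if z: "Z ! r * T \<approx> z" for z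
      unfolding agree_def
    proof (intro conjI allI ballI impI)
      show "length (modified_tuple \<chi> \<pi> Z' V) = length (Z[r := z])" using lenZ lenmod by simp
      show "modified_tuple \<chi> \<pi> Z' V ! i = Z[r := z] ! i" if "i < length (Z[r := z])" "i < m - 1" for i
        using that agm lenZ by (auto simp: modT r_def)
      fix U assume U: "U \<in> ?Q"
      have Zr: "Z' ! r = Z ! r" using agm r by simp
      \<comment> \<open>The remaining blocks end at \<open>r\<close> at the latest, so of all their
        tails from \<open>m - 1\<close> on only the single variable at \<open>r\<close> is left to
        compare.\<close>
      have "y = r" if "y \<in> U" "r \<le> y" for y using ym[of y] U that by (intro antisym) blast+
      then have "U \<inter> {m - 1..} = (if r \<in> U then {r} else {})"
        unfolding r_def[symmetric] by auto
      then show "ordered_prod (U \<inter> {m - 1..}) ((!) (modified_tuple \<chi> \<pi> Z' V)) \<approx>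
          ordered_prod (U \<inter> {m - 1..}) ((!) (Z[r := z]))"
        using lenZ r z Zr by (simp add: modT)
    qed
    \<comment> \<open>\<open>T\<close> stands at the right end, so it may be read as
      \<open>L b\<close> or as \<open>R b\<close> whatever the side of \<open>m\<close>. The reading
      that fits the side of \<open>r\<close> keeps the tuple admissible.\<close>
    have T: "Z ! r * T \<approx> Z ! r * L b" "Z ! r * T \<approx> Z ! r * R b"
      using equivalent_L_R[OF bB] equivalent_sym[OF equivalent_L_R[OF bB]]
      by (cases "\<chi> ! m"; simp add: T_def side_op_def)+
    show thesis
    proof (cases "\<chi> ! r")
      case Lft
      show thesis
      proof (rule finish[OF r(2)])
        show "nested S ?s h (?Q \<union> {V}) ((!) Z) =
            nested S ?s h ?Q (((!) Z)(r := put_after S (\<chi> ! r) b (Z ! r)))"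
        proof (rule after_V)
          show "r \<in> \<Union>?Q" using r inQ by blast
          show xr: "?k r < ?k x" if "x \<in> V" for x
            using Lft mle[OF that] r by (cases "\<chi> ! x") (auto simp: side_key_less_iff)
          fix x y assume x: "x \<in> V" and y: "y \<in> \<Union>?Q" "?k r < ?k y"
          then have "y < m" "y \<le> r" using ym[OF y(1)] r by auto
          then show "?k x < ?k y" using y(2) Lft mle[OF x]
            by (cases "\<chi> ! x"; cases "\<chi> ! y") (auto simp: side_key_less_iff)
        qed
        show "put_after S (\<chi> ! r) b (Z ! r) \<in> side_alg S (\<chi> ! r)"
          using bB sideZ[OF r(2)] by (rule put_after_side_alg)
        show "agree (m - 1) ?Q (modified_tuple \<chi> \<pi> Z' V) (Z[r := put_after S (\<chi> ! r) b (Z ! r)])"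
          using T Lft by (intro agr) (simp add: put_after_def)
      qed
    next
      case Rgt
      show thesis
      proof (rule finish[OF r(2)])
        show "nested S ?s h (?Q \<union> {V}) ((!) Z) =
            nested S ?s h ?Q (((!) Z)(r := put_before S (\<chi> ! r) b (Z ! r)))"
        proof (rule before_V)
          show "r \<in> \<Union>?Q" using r inQ by blast
          show xr: "?k x < ?k r" if "x \<in> V" for x
            using Rgt mle[OF that] r by (cases "\<chi> ! x") (auto simp: side_key_less_iff)
          fix x y assume x: "x \<in> V" and y: "y \<in> \<Union>?Q" "?k y < ?k r"
          then have "y < m" "y \<le> r" using ym[OF y(1)] r by auto
          then show "?k y < ?k x" using y(2) Rgt mle[OF x]
            by (cases "\<chi> ! x"; cases "\<chi> ! y") (auto simp: side_key_less_iff)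
        qed
        show "put_before S (\<chi> ! r) b (Z ! r) \<in> side_alg S (\<chi> ! r)"
          using bB sideZ[OF r(2)] by (rule put_before_side_alg)
        show "agree (m - 1) ?Q (modified_tuple \<chi> \<pi> Z' V) (Z[r := put_before S (\<chi> ! r) b (Z ! r)])"
          using T Rgt by (intro agr) (simp add: put_before_def)
      qed
    qed
  next
    case False
    \<comment> \<open>The set in \<open>adjacent_index\<close> retains only points whose block
      reaches below \<open>m\<close>. Taking all later points outside \<open>V\<close> makes
      \<open>j\<close> extreme among all of them, as the insertion lemmas require;
      \<open>last_block_neighbour\<close> shows that the block of \<open>j\<close> reaches below
      \<open>m\<close> anyway.\<close>
    define D' where "D' = {m<..<n} - V"
    have D'iff: "x \<in> D' \<longleftrightarrow> x < n \<and> m < x \<and> x \<notin> V" for x by (auto simp: D'_def)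
    have D': "finite D'" "D' \<noteq> {}"
    proof -
      have "V \<subseteq> {m..<n}" using mle Vn by auto
      then obtain x where "x \<in> {m..<n}" "x \<notin> V" using False by blast
      then have "x \<in> D'" using mV by (cases "x = m") (auto simp: D'iff)
      then show "D' \<noteq> {}" by blast
    qed (simp add: D'_def)
    have D'n: "D' \<subseteq> {..<length \<chi>}" by (auto simp: D'iff n_def)
    have alt: "interior_block ?k \<pi> V \<or> (\<forall>U\<in>\<pi>. U \<noteq> V \<longrightarrow> Min U < m)"
      using h by (auto simp: m_def)
    define j where "j = (case \<chi> ! m of Lft \<Rightarrow> chi_min \<chi> D' | Rgt \<Rightarrow> chi_max \<chi> D')"
    have jD: "j \<in> D'" using chi_min(1)[OF D'n D'(2)] chi_max(1)[OF D'n D'(2)]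
      by (cases "\<chi> ! m") (auto simp: j_def)
    then have j: "j < n" "m < j" "j \<notin> V" by (simp_all add: D'iff)
    obtain W where W: "W \<in> \<pi>" "j \<in> W" using j(1) Un by blast
    have WV: "W \<noteq> V" using W j by blast
    have xD: "x \<in> D'" if "x \<in> \<Union>\<pi>" "m < x" "x \<notin> V" for x using that Un by (auto simp: D'iff)
    have ex: "\<exists>i\<in>W. i < m"
    proof (cases "\<chi> ! m")
      case Lft
      have "?k m \<le> ?k x" if "m \<le> x" for x
        using that Lft by (cases "m = x"; cases "\<chi> ! x") (auto simp: side_key_less_iff less_imp_le)
      then show ?thesis
        using chi_min(2)[OF D'n D'(2)] Lft xD j W
        by (intro last_block_neighbour[OF nc V(1) mV sep lastm inj_side_key _ alt W(2,1) j(2,3)])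
          (auto simp: j_def)
    next
      case Rgt
      \<comment> \<open>On the right side the extreme point is a maximum; negating the key makes it
        the minimum that \<open>last_block_neighbour\<close> speaks of.\<close>
      have f1: "- ?k m \<le> - ?k x" if "m \<le> x" for x
        using that Rgt by (cases "m = x"; cases "\<chi> ! x") (auto simp: side_key_less_iff less_imp_le)
      have f2: "noncrossing_family (\<lambda>x. - ?k x) \<pi>" 
        using D unfolding noncrossing_family_def by (auto; metis)
      have f3: "inj (\<lambda>x. - ?k x)" using inj_side_key[of ?s] by (auto simp: inj_def)
      have f4: "(\<forall>x\<ge>m. - ?k y < - ?k x) \<or> (\<forall>x\<ge>m. - ?k x < - ?k y)" if "y < m" for y
        using sep[OF that] by auto
      have f5: "- ?k j \<le> - ?k x" if "x \<in> \<Union>\<pi>" "m < x" "x \<notin> V" for x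
        using chi_max(2)[OF D'n D'(2) xD[OF that]] Rgt by (simp add: j_def)
      show ?thesis
        by (rule last_block_neighbour[where k = "\<lambda>x. - ?k x", OF f2 V(1) mV f4 _ f3 f1 _ W(2,1) j(2,3) f5])
          (use lastm alt in \<open>simp_all only: interior_block_uminus simp_thms\<close>)
    qed
    \<comment> \<open>A subset of \<open>D'\<close> that contains the extreme point \<open>j\<close>
      of \<open>D'\<close> has the same extreme point, so \<open>adjacent_index\<close> refers to
      the block \<open>W\<close> of \<open>j\<close>.\<close>
    let ?J = "{j \<in> {m<..<length \<chi>} - V. \<exists>U\<in>\<pi>. j \<in> U \<and> (\<exists>i\<in>U. i < m)}"
    have J: "j \<in> ?J" "?J \<subseteq> D'" using j W ex by (auto simp: D'_def n_def)
    have "(case \<chi> ! m of Lft \<Rightarrow> chi_min \<chi> ?J | Rgt \<Rightarrow> chi_max \<chi> ?J) = j"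
      using J D'n chi_min(2)[OF D'n D'(2)] chi_max(2)[OF D'n D'(2)]
      by (cases "\<chi> ! m") (auto simp: j_def intro!: chi_min_eqI chi_max_eqI)
    moreover have "(THE U. U \<in> \<pi> \<and> j \<in> U) = W"
      using W D(5) by (intro the_equality) auto
    ultimately have adj: "adjacent_index \<chi> \<pi> V = Min {i \<in> W. m < i}"
      unfolding adjacent_index_def Let_def m_def[symmetric] by simp
    \<comment> \<open>The recursion inserts at \<open>q\<close>, the closed form at
      \<open>j\<close>. These may differ, but up to equivalence both insertions multiply the tail of
      \<open>W\<close> by \<open>T\<close> from the left.\<close>
    define q where "q = Min {i \<in> W. m < i}"
    have finW: "finite W" using D(2)[OF W(1)] .
    have mW: "m \<notin> W" using D(5)[OF W(1) V(1) _ mV] WV by blast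
    have W': "W \<inter> {m..} = {i \<in> W. m < i}" using mW by (auto simp: le_less)
    have ne: "finite {i \<in> W. m < i}" "{i \<in> W. m < i} \<noteq> {}" using finW W j by auto
    have q: "q \<in> W" "m < q" "\<And>i. i \<in> W \<Longrightarrow> m < i \<Longrightarrow> q \<le> i"
      using Min_in[OF ne] Min_le[OF ne(1)] by (auto simp: q_def)
    have qn: "q < n" using q(1) W(1) Un by blast
    have modq: "modified_tuple \<chi> \<pi> Z' V = Z'[q := T * Z' ! q]" using False by (simp add: mod adj q_def)
    have WD: "i \<in> D'" if "i \<in> W \<inter> {m..}" for i
      using that W' D(5)[OF W(1) V(1), of i] WV Un W(1) by (auto simp: D'iff)
    have agr: "agree (m - 1) ?Q (modified_tuple \<chi> \<pi> Z' V) (Z[j := z])"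
      if z: "T * ordered_prod (W \<inter> {m..}) ((!) Z) \<approx> ordered_prod (W \<inter> {m..}) (((!) Z)(j := z))" for z
    proof (rule agree_mono)
      show "agree m ?Q (modified_tuple \<chi> \<pi> Z' V) (Z[j := z])" unfolding agree_def
      proof (intro conjI allI ballI impI)
        show "length (modified_tuple \<chi> \<pi> Z' V) = length (Z[j := z])" using lenZ lenmod by simp
        show "modified_tuple \<chi> \<pi> Z' V ! i = Z[j := z] ! i" if "i < length (Z[j := z])" "i < m" for i
          using that agm q j lenZ by (auto simp: modq)
        fix U assume U: "U \<in> ?Q"
        have agU: "ordered_prod (U \<inter> {m..}) ((!) Z') \<approx> ordered_prod (U \<inter> {m..}) ((!) Z)"
          using ag U by (auto simp: agree_def m_def)
        have upd: "(!) (modified_tuple \<chi> \<pi> Z' V) = ((!) Z')(q := T * Z' ! q)" "(!) (Z[j := z]) = ((!) Z)(j := z)"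
          using qn j lenZ by (simp_all add: modq nth_list_update_fun)
        have finU: "finite U" using D(2) U by blast
        show "ordered_prod (U \<inter> {m..}) ((!) (modified_tuple \<chi> \<pi> Z' V)) \<approx>
            ordered_prod (U \<inter> {m..}) ((!) (Z[j := z]))"
        proof (cases "U = W")
          case True
          \<comment> \<open>\<open>q\<close> is the first point of the tail, so \<open>T\<close> is
            in front already. No commutation is used, which matters because \<open>Z'\<close> need
            not be admissible.\<close>
          have "ordered_prod (W \<inter> {m..}) (((!) Z')(q := T * Z' ! q)) = T * ordered_prod (W \<inter> {m..}) ((!) Z')"
          proof (rule ordered_prod_slide_front)
            show "finite (W \<inter> {m..})" "q \<in> W \<inter> {m..}" using finW q by auto
            fix i assume "i \<in> W \<inter> {m..}" "i < q"
            then show "T * Z' ! i = Z' ! i * T" using q(3)[of i] W' by auto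
          qed
          also have "T * ordered_prod (W \<inter> {m..}) ((!) Z') \<approx> T * ordered_prod (W \<inter> {m..}) ((!) Z)"
            using agU True by (simp add: equivalent_mult)
          finally show ?thesis using z True unfolding upd by (blast intro: equivalent_trans)
        next
          case False
          then have "q \<notin> U" "j \<notin> U" using D(5)[OF _ W(1)] U q(1) W(2) by blast+
          then have "ordered_prod (U \<inter> {m..}) (((!) Z')(q := T * Z' ! q)) = ordered_prod (U \<inter> {m..}) ((!) Z')"
            "ordered_prod (U \<inter> {m..}) (((!) Z)(j := z)) = ordered_prod (U \<inter> {m..}) ((!) Z)"
            using finU by (auto intro!: ordered_prod_cong)
          then show ?thesis using agU by (simp only: upd)
        qed
      qed
      show "\<Union>?Q \<subseteq> {..<length (Z[j := z])}" using Un lenZ by auto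
    qed simp
    have jW: "finite (W \<inter> {m..})" "j \<in> W \<inter> {m..}" "adm ?s (W \<inter> {m..}) ((!) Z)"
      using finW W j admissible_adm[OF adm] Un by (auto simp: adm_def n_def[symmetric])
    show thesis
    proof (cases "\<chi> ! m")
      case Lft
      have jmin: "?k j \<le> ?k x" if "x \<in> D'" for x
        using chi_min(2)[OF D'n D'(2) that] Lft by (simp add: j_def)
      have mj: "?k m < ?k j"
        using Lft j(2) by (cases "\<chi> ! j") (auto simp: side_key_less_iff)
      show thesis
      proof (rule finish[OF j(1)])
        show "nested S ?s h (?Q \<union> {V}) ((!) Z) =
            nested S ?s h ?Q (((!) Z)(j := put_before S (\<chi> ! j) b (Z ! j)))"
        proof (rule before_V)
          show "j \<in> \<Union>?Q" using j inQ by blast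
          \<comment> \<open>The point \<open>m\<close> of \<open>V\<close> precedes
            \<open>j\<close>, so a point of \<open>V\<close> beyond \<open>j\<close> would leave
            \<open>j\<close> between two points of \<open>V\<close>.\<close>
          show xj: "?k x < ?k j" if x: "x \<in> V" for x
            using interval[OF W(2,1) WV mV x mj] kne[of j x] x j(3) by force
          fix x y assume x: "x \<in> V" and y: "y \<in> \<Union>?Q" "?k y < ?k j"
          have "y \<notin> D'" using jmin y(2) by force
          then have "y < m" using disj[OF y(1)] mV by (cases "y = m") (auto simp: D'iff)
          then show "?k y < ?k x" using sep[of y] mle[OF x] y(2) j(2) by (metis less_imp_le less_asym)
        qed
        show "put_before S (\<chi> ! j) b (Z ! j) \<in> side_alg S (\<chi> ! j)"
          using bB sideZ[OF j(1)] by (rule put_before_side_alg)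
        \<comment> \<open>The tail of \<open>W\<close> is contained in \<open>D'\<close>, so
          \<open>j\<close> is its least point and the inserted value can be brought to the front as
          \<open>L b\<close>, which is \<open>T\<close> here.\<close>
        have "ordered_prod (W \<inter> {m..}) (((!) Z)(j := put_before S (\<chi> ! j) b (Z ! j))) \<approx>
          L b * ordered_prod (W \<inter> {m..}) ((!) Z)"
          using jW bB WD jmin by (intro ordered_prod_put_before_min) (auto simp: not_less)
        from equivalent_sym[OF this]
        have "T * ordered_prod (W \<inter> {m..}) ((!) Z) \<approx>
          ordered_prod (W \<inter> {m..}) (((!) Z)(j := put_before S (\<chi> ! j) b (Z ! j)))"
          unfolding T_def side_op_def Lft side.case .
        then show "agree (m - 1) ?Q (modified_tuple \<chi> \<pi> Z' V) (Z[j := put_before S (\<chi> ! j) b (Z ! j)])"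
          by (rule agr)
      qed
    next
      case Rgt
      have jmax: "?k x \<le> ?k j" if "x \<in> D'" for x
        using chi_max(2)[OF D'n D'(2) that] Rgt by (simp add: j_def)
      have mj: "?k j < ?k m"
        using Rgt j(2) by (cases "\<chi> ! j") (auto simp: side_key_less_iff)
      show thesis
      proof (rule finish[OF j(1)])
        show "nested S ?s h (?Q \<union> {V}) ((!) Z) =
            nested S ?s h ?Q (((!) Z)(j := put_after S (\<chi> ! j) b (Z ! j)))"
        proof (rule after_V)
          show "j \<in> \<Union>?Q" using j inQ by blast
          show xj: "?k j < ?k x" if x: "x \<in> V" for x
            using interval[OF W(2,1) WV x mV _ mj] kne[of j x] x j(3) by force
          fix x y assume x: "x \<in> V" and y: "y \<in> \<Union>?Q" "?k j < ?k y"
          have "y \<notin> D'" using jmax y(2) by force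
          then have "y < m" using disj[OF y(1)] mV by (cases "y = m") (auto simp: D'iff)
          then show "?k x < ?k y" using sep[of y] mle[OF x] y(2) j(2) by (metis less_imp_le less_asym)
        qed
        show "put_after S (\<chi> ! j) b (Z ! j) \<in> side_alg S (\<chi> ! j)"
          using bB sideZ[OF j(1)] by (rule put_after_side_alg)
        have "ordered_prod (W \<inter> {m..}) (((!) Z)(j := put_after S (\<chi> ! j) b (Z ! j))) \<approx>
          R b * ordered_prod (W \<inter> {m..}) ((!) Z)"
          using jW bB WD jmax by (intro ordered_prod_put_after_max) (auto simp: not_less)
        from equivalent_sym[OF this]
        have "T * ordered_prod (W \<inter> {m..}) ((!) Z) \<approx>
          ordered_prod (W \<inter> {m..}) (((!) Z)(j := put_after S (\<chi> ! j) b (Z ! j)))"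
          unfolding T_def side_op_def Rgt side.case .
        then show "agree (m - 1) ?Q (modified_tuple \<chi> \<pi> Z' V) (Z[j := put_after S (\<chi> ! j) b (Z ! j)])"
          by (rule agr)
      qed
    qed
  qed
qed

end

section \<open>The recursions compute the nested expectations\<close>

lemma one_part_BNC: "\<chi> \<noteq> [] \<Longrightarrow> one_part \<chi> \<in> BNC \<chi>"
  by (cases \<chi>) (auto simp: BNC_iff one_part_def noncrossing_family_def disjoint_def)

lemma BNC_single_block:
  assumes "\<pi> \<in> BNC \<chi>" "\<pi> = {V}" shows "\<pi> = one_part \<chi>"
  using BNC_Union[OF assms(1)] assms(2) by (simp add: one_part_def)

lemma blocks_in_complement:
  assumes "\<pi> \<in> BNC \<chi>" "V \<in> \<pi>"
  shows "union_of_blocks \<pi> ({..<length \<chi>} - V)" "{U \<in> \<pi>. U \<subseteq> {..<length \<chi>} - V} = \<pi> - {V}"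
proof -
  note D = noncrossing_familyD[OF BNC_noncrossing[OF assms(1)]]
  have sub: "U \<subseteq> {..<length \<chi>} - V" if "U \<in> \<pi> - {V}" for U
    using that BNC_Union[OF assms(1)] D(5)[OF _ assms(2)] by blast
  have "{..<length \<chi>} - V = \<Union>(\<pi> - {V})" using sub BNC_Union[OF assms(1)] by blast
  then show "union_of_blocks \<pi> ({..<length \<chi>} - V)" unfolding union_of_blocks_def by blast
  have "V \<noteq> {}" using D(3) assms(2) by blast
  then show "{U \<in> \<pi>. U \<subseteq> {..<length \<chi>} - V} = \<pi> - {V}" using sub by blast
qed

text \<open>An enclosing block in the restriction comes from an enclosing block of \<pi>, so removal
  creates no interior blocks. This preserves the bound on their minima along the recursion for
  \<open>F_mom\<close>.\<close>

lemma interior_restr: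
  assumes \<pi>: "\<pi> \<in> BNC \<chi>" "union_of_blocks \<pi> C" and X: "interior (nths \<chi> C) (restr \<pi> C) X"
  obtains U where "U \<in> \<pi>" "U \<subseteq> C" "X = rank C ` U" "interior \<chi> \<pi> U"
proof -
  note aux = restr_union_of_blocks_facts[OF \<pi>]
  let ?k = "side_key ((!) \<chi>)" and ?k' = "side_key ((!) (nths \<chi> C))"
  have "interior_block ?k' (restr \<pi> C) X" using X interior_iff[OF restr_BNC[OF \<pi>]] by simp
  then obtain Y u v where XY: "X \<in> restr \<pi> C" "Y \<in> restr \<pi> C" "Y \<noteq> X" "u \<in> Y" "v \<in> Y"
    and lt: "\<forall>x\<in>X. ?k' u < ?k' x \<and> ?k' x < ?k' v" unfolding interior_block_def by blast
  obtain U where U: "U \<in> \<pi>" "U \<subseteq> C" "X = rank C ` U" using XY(1) unfolding aux(3) by blast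
  obtain W where W: "W \<in> \<pi>" "W \<subseteq> C" "Y = rank C ` W" using XY(2) unfolding aux(3) by blast
  obtain u0 v0 where uv: "u0 \<in> W" "u = rank C u0" "v0 \<in> W" "v = rank C v0" using XY W by blast
  have iff: "?k' (rank C i) < ?k' (rank C j) \<longleftrightarrow> ?k i < ?k j" if "i \<in> C" "j \<in> C" for i j
    by (rule side_key_relabel[of C])
      (use that aux(1,2) nth_nths_rank[OF aux(1)] in \<open>auto intro: strict_mono_rank\<close>)
  have "\<forall>x\<in>U. ?k u0 < ?k x \<and> ?k x < ?k v0"
  proof
    fix x assume x: "x \<in> U"
    then have "?k' u < ?k' (rank C x) \<and> ?k' (rank C x) < ?k' v" using lt U(3) by blast
    then show "?k u0 < ?k x \<and> ?k x < ?k v0" using iff uv x U(2) W(2) by (simp add: subset_iff)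
  qed
  moreover have "W \<noteq> U" using XY(3) U(3) W(3) by blast
  ultimately have "interior_block ?k \<pi> U"
    unfolding interior_block_def using U(1) W(1) uv(1,3) by metis
  then show thesis using that U interior_iff[OF \<pi>(1)] by simp
qed

text \<open>With no interior block the gaps of the first block are empty, so all other blocks come
  after it, and peeling off first blocks produces the list. Together with uniqueness this justifies
  the definite description.\<close>

lemma ordered_blocks:
  assumes \<pi>: "\<pi> \<in> BNC \<chi>" and no: "\<not> (\<exists>V. interior \<chi> \<pi> V)"
  shows "set (ordered_blocks \<chi> \<pi>) = \<pi>" "chi_ordered \<chi> (ordered_blocks \<chi> \<pi>)"
proof -
  let ?k = "side_key ((!) \<chi>)"
  let ?r = "\<lambda>V W. \<forall>i\<in>V. \<forall>j\<in>W. ?k i < ?k j"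
  note nc = BNC_noncrossing[OF \<pi>]
  have ex: "\<exists>Vs. distinct Vs \<and> set Vs = P \<and> sorted_wrt ?r Vs" if "P \<subseteq> \<pi>" for P
    using that
  proof (induction "card P" arbitrary: P rule: less_induct)
    case less
    have ncP: "noncrossing_family ?k P" using nc less.prems by (rule noncrossing_family_subset)
    show ?case
    proof (cases "P = {}")
      case False
      define U where "U = first_block ?k P"
      have U: "U \<in> P" using first_block(1)[OF ncP False] by (simp add: U_def)
      have Une: "U \<noteq> {}" using noncrossing_familyD(3)[OF ncP U] .
      have "W \<notin> under ?k P U i" if W: "W \<in> P" "i \<in> U" for W i
      proof
        assume u: "W \<in> under ?k P U i"
        then obtain v where v: "v \<in> U" "?k i < ?k v" by (auto simp: under_def)
        then have "\<forall>x\<in>W. ?k i < ?k x \<and> ?k x < ?k v" using u by (auto simp: under_def)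
        moreover have "W \<noteq> U" using in_under_imp[OF u] noncrossing_familyD(3)[OF ncP W(1)] by blast
        ultimately have "interior_block ?k \<pi> W"
          unfolding interior_block_def using W U v less.prems by (metis subsetD)
        then show False using no interior_iff[OF \<pi>] by blast
      qed
      then have "W \<in> after ?k P U" if "W \<in> P" "W \<noteq> U" for W
        using first_block_cases[OF ncP inj_side_key False U_def that(1)] that by blast
      then have P: "P = insert U (after ?k P U)" using U after_subset[of ?k P U] by blast
      have "card (after ?k P U) < card P" using ncP U by (rule card_under_after_less)
      then obtain Vs where Vs: "distinct Vs" "set Vs = after ?k P U" "sorted_wrt ?r Vs"
        using less.hyps[of "after ?k P U"] after_subset[of ?k P U] less.prems by blast
      have "U \<notin> after ?k P U" using in_after_imp Une by blast
      then have "distinct (U # Vs)" "set (U # Vs) = P" using Vs P by auto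
      moreover have "sorted_wrt ?r (U # Vs)" using Vs by (auto simp: after_def)
      ultimately show ?thesis by blast
    qed auto
  qed
  have chi: "chi_ordered \<chi> Vs \<longleftrightarrow> sorted_wrt ?r Vs" if "set Vs = \<pi>" for Vs
  proof -
    have "i < length \<chi>" if "V \<in> set Vs" "i \<in> V" for V i
      using that BNC_Union[OF \<pi>] \<open>set Vs = \<pi>\<close> by blast
    then show ?thesis unfolding chi_ordered_def
      by (auto simp: chi_less_iff elim!: sorted_wrt_mono_rel[rotated])
  qed
  obtain Vs where Vs: "distinct Vs" "set Vs = \<pi>" "sorted_wrt ?r Vs" using ex[of \<pi>] by blast
  have un: "Ws = Vs" if Ws: "distinct Ws" "set Ws = \<pi>" "sorted_wrt ?r Ws" for Ws
  proof -
    \<comment> \<open>Ordered blocks have strictly increasing least keys, and a strictly sorted list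
      is determined by its set.\<close>
    let ?f = "\<lambda>V. Min (?k ` V)"
    have less: "?f V < ?f W" if "V \<in> \<pi>" "W \<in> \<pi>" "?r V W" for V W
    proof -
      have "?f V \<in> ?k ` V" "?f W \<in> ?k ` W"
        using that noncrossing_familyD(2,3)[OF nc] by (intro Min_in; simp)+
      then show ?thesis using that(3) by auto
    qed
    have srt: "sorted_wrt (<) (map ?f Xs)" if "set Xs = \<pi>" "sorted_wrt ?r Xs" for Xs
      unfolding sorted_wrt_map
      by (rule sorted_wrt_mono_rel[OF _ that(2)]) (use that(1) less in auto)
    have "map ?f Ws = map ?f Vs"
      by (rule strict_sorted_equal) (use srt Ws Vs in auto)
    moreover have "inj_on ?f \<pi>"
      using srt[OF Vs(2,3)] Vs(2) by (simp add: strict_sorted_iff distinct_map)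
    ultimately show ?thesis using Ws(2) Vs(2) map_inj_on[of ?f Ws Vs] by simp
  qed
  have "ordered_blocks \<chi> \<pi> = Vs"
    unfolding ordered_blocks_def
  proof (rule the_equality)
    show "distinct Vs \<and> set Vs = \<pi> \<and> chi_ordered \<chi> Vs" using Vs chi by simp
    show "Ws = Vs" if "distinct Ws \<and> set Ws = \<pi> \<and> chi_ordered \<chi> Ws" for Ws
      using that un[of Ws] chi[of Ws] by blast
  qed
  then show "set (ordered_blocks \<chi> \<pi>) = \<pi>" "chi_ordered \<chi> (ordered_blocks \<chi> \<pi>)"
    using Vs chi by simp_all
qed

context expectation_pair
begin

text \<open>\<open>removal_step\<close> with the complement relabelled. The last clause keeps the
  induction going: blocks whose minima lay below that of \<open>V\<close> have minima at most the
  new threshold.\<close>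

lemma removal_step_restr:
  assumes adm: "admissible S \<chi> Z" and \<pi>: "\<pi> \<in> BNC \<chi>" and V: "V \<in> \<pi>" "\<pi> \<noteq> one_part \<chi>"
    and ag: "agree \<mu> \<pi> Z' Z" "Min V \<le> \<mu>"
    and last: "\<And>U. interior \<chi> \<pi> U \<Longrightarrow> U \<noteq> V \<Longrightarrow> Min U < Min V"
    and h: "h = exp_E S \<and> (\<forall>U\<in>\<pi>. U \<noteq> V \<longrightarrow> Min U < Min V) \<or> h = exp_F S \<and> interior \<chi> \<pi> V"
    and C: "C = {..<length \<chi>} - V"
  obtains Y where "admissible S (nths \<chi> C) Y" "restr \<pi> C \<in> BNC (nths \<chi> C)"
    "nested S ((!) \<chi>) h \<pi> ((!) Z) = nested S ((!) (nths \<chi> C)) h (restr \<pi> C) ((!) Y)"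
    "agree (rank C (Min V - 1)) (restr \<pi> C) (remove_block S \<chi> \<pi> Z' V) Y"
    "\<forall>U\<in>\<pi>. U \<subseteq> C \<longrightarrow> Min U < Min V \<longrightarrow> Min (rank C ` U) \<le> rank C (Min V - 1)"
proof -
  note D = noncrossing_familyD[OF BNC_noncrossing[OF \<pi>]]
  have ne: "\<pi> \<noteq> {V}" using BNC_single_block[OF \<pi>] V(2) by blast
  have len: "length Z = length \<chi>" using adm by (simp add: admissible_def)
  have ag': "agree (Min V) \<pi> Z' Z" using ag by (rule agree_mono) (use BNC_Union[OF \<pi>] len in simp)
  obtain Y where Y: "admissible S \<chi> Y"
    "nested S ((!) \<chi>) h \<pi> ((!) Z) = nested S ((!) \<chi>) h (\<pi> - {V}) ((!) Y)"
    "agree (Min V - 1) (\<pi> - {V}) (modified_tuple \<chi> \<pi> Z' V) Y"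
    using removal_step[OF adm \<pi> V(1) ne ag'] last h unfolding interior_iff[OF \<pi>] by metis
  have lenY: "length Y = length \<chi>" using Y(1) by (simp add: admissible_def)
  note bc = blocks_in_complement[OF \<pi> V(1), folded C]
  note aux = restr_union_of_blocks_facts[OF \<pi> bc(1)]
  obtain U where U: "U \<in> \<pi> - {V}" using ne V(1) by blast
  then have "U \<subseteq> C" "U \<noteq> {}" using bc(2) D(3) by blast+
  then have "C \<noteq> {}" by blast
  show thesis
  proof (rule that[of "nths Y C"])
    show "admissible S (nths \<chi> C) (nths Y C)" using Y(1) aux(1) \<open>C \<noteq> {}\<close> by (rule admissible_nths)
    show "restr \<pi> C \<in> BNC (nths \<chi> C)" using \<pi> bc(1) by (rule restr_BNC)
    show "nested S ((!) \<chi>) h \<pi> ((!) Z) = nested S ((!) (nths \<chi> C)) h (restr \<pi> C) ((!) (nths Y C))"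
      using Y(2) nested_restr[OF \<pi> bc(1) lenY, of S h] bc(2) by simp
    show "agree (rank C (Min V - 1)) (restr \<pi> C) (remove_block S \<chi> \<pi> Z' V) (nths Y C)"
      unfolding remove_block_eq C[symmetric] using Y(3) bc(2)
      by (intro agree_restr[OF \<pi> bc(1) lenY]) simp
    show "\<forall>U\<in>\<pi>. U \<subseteq> C \<longrightarrow> Min U < Min V \<longrightarrow> Min (rank C ` U) \<le> rank C (Min V - 1)"
    proof (intro ballI impI)
      fix U assume U: "U \<in> \<pi>" "U \<subseteq> C" "Min U < Min V"
      have "Min (rank C ` U) \<le> rank C (Min U)" using D(2,3)[OF U(1)] by (intro Min_le) auto
      also have "\<dots> \<le> rank C (Min V - 1)" using aux(2) U(3) by (intro rank_mono) auto
      finally show "Min (rank C ` U) \<le> rank C (Min V - 1)" .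
    qed
  qed
qed

lemma Min_distinct_blocks:
  assumes "\<pi> \<in> BNC \<chi>" "U \<in> \<pi>" "V \<in> \<pi>" "U \<noteq> V" "Min U \<le> Min V"
  shows "Min U < Min V"
proof -
  note D = noncrossing_familyD[OF BNC_noncrossing[OF assms(1)]]
  have "Min U \<in> U" "Min V \<in> V" using D(2,3) assms(2,3) by simp_all
  then have "Min U \<noteq> Min V" using D(5)[OF assms(2,3)] assms(4) by metis
  then show ?thesis using assms(5) by simp
qed

lemma one_part_nested:
  assumes "admissible S \<chi> Z" "agree \<mu> (one_part \<chi>) Z' Z" "expectation h"
  shows "h (prod_list Z') = nested S ((!) \<chi>) h (one_part \<chi>) ((!) Z)"
proof -
  have len: "length Z = length \<chi>" "length Z' = length \<chi>" and ne: "\<chi> \<noteq> []"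
    using assms by (auto simp: admissible_def agree_def)
  have "h (ordered_prod {..<length \<chi>} ((!) Z')) = h (ordered_prod {..<length \<chi>} ((!) Z))"
    using assms(2) _ _ assms(3) by (rule agree_expectation) (auto simp: one_part_def len)
  moreover have "{..<length \<chi>} \<noteq> {}" using ne by (cases \<chi>) auto
  ultimately show ?thesis using len
    by (simp add: prod_list_eq_ordered_prod one_part_def nested_single_block)
qed

text \<open>The induction needs two tuples: the recursion runs on \<open>Z'\<close>, the closed form
  on an admissible \<open>Z\<close>. The bound on the minima allows the threshold to be lowered to
  the minimum of the block removed next.\<close>

lemma E_mom_eq_nested_agree:
  assumes "admissible S \<chi> Z" "\<pi> \<in> BNC \<chi>" "agree \<mu> \<pi> Z' Z" "\<And>U. U \<in> \<pi> \<Longrightarrow> Min U \<le> \<mu>"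
  shows "E_mom S \<chi> \<pi> Z' = nested S ((!) \<chi>) (exp_E S) \<pi> ((!) Z)"
  using assms
proof (induction "length \<chi>" arbitrary: \<chi> \<pi> Z Z' \<mu> rule: less_induct)
  case less
  note adm = less.prems(1) and \<pi> = less.prems(2) and ag = less.prems(3)
  have len: "\<chi> \<noteq> []" "length Z' = length \<chi>" using adm ag by (auto simp: admissible_def agree_def)
  show ?case
  proof (cases "\<pi> = one_part \<chi>")
    case True
    then have "E_mom S \<chi> \<pi> Z' = exp_E S (prod_list Z')"
      using len \<pi> by (subst E_mom.simps) simp
    then show ?thesis using one_part_nested[OF adm] ag True by simp
  next
    case False
    define V where "V = last_block \<pi>"
    define C where "C = {..<length \<chi>} - V"
    have V: "V \<in> \<pi>" "\<And>U. U \<in> \<pi> \<Longrightarrow> Min U \<le> Min V"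
      using last_block[OF finite_BNC[OF \<pi>] BNC_nonempty[OF \<pi> len(1)]] by (auto simp: V_def)
    have lt: "Min U < Min V" if "U \<in> \<pi>" "U \<noteq> V" for U
      using Min_distinct_blocks[OF \<pi> that(1) V(1) that(2) V(2)[OF that(1)]] .
    have lt': "Min U < Min V" if "interior \<chi> \<pi> U" "U \<noteq> V" for U
      using that lt by (simp add: interior_def)
    have hE: "exp_E S = exp_E S \<and> (\<forall>U\<in>\<pi>. U \<noteq> V \<longrightarrow> Min U < Min V) \<or>
      exp_E S = exp_F S \<and> interior \<chi> \<pi> V"
      using lt by auto
    obtain Y where Y: "admissible S (nths \<chi> C) Y" "restr \<pi> C \<in> BNC (nths \<chi> C)"
      "nested S ((!) \<chi>) (exp_E S) \<pi> ((!) Z) = nested S ((!) (nths \<chi> C)) (exp_E S) (restr \<pi> C) ((!) Y)"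
      "agree (rank C (Min V - 1)) (restr \<pi> C) (remove_block S \<chi> \<pi> Z' V) Y"
      "\<forall>U\<in>\<pi>. U \<subseteq> C \<longrightarrow> Min U < Min V \<longrightarrow> Min (rank C ` U) \<le> rank C (Min V - 1)"
      by (rule removal_step_restr[OF adm \<pi> V(1) False ag less.prems(4)[OF V(1)] lt' hE C_def])
    have "E_mom S \<chi> \<pi> Z' = E_mom S (nths \<chi> C) (restr \<pi> C) (remove_block S \<chi> \<pi> Z' V)"
      using len \<pi> False by (subst E_mom.simps) (simp add: Let_def V_def C_def)
    also have "\<dots> = nested S ((!) (nths \<chi> C)) (exp_E S) (restr \<pi> C) ((!) Y)"
    proof (rule less.hyps[OF _ Y(1,2,4)])
      show "length (nths \<chi> C) < length \<chi>"
        unfolding C_def using len(1) \<pi> V(1) by (rule length_nths_compl_less)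
      note bc = blocks_in_complement[OF \<pi> V(1), folded C_def]
      fix X assume "X \<in> restr \<pi> C"
      then obtain U where U: "U \<in> \<pi>" "U \<subseteq> C" "X = rank C ` U"
        unfolding restr_union_of_blocks_facts(3)[OF \<pi> bc(1)] by blast
      then have "U \<noteq> V" using bc(2) by blast
      then show "Min X \<le> rank C (Min V - 1)" using Y(5)[rule_format, OF U(1,2) lt[OF U(1)]] U(3) by simp
    qed
    finally show ?thesis using Y(3) by simp
  qed
qed

text \<open>Only interior blocks are removed, so only their minima are bounded. When none is left,
  \<open>nested\<close> splits into a product over the blocks, and agreement of the tuples gives
  equality of the expectations block by block.\<close>

lemma F_mom_eq_nested_agree:
  assumes "admissible S \<chi> Z" "\<pi> \<in> BNC \<chi>" "agree \<mu> \<pi> Z' Z" "\<And>U. interior \<chi> \<pi> U \<Longrightarrow> Min U \<le> \<mu>"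
  shows "F_mom S \<chi> \<pi> Z' = nested S ((!) \<chi>) (exp_F S) \<pi> ((!) Z)"
  using assms
proof (induction "length \<chi>" arbitrary: \<chi> \<pi> Z Z' \<mu> rule: less_induct)
  case less
  note adm = less.prems(1) and \<pi> = less.prems(2) and ag = less.prems(3)
  note nc = BNC_noncrossing[OF \<pi>]
  have len: "\<chi> \<noteq> []" "length Z' = length \<chi>" "length Z = length \<chi>"
    using adm ag by (auto simp: admissible_def agree_def)
  show ?case
  proof (cases "\<pi> = one_part \<chi>")
    case True
    then have "F_mom S \<chi> \<pi> Z' = exp_F S (prod_list Z')"
      using len \<pi> by (subst F_mom.simps) simp
    then show ?thesis using one_part_nested[OF adm] ag True by simp
  next
    case nop: False
    show ?thesis
    proof (cases "\<exists>V. interior \<chi> \<pi> V")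
      case False
      let ?Vs = "ordered_blocks \<chi> \<pi>"
      note ob = ordered_blocks[OF \<pi> False]
      have sub: "V \<subseteq> {..<length \<chi>}" if "V \<in> \<pi>" for V using that BNC_Union[OF \<pi>] by blast
      have "nested S ((!) \<chi>) (exp_F S) \<pi> ((!) Z) =
          prod_list (map (\<lambda>V. nested S ((!) \<chi>) (exp_F S) {U \<in> \<pi>. U \<subseteq> V} ((!) Z)) ?Vs)"
      proof (rule nested_concat[OF nc])
        show "\<exists>V\<in>set ?Vs. U \<subseteq> V" if "U \<in> \<pi>" for U using that ob(1) by blast
        show "sorted_wrt (\<lambda>V W. \<forall>i\<in>V. \<forall>j\<in>W. side_key ((!) \<chi>) i < side_key ((!) \<chi>) j) ?Vs"
          using ob(2) unfolding chi_ordered_def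
          by (rule sorted_wrt_mono_rel[rotated]) (auto simp: chi_less_iff)
      qed
      also have "\<dots> = prod_list (map (\<lambda>V. exp_F S (prod_list (nths Z' V))) ?Vs)"
      proof (intro arg_cong[of _ _ prod_list] map_cong refl)
        fix V assume "V \<in> set ?Vs"
        then have V: "V \<in> \<pi>" using ob(1) by simp
        have "U = V" if "U \<in> \<pi>" "U \<subseteq> V" for U
          using noncrossing_familyD(3,5)[OF nc] that V by (metis all_not_in_conv subsetD)
        then have "{U \<in> \<pi>. U \<subseteq> V} = {V}" using V by blast
        then have "nested S ((!) \<chi>) (exp_F S) {U \<in> \<pi>. U \<subseteq> V} ((!) Z) = exp_F S (ordered_prod V ((!) Z))"
          using noncrossing_familyD(2,3)[OF nc V] by (simp add: nested_single_block)
        also have "\<dots> = exp_F S (ordered_prod V ((!) Z'))"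
          using BNC_Union[OF \<pi>] len by (intro agree_expectation[OF ag _ V, symmetric]) auto
        finally show "nested S ((!) \<chi>) (exp_F S) {U \<in> \<pi>. U \<subseteq> V} ((!) Z) = exp_F S (prod_list (nths Z' V))"
          using sub[OF V] len by (simp add: prod_list_nths)
      qed
      finally show ?thesis using len \<pi> nop False by (subst F_mom.simps) simp
    next
      case True
      define V where "V = last_block {V. interior \<chi> \<pi> V}"
      define C where "C = {..<length \<chi>} - V"
      have fin: "finite {V. interior \<chi> \<pi> V}"
        by (rule finite_subset[OF _ finite_BNC[OF \<pi>]]) (auto simp: interior_def)
      have Vint: "interior \<chi> \<pi> V" and Vmax: "\<And>U. interior \<chi> \<pi> U \<Longrightarrow> Min U \<le> Min V"
        using last_block[OF fin] True by (auto simp: V_def)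
      have V: "V \<in> \<pi>" using Vint by (simp add: interior_def)
      have lt: "Min U < Min V" if "interior \<chi> \<pi> U" "U \<noteq> V" for U
        using Min_distinct_blocks[OF \<pi> _ V that(2) Vmax[OF that(1)]] that(1) by (simp add: interior_def)
      have hF: "exp_F S = exp_E S \<and> (\<forall>U\<in>\<pi>. U \<noteq> V \<longrightarrow> Min U < Min V) \<or>
        exp_F S = exp_F S \<and> interior \<chi> \<pi> V"
        using Vint by simp
      obtain Y where Y: "admissible S (nths \<chi> C) Y" "restr \<pi> C \<in> BNC (nths \<chi> C)"
        "nested S ((!) \<chi>) (exp_F S) \<pi> ((!) Z) = nested S ((!) (nths \<chi> C)) (exp_F S) (restr \<pi> C) ((!) Y)"
        "agree (rank C (Min V - 1)) (restr \<pi> C) (remove_block S \<chi> \<pi> Z' V) Y"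
        "\<forall>U\<in>\<pi>. U \<subseteq> C \<longrightarrow> Min U < Min V \<longrightarrow> Min (rank C ` U) \<le> rank C (Min V - 1)"
        by (rule removal_step_restr[OF adm \<pi> V nop ag less.prems(4)[OF Vint] lt hF C_def])
      have "F_mom S \<chi> \<pi> Z' = F_mom S (nths \<chi> C) (restr \<pi> C) (remove_block S \<chi> \<pi> Z' V)"
        using len \<pi> nop True by (subst F_mom.simps) (simp add: Let_def V_def C_def)
      also have "\<dots> = nested S ((!) (nths \<chi> C)) (exp_F S) (restr \<pi> C) ((!) Y)"
      proof (rule less.hyps[OF _ Y(1,2,4)])
        show "length (nths \<chi> C) < length \<chi>"
          unfolding C_def using len(1) \<pi> V by (rule length_nths_compl_less)
        note bc = blocks_in_complement[OF \<pi> V, folded C_def]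
        fix X assume "interior (nths \<chi> C) (restr \<pi> C) X"
        then obtain U where U: "U \<in> \<pi>" "U \<subseteq> C" "X = rank C ` U" "interior \<chi> \<pi> U"
          by (rule interior_restr[OF \<pi> bc(1)])
        then have "U \<noteq> V" using bc(2) by blast
        then show "Min X \<le> rank C (Min V - 1)" using Y(5)[rule_format, OF U(1,2) lt[OF U(4)]] U(3) by simp
      qed
      finally show ?thesis using Y(3) by simp
    qed
  qed
qed

lemma moments_eq_nested:
  assumes "admissible S \<chi> Z" "\<pi> \<in> BNC \<chi>"
  shows "E_mom S \<chi> \<pi> Z = nested S ((!) \<chi>) (exp_E S) \<pi> ((!) Z)"
    "F_mom S \<chi> \<pi> Z = nested S ((!) \<chi>) (exp_F S) \<pi> ((!) Z)"
proof -
  note D = noncrossing_familyD[OF BNC_noncrossing[OF assms(2)]]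
  have "Min U \<le> length \<chi>" if "U \<in> \<pi>" for U
  proof -
    have "Min U \<in> U" using D(2,3)[OF that] by simp
    then have "Min U \<in> {..<length \<chi>}" using that BNC_Union[OF assms(2)] by blast
    then show ?thesis by simp
  qed
  then show "E_mom S \<chi> \<pi> Z = nested S ((!) \<chi>) (exp_E S) \<pi> ((!) Z)"
    "F_mom S \<chi> \<pi> Z = nested S ((!) \<chi>) (exp_F S) \<pi> ((!) Z)"
    \<comment> \<open>A tuple agrees with itself at every threshold, and
      \<open>length \<chi>\<close> is above all minima.\<close>
    using E_mom_eq_nested_agree[OF assms agree_refl, of "length \<chi>"]
      F_mom_eq_nested_agree[OF assms agree_refl, of "length \<chi>"] by (auto simp: interior_def)
qed

end


section \<open>Conditional bi-multiplicativity of the moment pair\<close>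

lemma block_subset_union_of_blocks:
  assumes "\<pi> \<in> BNC \<chi>" "union_of_blocks \<pi> V" "U \<in> \<pi>" "u \<in> U" "u \<in> V"
  shows "U \<subseteq> V"
proof -
  obtain P where P: "P \<subseteq> \<pi>" "V = \<Union>P" using assms(2) by (auto simp: union_of_blocks_def)
  then obtain W where W: "W \<in> P" "u \<in> W" using assms(5) by blast
  then have "U = W"
    using noncrossing_familyD(5)[OF BNC_noncrossing[OF assms(1)] assms(3) _ assms(4)] P(1) by blast
  then show ?thesis using W(1) P(2) by blast
qed

context expectation_pair
begin

text \<open>Allows each condition to be proved once for both moment functions, with \<open>h\<close>
  as the parameter in which their closed forms differ.\<close>

definition represents :: "('a \<Rightarrow> 'd) \<Rightarrow> ('a, 'd) moment_fun \<Rightarrow> bool" where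
  "represents h \<Theta> \<longleftrightarrow> expectation h \<and>
     (\<forall>\<chi> \<pi> Z. admissible S \<chi> Z \<and> \<pi> \<in> BNC \<chi> \<longrightarrow> \<Theta> \<chi> \<pi> Z = nested S ((!) \<chi>) h \<pi> ((!) Z))"

lemma represents_moments: "represents (exp_E S) (E_mom S)" "represents (exp_F S) (F_mom S)"
  by (simp_all add: represents_def moments_eq_nested)

lemma representsD:
  assumes "represents h \<Theta>"
  shows "expectation h" "admissible S \<chi> Z \<Longrightarrow> \<pi> \<in> BNC \<chi> \<Longrightarrow> \<Theta> \<chi> \<pi> Z = nested S ((!) \<chi>) h \<pi> ((!) Z)"
  using assms by (auto simp: represents_def)

lemma represents_restr:
  assumes "represents h \<Theta>" "admissible S \<chi> Z" "\<pi> \<in> BNC \<chi>" "union_of_blocks \<pi> V" "V \<noteq> {}"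
  shows "\<Theta> (nths \<chi> V) (restr \<pi> V) (nths Z V) = nested S ((!) \<chi>) h {U \<in> \<pi>. U \<subseteq> V} ((!) Z)"
proof -
  have "admissible S (nths \<chi> V) (nths Z V)"
    using assms(2) restr_union_of_blocks_facts(1)[OF assms(3,4)] assms(5) by (rule admissible_nths)
  then have "\<Theta> (nths \<chi> V) (restr \<pi> V) (nths Z V) =
      nested S ((!) (nths \<chi> V)) h (restr \<pi> V) ((!) (nths Z V))"
    using representsD(2)[OF assms(1)] restr_BNC[OF assms(3,4)] by simp
  also have "\<dots> = nested S ((!) \<chi>) h {U \<in> \<pi>. U \<subseteq> V} ((!) Z)"
    using assms(2) by (intro nested_restr[OF assms(3,4)]) (simp add: admissible_def)
  finally show ?thesis .
qed

lemma represents_one_part: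
  assumes "represents h \<Theta>" "admissible S \<chi> Z" "p < length \<chi>" "z \<in> side_alg S (\<chi> ! p)"
  shows "\<Theta> \<chi> (one_part \<chi>) (Z[p := z]) = h (ordered_prod {..<length \<chi>} (((!) Z)(p := z)))"
    "\<Theta> \<chi> (one_part \<chi>) Z = h (ordered_prod {..<length \<chi>} ((!) Z))"
proof -
  have len: "length Z = length \<chi>" "\<chi> \<noteq> []" "{..<length \<chi>} \<noteq> {}"
    using assms(2,3) by (auto simp: admissible_def)
  have *: "\<Theta> \<chi> (one_part \<chi>) Y = h (ordered_prod {..<length \<chi>} ((!) Y))" if "admissible S \<chi> Y" for Y
  proof -
    have "\<Theta> \<chi> (one_part \<chi>) Y = nested S ((!) \<chi>) h (one_part \<chi>) ((!) Y)"
      using representsD(2)[OF assms(1) that one_part_BNC[OF len(2)]] .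
    also have "\<dots> = h (ordered_prod {..<length \<chi>} ((!) Y))"
      unfolding one_part_def using len(3) by (intro nested_single_block) auto
    finally show ?thesis .
  qed
  show "\<Theta> \<chi> (one_part \<chi>) Z = h (ordered_prod {..<length \<chi>} ((!) Z))" using * assms(2) .
  show "\<Theta> \<chi> (one_part \<chi>) (Z[p := z]) = h (ordered_prod {..<length \<chi>} (((!) Z)(p := z)))"
    using *[OF admissible_update[OF assms(2-4)]] assms(3) len(1) by (simp add: nth_list_update_fun)
qed

text \<open>The common content of conditions (1) and (2) when \<open>q\<close> exists: in both, the
  two positions are neighbours for \<open>\<prec>\<^sub>\<chi>\<close>. The next two lemmas serve
  the case in which no neighbour exists.\<close>

lemma represents_put_adjacent:
  assumes "represents h \<Theta>" "admissible S \<chi> Z" "b \<in> B" "p < length \<chi>" "q < length \<chi>"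
    "side_key ((!) \<chi>) p < side_key ((!) \<chi>) q"
    "\<And>i. i < length \<chi> \<Longrightarrow> side_key ((!) \<chi>) p < side_key ((!) \<chi>) i \<Longrightarrow> \<not> side_key ((!) \<chi>) i < side_key ((!) \<chi>) q"
  shows "\<Theta> \<chi> (one_part \<chi>) (Z[p := put_after S (\<chi> ! p) b (Z ! p)]) =
    \<Theta> \<chi> (one_part \<chi>) (Z[q := put_before S (\<chi> ! q) b (Z ! q)])"
proof -
  have side: "Z ! i \<in> side_alg S (\<chi> ! i)" if "i < length \<chi>" for i
    using assms(2) that by (simp add: admissible_def)
  show ?thesis
    unfolding represents_one_part(1)[OF assms(1,2,4) put_after_side_alg[OF assms(3) side[OF assms(4)]]]
      represents_one_part(1)[OF assms(1,2,5) put_before_side_alg[OF assms(3) side[OF assms(5)]]]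
    using assms admissible_adm[OF assms(2)] representsD(1)[OF assms(1)]
    by (intro equivalentD[OF ordered_prod_put_adjacent]) auto
qed

lemma represents_put_max:
  assumes "represents h \<Theta>" "admissible S \<chi> Z" "b \<in> B" "p < length \<chi>"
    "\<And>i. i < length \<chi> \<Longrightarrow> \<not> side_key ((!) \<chi>) p < side_key ((!) \<chi>) i"
  shows "\<Theta> \<chi> (one_part \<chi>) (Z[p := put_after S (\<chi> ! p) b (Z ! p)]) = \<Theta> \<chi> (one_part \<chi>) Z * b"
proof -
  have side: "Z ! p \<in> side_alg S (\<chi> ! p)" using assms(2,4) by (simp add: admissible_def)
  note h = representsD(1)[OF assms(1)]
  have "h (ordered_prod {..<length \<chi>} (((!) Z)(p := put_after S (\<chi> ! p) b (Z ! p)))) =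
      h (R b * ordered_prod {..<length \<chi>} ((!) Z))"
    using assms admissible_adm[OF assms(2)] h
    by (intro equivalentD[OF ordered_prod_put_after_max]) auto
  then show ?thesis
    using represents_one_part[OF assms(1,2,4) put_after_side_alg[OF assms(3) side]] h assms(3)
    by (simp add: expectation_bimodule)
qed

lemma represents_put_min:
  assumes "represents h \<Theta>" "admissible S \<chi> Z" "b \<in> B" "p < length \<chi>"
    "\<And>i. i < length \<chi> \<Longrightarrow> \<not> side_key ((!) \<chi>) i < side_key ((!) \<chi>) p"
  shows "\<Theta> \<chi> (one_part \<chi>) (Z[p := put_before S (\<chi> ! p) b (Z ! p)]) = b * \<Theta> \<chi> (one_part \<chi>) Z"
proof -
  have side: "Z ! p \<in> side_alg S (\<chi> ! p)" using assms(2,4) by (simp add: admissible_def)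
  note h = representsD(1)[OF assms(1)]
  have "h (ordered_prod {..<length \<chi>} (((!) Z)(p := put_before S (\<chi> ! p) b (Z ! p)))) =
      h (L b * ordered_prod {..<length \<chi>} ((!) Z))"
    using assms admissible_adm[OF assms(2)] h
    by (intro equivalentD[OF ordered_prod_put_before_min]) auto
  then show ?thesis
    using represents_one_part[OF assms(1,2,4) put_before_side_alg[OF assms(3) side]] h assms(3)
    by (simp add: expectation_bimodule)
qed

section \<open>Linearity and conditions (1) to (4)\<close>

lemma multilinear_represents:
  assumes "represents h \<Theta>" shows "multilinear S \<Theta>"
  unfolding multilinear_def
proof (intro allI impI, elim conjE)
  fix \<chi> \<pi> Z k X Y c
  assume adm: "admissible S \<chi> Z" and \<pi>: "\<pi> \<in> BNC \<chi>" and k: "k < length \<chi>"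
    and X: "X \<in> side_alg S (\<chi> ! k)" and Y: "Y \<in> side_alg S (\<chi> ! k)"
  interpret A: vector_space sA by (rule vector_space_A)
  interpret D: vector_space sD by (rule vector_space_D)
  have kZ: "k < length Z" using adm k by (simp add: admissible_def)
  have val: "\<Theta> \<chi> \<pi> (Z[k := z]) = nested S ((!) \<chi>) h \<pi> (((!) Z)(k := z))" if "z \<in> side_alg S (\<chi> ! k)" for z
    using representsD(2)[OF assms admissible_update[OF adm k that] \<pi>] kZ by (simp add: nth_list_update_fun)
  have lin: "\<Theta> \<chi> \<pi> (Z[k := sA u X + sA v Y]) = sD u (\<Theta> \<chi> \<pi> (Z[k := X])) + sD v (\<Theta> \<chi> \<pi> (Z[k := Y]))"
    for u v
  proof -
    have "k \<in> \<Union>\<pi>" using k BNC_Union[OF \<pi>] by simp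
    then show ?thesis
      using nested_linear[OF BNC_noncrossing[OF \<pi>] _ representsD(1)[OF assms]]
      by (simp add: val X Y side_alg_linear)
  qed
  show "\<Theta> \<chi> \<pi> (Z[k := X + Y]) = \<Theta> \<chi> \<pi> (Z[k := X]) + \<Theta> \<chi> \<pi> (Z[k := Y]) \<and>
    \<Theta> \<chi> \<pi> (Z[k := sA c X]) = sD c (\<Theta> \<chi> \<pi> (Z[k := X]))"
    \<comment> \<open>The coefficients 1, 1 give additivity and \<open>c\<close>, 0 give
      homogeneity.\<close>
    using lin[of 1 1] lin[of c 0] by simp
qed

text \<open>The last index is where its side meets the turn of \<open>\<prec>\<^sub>\<chi>\<close>.
  Its neighbour across the turn is the last index of the other side; if that side is empty, the last
  index is the maximum (left) or the minimum (right) of the order.\<close>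

lemma bimult_1_represents:
  assumes rep: "represents h \<Theta>" shows "bimult_1 S \<Theta>"
  unfolding bimult_1_def
proof (intro allI ballI impI)
  fix \<chi> Z b assume b: "b \<in> B" and adm: "admissible S \<chi> Z"
  let ?n = "length \<chi>" and ?k = "side_key ((!) \<chi>)"
  let ?Q = "{k. k < ?n \<and> \<chi> ! k \<noteq> \<chi> ! (?n - 1)}"
  have n: "?n - 1 < ?n" using adm by (simp add: admissible_def)
  have le: "i \<le> ?n - 1" if "i < ?n" for i using that by simp
  have fin: "finite ?Q" by simp
  define q where "q = Max ?Q"
  have Q: "q < ?n" "\<chi> ! q \<noteq> \<chi> ! (?n - 1)" if "?Q \<noteq> {}" using Max_in[OF fin that] by (auto simp: q_def)
  have Qle: "i \<le> q" if "i < ?n" "\<chi> ! i \<noteq> \<chi> ! (?n - 1)" for i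
    unfolding q_def using that by (intro Max_ge[OF fin]) simp
  have all: "\<chi> ! i = \<chi> ! (?n - 1)" if "?Q = {}" "i < ?n" for i using that by blast
  show "let n = length \<chi>; Q = {k. k < n \<and> \<chi> ! k \<noteq> \<chi> ! (n - 1)}; q = Max Q; \<theta> = \<Theta> \<chi> (one_part \<chi>)
    in case \<chi> ! (n - 1) of
      Lft \<Rightarrow> \<theta> (Z[n - 1 := Z ! (n - 1) * L b]) =
        (if Q \<noteq> {} then \<theta> (Z[q := Z ! q * R b]) else \<theta> Z * b)
    | Rgt \<Rightarrow> \<theta> (Z[n - 1 := Z ! (n - 1) * R b]) =
        (if Q \<noteq> {} then \<theta> (Z[q := Z ! q * L b]) else b * \<theta> Z)"
  proof (cases "\<chi> ! (?n - 1)")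
    case Lft
    have "\<Theta> \<chi> (one_part \<chi>) (Z[?n - 1 := put_after S (\<chi> ! (?n - 1)) b (Z ! (?n - 1))]) =
        \<Theta> \<chi> (one_part \<chi>) (Z[q := put_before S (\<chi> ! q) b (Z ! q)])" if "?Q \<noteq> {}"
    proof (rule represents_put_adjacent[OF rep adm b n Q(1)[OF that]])
      have q: "\<chi> ! q = Rgt" using Q(2)[OF that] Lft by (cases "\<chi> ! q") auto
      then show "?k (?n - 1) < ?k (q)" using Lft by (simp add: side_key_less_iff)
      fix i assume i: "i < ?n" "?k (?n - 1) < ?k i"
      then have "\<chi> ! i = Rgt" using Lft le[OF i(1)] by (cases "\<chi> ! i") (auto simp: side_key_less_iff)
      then show "\<not> ?k i < ?k (q)" using Qle[OF i(1)] Lft q by (auto simp: side_key_less_iff)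
    qed
    moreover have "\<chi> ! q = Rgt" if "?Q \<noteq> {}" using Q(2)[OF that] Lft by (cases "\<chi> ! q") auto
    moreover have "\<Theta> \<chi> (one_part \<chi>) (Z[?n - 1 := put_after S (\<chi> ! (?n - 1)) b (Z ! (?n - 1))]) =
        \<Theta> \<chi> (one_part \<chi>) Z * b" if "?Q = {}"
    proof (rule represents_put_max[OF rep adm b n])
      show "\<not> ?k (?n - 1) < ?k i" if "i < ?n" for i
        using all[OF \<open>?Q = {}\<close> that] Lft le[OF that] by (auto simp: side_key_less_iff)
    qed
    ultimately show ?thesis unfolding Let_def q_def[symmetric] using Lft by (simp add: put_after_def put_before_def)
  next
    case Rgt
    have "\<Theta> \<chi> (one_part \<chi>) (Z[q := put_after S (\<chi> ! q) b (Z ! q)]) =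
        \<Theta> \<chi> (one_part \<chi>) (Z[?n - 1 := put_before S (\<chi> ! (?n - 1)) b (Z ! (?n - 1))])" if "?Q \<noteq> {}"
    proof (rule represents_put_adjacent[OF rep adm b Q(1)[OF that] n])
      have q: "\<chi> ! q = Lft" using Q(2)[OF that] Rgt by (cases "\<chi> ! q") auto
      then show "?k (q) < ?k (?n - 1)" using Rgt by (simp add: side_key_less_iff)
      fix i assume i: "i < ?n" "?k (q) < ?k i"
      then have "\<chi> ! i = Rgt" using Qle[OF i(1)] Rgt q by (cases "\<chi> ! i") (auto simp: side_key_less_iff)
      then show "\<not> ?k i < ?k (?n - 1)" using le[OF i(1)] Rgt by (auto simp: side_key_less_iff)
    qed
    moreover have "\<chi> ! q = Lft" if "?Q \<noteq> {}" using Q(2)[OF that] Rgt by (cases "\<chi> ! q") auto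
    moreover have "\<Theta> \<chi> (one_part \<chi>) (Z[?n - 1 := put_before S (\<chi> ! (?n - 1)) b (Z ! (?n - 1))]) =
        b * \<Theta> \<chi> (one_part \<chi>) Z" if "?Q = {}"
    proof (rule represents_put_min[OF rep adm b n])
      show "\<not> ?k i < ?k (?n - 1)" if "i < ?n" for i
        using all[OF \<open>?Q = {}\<close> that] Rgt le[OF that] by (auto simp: side_key_less_iff)
    qed
    ultimately show ?thesis unfolding Let_def q_def[symmetric] using Rgt by (simp add: put_after_def put_before_def)
  qed
qed

text \<open>The preceding index on the same side is a neighbour of \<open>p\<close>: just before it
  on the left side, just after it on the right side. If there is none, \<open>p\<close> is
  extreme.\<close>

lemma bimult_2_represents:
  assumes rep: "represents h \<Theta>" shows "bimult_2 S \<Theta>"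
  unfolding bimult_2_def
proof (intro allI ballI impI)
  fix \<chi> Z b p assume b: "b \<in> B" and p: "p < length \<chi>" and adm: "admissible S \<chi> Z"
  let ?k = "side_key ((!) \<chi>)"
  let ?Q = "{k. k < p \<and> \<chi> ! k = \<chi> ! p}"
  have fin: "finite ?Q" by simp
  define q where "q = Max ?Q"
  have Q: "q < p" "\<chi> ! q = \<chi> ! p" if "?Q \<noteq> {}" using Max_in[OF fin that] by (auto simp: q_def)
  have qn: "q < length \<chi>" if "?Q \<noteq> {}" using Q(1)[OF that] p by simp
  have Qle: "i \<le> q" if "i < p" "\<chi> ! i = \<chi> ! p" for i
    unfolding q_def using that by (intro Max_ge[OF fin]) simp
  show "let Q = {k. k < p \<and> \<chi> ! k = \<chi> ! p}; q = Max Q; \<theta> = \<Theta> \<chi> (one_part \<chi>)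
    in case \<chi> ! p of
      Lft \<Rightarrow> \<theta> (Z[p := L b * Z ! p]) = (if Q \<noteq> {} then \<theta> (Z[q := Z ! q * L b]) else b * \<theta> Z)
    | Rgt \<Rightarrow> \<theta> (Z[p := R b * Z ! p]) = (if Q \<noteq> {} then \<theta> (Z[q := Z ! q * R b]) else \<theta> Z * b)"
  proof (cases "\<chi> ! p")
    case Lft
    have "\<Theta> \<chi> (one_part \<chi>) (Z[q := put_after S (\<chi> ! q) b (Z ! q)]) =
        \<Theta> \<chi> (one_part \<chi>) (Z[p := put_before S (\<chi> ! p) b (Z ! p)])" if "?Q \<noteq> {}"
    proof (rule represents_put_adjacent[OF rep adm b qn[OF that] p])
      show "?k (q) < ?k p" using Q[OF that] Lft by (simp add: side_key_less_iff)
      fix i assume i: "i < length \<chi>" "?k (q) < ?k i"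
      then show "\<not> ?k i < ?k p" using Q(2)[OF that] Qle[of i] Lft by (auto simp: side_key_less_iff)
    qed
    moreover have "\<Theta> \<chi> (one_part \<chi>) (Z[p := put_before S (\<chi> ! p) b (Z ! p)]) = b * \<Theta> \<chi> (one_part \<chi>) Z"
      if "?Q = {}"
    proof (rule represents_put_min[OF rep adm b p])
      show "\<not> ?k i < ?k p" if "i < length \<chi>" for i
        using \<open>?Q = {}\<close> Lft by (auto simp: side_key_less_iff)
    qed
    ultimately show ?thesis unfolding Let_def q_def[symmetric] using Lft Q(2) by (auto simp: put_after_def put_before_def)
  next
    case Rgt
    have "\<Theta> \<chi> (one_part \<chi>) (Z[p := put_after S (\<chi> ! p) b (Z ! p)]) =
        \<Theta> \<chi> (one_part \<chi>) (Z[q := put_before S (\<chi> ! q) b (Z ! q)])" if "?Q \<noteq> {}"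
    proof (rule represents_put_adjacent[OF rep adm b p qn[OF that]])
      show "?k p < ?k (q)" using Q[OF that] Rgt by (simp add: side_key_less_iff)
      fix i assume i: "i < length \<chi>" "?k p < ?k i"
      then show "\<not> ?k i < ?k (q)" using Q(2)[OF that] Qle[of i] Rgt by (auto simp: side_key_less_iff)
    qed
    moreover have "\<Theta> \<chi> (one_part \<chi>) (Z[p := put_after S (\<chi> ! p) b (Z ! p)]) = \<Theta> \<chi> (one_part \<chi>) Z * b"
      if "?Q = {}"
    proof (rule represents_put_max[OF rep adm b p])
      show "\<not> ?k p < ?k i" if "i < length \<chi>" for i
        using \<open>?Q = {}\<close> Rgt by (auto simp: side_key_less_iff)
    qed
    ultimately show ?thesis unfolding Let_def q_def[symmetric] using Rgt Q(2) by (auto simp: put_after_def put_before_def)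
  qed
qed

lemma bimult_3_represents:
  assumes rep: "represents h \<Theta>" shows "bimult_3 S \<Theta>"
  unfolding bimult_3_def
proof (intro allI impI, elim conjE)
  fix \<chi> Z \<pi> Vs
  assume adm: "admissible S \<chi> Z" and \<pi>: "\<pi> \<in> BNC \<chi>" and part: "partition_on {..<length \<chi>} (set Vs)"
    and ord: "chi_ordered \<chi> Vs" and V: "\<forall>V\<in>set Vs. chi_interval \<chi> V \<and> union_of_blocks \<pi> V"
  have "\<Theta> \<chi> \<pi> Z = nested S ((!) \<chi>) h \<pi> ((!) Z)" using representsD(2)[OF rep adm \<pi>] .
  also have "\<dots> = prod_list (map (\<lambda>V. nested S ((!) \<chi>) h {U \<in> \<pi>. U \<subseteq> V} ((!) Z)) Vs)"
  proof (rule nested_concat[OF BNC_noncrossing[OF \<pi>]])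
    show "\<exists>V\<in>set Vs. U \<subseteq> V" if U: "U \<in> \<pi>" for U
    proof -
      obtain u where u: "u \<in> U" using noncrossing_familyD(3)[OF BNC_noncrossing[OF \<pi>] U] by blast
      then have "u \<in> \<Union>(set Vs)" using U BNC_Union[OF \<pi>] partition_onD1[OF part] by blast
      then obtain W where "W \<in> set Vs" "u \<in> W" by blast
      then show ?thesis using block_subset_union_of_blocks[OF \<pi> _ U u] V by blast
    qed
    show "sorted_wrt (\<lambda>V W. \<forall>i\<in>V. \<forall>j\<in>W. side_key ((!) \<chi>) i < side_key ((!) \<chi>) j) Vs"
      using ord unfolding chi_ordered_def
      by (rule sorted_wrt_mono_rel[rotated]) (auto simp: chi_less_iff)
  qed
  also have "\<dots> = prod_list (map (\<lambda>V. \<Theta> (nths \<chi> V) (restr \<pi> V) (nths Z V)) Vs)"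
  proof (intro arg_cong[of _ _ prod_list] map_cong refl)
    fix W assume W: "W \<in> set Vs"
    then have "W \<noteq> {}" using partition_onD3[OF part] by blast
    then show "nested S ((!) \<chi>) h {U \<in> \<pi>. U \<subseteq> W} ((!) Z) = \<Theta> (nths \<chi> W) (restr \<pi> W) (nths Z W)"
      using represents_restr[OF rep adm \<pi>] V W by simp
  qed
  finally show "\<Theta> \<chi> \<pi> Z = prod_list (map (\<lambda>V. \<Theta> (nths \<chi> V) (restr \<pi> V) (nths Z V)) Vs)" .
qed

text \<open>Here \<open>p\<close> and \<open>q\<close> are the points of \<open>W\<close> nearest to
  \<open>V\<close> on either side, which exist because both ends of the order belong to
  \<open>W\<close>. So the insertion lemmas apply to the blocks inside \<open>W\<close> and those
  inside \<open>V\<close>.\<close>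

lemma bimult_4_represents:
  assumes rep: "represents h \<Theta>" and repE: "represents (exp_E S) \<Psi>"
    and H: "\<And>\<chi> \<pi>. H \<chi> \<pi> \<Longrightarrow> h = exp_E S \<or> ends_in_same_block \<chi> \<pi>"
  shows "bimult_4 S H \<Psi> \<Theta>"
  unfolding bimult_4_def
proof (intro allI impI, elim conjE)
  fix \<chi> Z \<pi> V W
  let ?N = "{..<length \<chi>}" and ?k = "side_key ((!) \<chi>)"
  assume adm: "admissible S \<chi> Z" and \<pi>: "\<pi> \<in> BNC \<chi>" and Hp: "H \<chi> \<pi>" and V0: "V \<noteq> {}"
    and disj: "V \<inter> W = {}" and VW: "V \<union> W = ?N"
    and ub: "union_of_blocks \<pi> V" "union_of_blocks \<pi> W" and int: "chi_interval \<chi> V"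
    and ends: "chi_min \<chi> ?N \<in> W" "chi_max \<chi> ?N \<in> W"
  let ?T = "{U \<in> \<pi>. U \<subseteq> V}" and ?Q = "{U \<in> \<pi>. U \<subseteq> W}"
  have N: "?N \<noteq> {}" using ends VW by auto
  have Vn: "V \<subseteq> ?N" and Wn: "W \<subseteq> ?N" using VW by blast+
  have W0: "W \<noteq> {}" using ends by blast
  have lenZ: "length Z = length \<chi>" using adm by (simp add: admissible_def)
  note UT = union_of_blocks_Union[OF ub(1)] and UQ = union_of_blocks_Union[OF ub(2)]
  have kne: "?k x \<noteq> ?k y" if "x \<in> V" "y \<in> W" for x y
    using that disj inj_side_key[of "(!) \<chi>"] by (metis disjoint_iff inj_eq)
  have piQT: "?Q \<union> ?T = \<pi>"
  proof -
    have "U \<subseteq> V \<or> U \<subseteq> W" if U: "U \<in> \<pi>" for U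
    proof -
      obtain u where u: "u \<in> U" using noncrossing_familyD(3)[OF BNC_noncrossing[OF \<pi>] U] by blast
      then have "u \<in> V \<or> u \<in> W" using U BNC_Union[OF \<pi>] VW by blast
      then show ?thesis using block_subset_union_of_blocks[OF \<pi> _ U u] ub by blast
    qed
    then show ?thesis by blast
  qed
  have nc: "noncrossing_family ?k (?Q \<union> ?T)" using BNC_noncrossing[OF \<pi>] piQT by simp
  have T0: "?T \<noteq> {}" using UT V0 by blast
  have admU: "adm ((!) \<chi>) (\<Union>(?Q \<union> ?T)) ((!) Z)" 
    using admissible_adm[OF adm] piQT BNC_Union[OF \<pi>] by simp
  note h = representsD(1)[OF rep]
  define c where "c = \<Psi> (nths \<chi> V) (restr \<pi> V) (nths Z V)"
  have c: "nested S ((!) \<chi>) (exp_E S) ?T ((!) Z) = c"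
    unfolding c_def using represents_restr[OF repE adm \<pi> ub(1) V0] by simp
  have cB: "c \<in> B" unfolding c[symmetric] by simp
  have endsle: "?k (chi_min \<chi> ?N) \<le> ?k x" "?k x \<le> ?k (chi_max \<chi> ?N)" if "x < length \<chi>" for x
    using chi_min(2)[OF subset_refl N] chi_max(2)[OF subset_refl N] that by simp_all
  \<comment> \<open>The block that contains both ends lies in \<open>W\<close>; its ends are
    distinct from all points of \<open>V\<close>, so it encloses \<open>V\<close> strictly.\<close>
  have enc: "h = exp_E S \<or> enclosed ((!) \<chi>) ?Q ?T"
  proof (cases "h = exp_E S")
    case False
    then obtain U where U: "U \<in> \<pi>" "chi_min \<chi> ?N \<in> U" "chi_max \<chi> ?N \<in> U"
      using H[OF Hp] unfolding ends_in_same_block_def by blast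
    have "U \<in> ?Q" using block_subset_union_of_blocks[OF \<pi> ub(2) U(1,2) ends(1)] U(1) by simp
    moreover have "?k (chi_min \<chi> ?N) < ?k x \<and> ?k x < ?k (chi_max \<chi> ?N)" if x: "x \<in> V" for x
      using endsle[of x] kne[OF x ends(1)] kne[OF x ends(2)] x Vn by (simp add: subset_iff less_le)
    ultimately show ?thesis using U(2,3) unfolding enclosed_def UT by blast
  qed simp
  define P where "P = {k \<in> W. chi_less \<chi> k (chi_min \<chi> V)}"
  define P' where "P' = {k \<in> W. chi_less \<chi> (chi_max \<chi> V) k}"
  define p where "p = chi_max \<chi> P"
  define q where "q = chi_min \<chi> P'"
  have v: "chi_min \<chi> V \<in> V" "chi_max \<chi> V \<in> V"
    and vle: "\<And>x. x \<in> V \<Longrightarrow> ?k (chi_min \<chi> V) \<le> ?k x" "\<And>x. x \<in> V \<Longrightarrow> ?k x \<le> ?k (chi_max \<chi> V)"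
    using chi_min[OF Vn V0] chi_max[OF Vn V0] by auto
  have Piff: "y \<in> P \<longleftrightarrow> y \<in> W \<and> ?k y < ?k (chi_min \<chi> V)" for y
    using Wn Vn v by (auto simp: P_def chi_less_iff)
  have P'iff: "y \<in> P' \<longleftrightarrow> y \<in> W \<and> ?k (chi_max \<chi> V) < ?k y" for y
    using Wn Vn v by (auto simp: P'_def chi_less_iff)
  have Pn: "P \<subseteq> ?N" "P' \<subseteq> ?N" using Wn Piff P'iff by blast+
  have "chi_min \<chi> ?N \<in> P" "chi_max \<chi> ?N \<in> P'"
    using endsle(1)[of "chi_min \<chi> V"] endsle(2)[of "chi_max \<chi> V"]
      kne[OF v(1) ends(1)] kne[OF v(2) ends(2)] v Vn ends
    by (simp_all add: Piff P'iff subset_iff less_le)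
  then have P0: "P \<noteq> {}" "P' \<noteq> {}" by blast+
  have pP: "p \<in> P" "\<And>y. y \<in> P \<Longrightarrow> ?k y \<le> ?k p" using chi_max[OF Pn(1) P0(1)] by (auto simp: p_def)
  have qP: "q \<in> P'" "\<And>y. y \<in> P' \<Longrightarrow> ?k q \<le> ?k y" using chi_min[OF Pn(2) P0(2)] by (auto simp: q_def)
  have p: "p \<in> W" "p < length \<chi>" and q: "q \<in> W" "q < length \<chi>"
    using pP(1) qP(1) Wn by (auto simp: Piff P'iff)
  \<comment> \<open>The interval property of \<open>V\<close> enters here: no point of
    \<open>W\<close> separates two points of \<open>V\<close>, so \<open>p\<close> and
    \<open>q\<close> are adjacent to \<open>V\<close> as a whole.\<close>
  have between: False if "x \<in> V" "x' \<in> V" "y \<in> W" "?k x < ?k y" "?k y < ?k x'" for x x' y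
  proof -
    have "chi_less \<chi> x y \<and> chi_less \<chi> y x'" using that Vn Wn by (auto simp: chi_less_iff)
    then have "y \<in> V" using int that(1,2) unfolding chi_interval_def by blast
    then show False using that(3) disj by blast
  qed
  have side: "Z ! i \<in> side_alg S (\<chi> ! i)" if "i < length \<chi>" for i
    using adm that by (simp add: admissible_def)
  have val: "\<Theta> (nths \<chi> W) (restr \<pi> W) (nths (Z[i := z]) W) = nested S ((!) \<chi>) h ?Q (((!) Z)(i := z))"
    if "i < length \<chi>" "z \<in> side_alg S (\<chi> ! i)" for i z
    using represents_restr[OF rep admissible_update[OF adm that] \<pi> ub(2) W0] that(1) lenZ
    by (simp add: nth_list_update_fun)
  have whole: "\<Theta> \<chi> \<pi> Z = nested S ((!) \<chi>) h (?Q \<union> ?T) ((!) Z)"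
    using representsD(2)[OF rep adm \<pi>] piQT by simp
  have "nested S ((!) \<chi>) h (?Q \<union> ?T) ((!) Z) =
      nested S ((!) \<chi>) h ?Q (((!) Z)(p := put_after S (\<chi> ! p) c (Z ! p)))"
    unfolding c[symmetric]
  proof (rule nested_insert_after[OF nc T0 _ admU _ _ h enc], unfold UT UQ)
    show "p \<in> W" by (rule p)
    show px: "?k p < ?k x" if "x \<in> V" for x using pP(1) vle(1)[OF that] by (auto simp: Piff)
    show "?k x < ?k y" if x: "x \<in> V" and y: "y \<in> W" "?k p < ?k y" for x y
    proof (rule ccontr)
      assume "\<not> ?k x < ?k y"
      then have "?k y < ?k x" using kne[OF x y(1)] by simp
      moreover have "\<not> ?k y < ?k (chi_min \<chi> V)" using pP(2)[of y] y by (auto simp: Piff)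
      then have "?k (chi_min \<chi> V) < ?k y" using kne[OF v(1) y(1)] by simp
      ultimately show False using between[OF v(1) x y(1)] by simp
    qed
  qed
  moreover have "nested S ((!) \<chi>) h (?Q \<union> ?T) ((!) Z) =
      nested S ((!) \<chi>) h ?Q (((!) Z)(q := put_before S (\<chi> ! q) c (Z ! q)))"
    unfolding c[symmetric]
  proof (rule nested_insert_before[OF nc T0 _ admU _ _ h enc], unfold UT UQ)
    show "q \<in> W" by (rule q)
    show xq: "?k x < ?k q" if "x \<in> V" for x using qP(1) vle(2)[OF that] by (auto simp: P'iff)
    show "?k y < ?k x" if x: "x \<in> V" and y: "y \<in> W" "?k y < ?k q" for x y
    proof (rule ccontr)
      assume "\<not> ?k y < ?k x"
      then have "?k x < ?k y" using kne[OF x y(1)] by simp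
      moreover have "\<not> ?k (chi_max \<chi> V) < ?k y" using qP(2)[of y] y by (auto simp: P'iff)
      then have "?k y < ?k (chi_max \<chi> V)" using kne[OF v(2) y(1)] by simp
      ultimately show False using between[OF x v(2) y(1)] by simp
    qed
  qed
  ultimately have res:
    "\<Theta> \<chi> \<pi> Z = \<Theta> (nths \<chi> W) (restr \<pi> W) (nths (Z[p := put_after S (\<chi> ! p) c (Z ! p)]) W)"
    "\<Theta> \<chi> \<pi> Z = \<Theta> (nths \<chi> W) (restr \<pi> W) (nths (Z[q := put_before S (\<chi> ! q) c (Z ! q)]) W)"
    unfolding whole val[OF p(2) put_after_side_alg[OF cB side[OF p(2)]]]
      val[OF q(2) put_before_side_alg[OF cB side[OF q(2)]]] by simp_all
  show "let p = chi_max \<chi> {k \<in> W. chi_less \<chi> k (chi_min \<chi> V)};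
      q = chi_min \<chi> {k \<in> W. chi_less \<chi> (chi_max \<chi> V) k};
      c = \<Psi> (nths \<chi> V) (restr \<pi> V) (nths Z V);
      \<theta> = \<lambda>Z'. \<Theta> (nths \<chi> W) (restr \<pi> W) (nths Z' W)
    in \<Theta> \<chi> \<pi> Z = \<theta> (Z[p := case \<chi> ! p of Lft \<Rightarrow> Z ! p * L c | Rgt \<Rightarrow> R c * Z ! p]) \<and>
       \<Theta> \<chi> \<pi> Z = \<theta> (Z[q := case \<chi> ! q of Lft \<Rightarrow> L c * Z ! q | Rgt \<Rightarrow> Z ! q * R c])"
    unfolding Let_def P_def[symmetric] P'_def[symmetric] p_def[symmetric] q_def[symmetric] c_def[symmetric]
    using res unfolding put_after_def put_before_def by blast
qed

lemma moments_cond_bimultiplicative: "cond_bimultiplicative S (E_mom S) (F_mom S)"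
  unfolding cond_bimultiplicative_def
proof (intro conjI allI impI ballI)
  note E = represents_moments(1) and F = represents_moments(2)
  show "E_mom S \<chi> \<pi> Z \<in> alg_B S" if "admissible S \<chi> Z \<and> \<pi> \<in> BNC \<chi>" for \<chi> \<pi> Z
    using that by (simp add: moments_eq_nested)
  fix \<Theta> assume "\<Theta> \<in> {E_mom S, F_mom S}"
  then obtain h where h: "represents h \<Theta>" using E F by auto
  show "multilinear S \<Theta>" "bimult_1 S \<Theta>" "bimult_2 S \<Theta>" "bimult_3 S \<Theta>"
    using multilinear_represents[OF h] bimult_1_represents[OF h] bimult_2_represents[OF h]
      bimult_3_represents[OF h] .
next
  show "bimult_4 S (\<lambda>_ _. True) (E_mom S) (E_mom S)"
    using represents_moments(1,1) by (rule bimult_4_represents) simp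
  show "bimult_4 S ends_in_same_block (E_mom S) (F_mom S)"
    using represents_moments(2,1) by (rule bimult_4_represents) simp
qed

end

theorem theorem4p6:
  fixes S :: "('a::{ring, monoid_mult}, 'd::{ring, monoid_mult}) pair_space"
  assumes "is_pair_space S"
  shows "cond_bimultiplicative S (E_mom S) (F_mom S)"
proof -
  interpret expectation_pair S by unfold_locales (rule assms)
  show ?thesis by (rule moments_cond_bimultiplicative)
qed

end
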